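(* Let $X$ be the homogeneous diffusion with coefficients $a,b$ described in the context, and assume $\Phi(0,+\infty)<+\infty$ and $\Phi(0,-\infty)=-\infty$. Let $f:\mathbb{R}\to\mathbb{R}$ be a measurable function such that $f$ and $f/a^2$ are locally integrable. Then for every $x\in\mathbb{R}$ and every integer $k>1$ $$\left(\mathsf{E}\left[\left|J^x_\infty(f)\right|^k\right]\right)^{1/k}\le 2(k!)^{1/k}\left(\int_x^{+\infty}\frac{|f(u)|}{a(u)^2}\Phi(u,+\infty)\,du+\Phi(x,+\infty)^{1/k}\int_{-\infty}^x\frac{|f(u)|}{a(u)^2}\Phi(u,+\infty)^{1-1/k}\varphi(u,x)^{1/k}\,du\right),$$ where the right-hand side takes values in $[0,+\infty]$ (nothing is asserted when it is $+\infty$).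
   Context: On a complete filtered probability space $(\Omega,\mathcal{F},\{\mathcal{F}_t\}_{t\ge0},\mathsf{P})$ with a standard $\mathcal{F}_t$-Wiener process $W$, consider the family $\{X^x_t,\,t\ge 0,\,x\in\mathbb{R}\}$ of one-dimensional homogeneous diffusion processes $$dX^x_t=b(X^x_t)\,dt+a(X^x_t)\,dW_t,\quad t\ge 0,\qquad X_0^x=x.$$ The coefficients $a,b:\mathbb{R}\to\mathbb{R}$ are continuous, $a(x)\ne 0$ for all $x\in\mathbb{R}$, and they are such that a non-explosive weak solution on $\mathbb{R}$ exists. Define $\varphi(x_0,x)=\exp\left\{-2\int_{x_0}^{x}\frac{b(u)}{a(u)^2}\,du\right\}$ and $\Phi(x_0,x)=\int_{x_0}^x\varphi(x_0,z)\,dz$ for $x_0,x\in\mathbb{R}$, and $\Phi(x_0,\pm\infty)=\lim_{x\to\pm\infty}\Phi(x_0,x)$. Integral functional: $J^x_\infty(f)=\int_0^\infty f(X^x_s)\,ds$. *)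

theory Defs
  imports "HOL-Probability.Probability"
begin

section \<open>Filtered probability spaces and Wiener processes\<close>

text \<open>
  Time is indexed by \<^typ>\<open>real\<close>, and only times \<open>t \<ge> 0\<close> are used. A filtration on
  \<open>[0,\<infinity>)\<close> extends to negative times by \<open>F t = F 0\<close>, so monotonicity on all of \<^typ>\<open>real\<close>
  is no restriction. Right-continuity of the filtration is not assumed.
\<close>

locale complete_filtered_prob_space =
  prob_space M + complete_measure M + filtration "space M" F
  for M :: "'a measure" and F :: "real \<Rightarrow> 'a measure" +
  assumes subalgebra_F: "\<And>t. subalgebra M (F t)"
    and null_sets_F: "null_sets M \<subseteq> sets (F 0)"

definition wiener_process ::
  "'a measure \<Rightarrow> (real \<Rightarrow> 'a measure) \<Rightarrow> (real \<Rightarrow> 'a \<Rightarrow> real) \<Rightarrow> bool" where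
  "wiener_process M F W \<longleftrightarrow>
     (\<forall>t\<ge>0. W t \<in> borel_measurable (F t)) \<and>
     (AE \<omega> in M. W 0 \<omega> = 0) \<and>
     (AE \<omega> in M. continuous_on {0..} (\<lambda>t. W t \<omega>)) \<and>
     (\<forall>s t. 0 \<le> s \<and> s < t \<longrightarrow>
        distributed M lborel (\<lambda>\<omega>. W t \<omega> - W s \<omega>)
          (\<lambda>y. ennreal (normal_density 0 (sqrt (t - s)) y)) \<and>
        prob_space.indep_set M (sets (F s))
          {(\<lambda>\<omega>. W t \<omega> - W s \<omega>) -` A \<inter> space M | A. A \<in> sets borel})"

section \<open>The Ito integral\<close>

text \<open>
  A simple integrand is the finite sum of the processes \<open>\<xi> \<cdot> 1\<^bsub>(u,v]\<^esub>\<close> over the triples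
  \<open>(u, v, \<xi>)\<close> of a list, each \<open>\<xi>\<close> being bounded and \<open>F u\<close>-measurable; the intervals may overlap.
\<close>

type_synonym 'a simple_integrand = "(real \<times> real \<times> ('a \<Rightarrow> real)) list"

definition simple_integrand :: "(real \<Rightarrow> 'a measure) \<Rightarrow> 'a simple_integrand \<Rightarrow> bool" where
  "simple_integrand F S \<longleftrightarrow>
     (\<forall>(u, v, \<xi>) \<in> set S. 0 \<le> u \<and> u \<le> v \<and> \<xi> \<in> borel_measurable (F u) \<and>
        (\<exists>C. \<forall>\<omega> \<in> space (F u). \<bar>\<xi> \<omega>\<bar> \<le> C))"

definition simple_value :: "'a simple_integrand \<Rightarrow> real \<Rightarrow> 'a \<Rightarrow> real" where
  "simple_value S s \<omega> = (\<Sum>(u, v, \<xi>) \<leftarrow> S. \<xi> \<omega> * indicator {u<..v} s)"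

definition simple_ito ::
  "(real \<Rightarrow> 'a \<Rightarrow> real) \<Rightarrow> 'a simple_integrand \<Rightarrow> real \<Rightarrow> 'a \<Rightarrow> real" where
  "simple_ito W S t \<omega> = (\<Sum>(u, v, \<xi>) \<leftarrow> S. \<xi> \<omega> * (W (min t v) \<omega> - W (min t u) \<omega>))"

text \<open>
  Measurability is required explicitly, because \<^const>\<open>measure\<close> is 0 on non-measurable sets.
\<close>

definition null_in_probability :: "'a measure \<Rightarrow> (nat \<Rightarrow> 'a \<Rightarrow> ennreal) \<Rightarrow> bool" where
  "null_in_probability M Y \<longleftrightarrow>
     (\<forall>n. Y n \<in> borel_measurable M) \<and>
     (\<forall>\<epsilon>>0. (\<lambda>n. measure M {\<omega> \<in> space M. Y n \<omega> > ennreal \<epsilon>}) \<longlonglongrightarrow> 0)"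

text \<open>
  \<open>I\<close> is a version of the Ito integral of \<open>H\<close> with respect to \<open>W\<close> over \<open>[0,t]\<close>: the limit in
  probability of the integrals of simple integrands \<open>S n\<close> such that
  \<open>\<integral>\<^sub>0\<^sup>t (S n - H)\<^sup>2 ds\<close> tends to 0 in probability. It is unique up to null sets, and the
  existence of such \<open>S n\<close> forces \<open>\<integral>\<^sub>0\<^sup>t H\<^sup>2 ds < \<infinity>\<close> almost surely.
\<close>

definition has_ito_integral ::
  "'a measure \<Rightarrow> (real \<Rightarrow> 'a measure) \<Rightarrow> (real \<Rightarrow> 'a \<Rightarrow> real) \<Rightarrow> (real \<Rightarrow> 'a \<Rightarrow> real) \<Rightarrow>
   real \<Rightarrow> ('a \<Rightarrow> real) \<Rightarrow> bool" where
  "has_ito_integral M F W H t I \<longleftrightarrow>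
     (\<exists>S. (\<forall>n. simple_integrand F (S n)) \<and>
        null_in_probability M
          (\<lambda>n \<omega>. \<integral>\<^sup>+ s \<in> {0..t}. ennreal ((simple_value (S n) s \<omega> - H s \<omega>)\<^sup>2) \<partial>lborel) \<and>
        null_in_probability M (\<lambda>n \<omega>. ennreal \<bar>simple_ito W (S n) t \<omega> - I \<omega>\<bar>))"

section \<open>One-dimensional homogeneous diffusions\<close>

text \<open>
  \<open>X\<close> solves \<open>dX = b(X) dt + a(X) dW\<close>, \<open>X\<^sub>0 = x\<close>, on the whole of \<open>[0,\<infinity>)\<close>. Non-explosion is
  built in, as \<open>X\<close> is real-valued with continuous paths.
\<close>

definition sde_solution ::
  "'a measure \<Rightarrow> (real \<Rightarrow> 'a measure) \<Rightarrow> (real \<Rightarrow> 'a \<Rightarrow> real) \<Rightarrow>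
   (real \<Rightarrow> real) \<Rightarrow> (real \<Rightarrow> real) \<Rightarrow> real \<Rightarrow> (real \<Rightarrow> 'a \<Rightarrow> real) \<Rightarrow> bool" where
  "sde_solution M F W a b x X \<longleftrightarrow>
     (\<forall>t\<ge>0. X t \<in> borel_measurable (F t)) \<and>
     (AE \<omega> in M. continuous_on {0..} (\<lambda>t. X t \<omega>)) \<and>
     (AE \<omega> in M. X 0 \<omega> = x) \<and>
     (AE \<omega> in M. \<forall>t\<ge>0. set_integrable lborel {0..t} (\<lambda>s. b (X s \<omega>))) \<and>
     (\<forall>t\<ge>0. has_ito_integral M F W (\<lambda>s \<omega>. a (X s \<omega>)) t
        (\<lambda>\<omega>. X t \<omega> - x - (LBINT s=0..t. b (X s \<omega>))))"

definition scale_density :: "(real \<Rightarrow> real) \<Rightarrow> (real \<Rightarrow> real) \<Rightarrow> real \<Rightarrow> real \<Rightarrow> real" where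
  "scale_density a b x0 x = exp (- 2 * (LBINT u=x0..x. b u / (a u)\<^sup>2))"

definition scale_fun :: "(real \<Rightarrow> real) \<Rightarrow> (real \<Rightarrow> real) \<Rightarrow> real \<Rightarrow> real \<Rightarrow> real" where
  "scale_fun a b x0 x = (LBINT z=x0..x. scale_density a b x0 z)"

text \<open>The limits exist in the extended reals, as \<^term>\<open>scale_fun a b x0\<close> is increasing.\<close>

definition scale_fun_top :: "(real \<Rightarrow> real) \<Rightarrow> (real \<Rightarrow> real) \<Rightarrow> real \<Rightarrow> ereal" where
  "scale_fun_top a b x0 = Lim at_top (\<lambda>x. ereal (scale_fun a b x0 x))"

definition scale_fun_bot :: "(real \<Rightarrow> real) \<Rightarrow> (real \<Rightarrow> real) \<Rightarrow> real \<Rightarrow> ereal" where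
  "scale_fun_bot a b x0 = Lim at_bot (\<lambda>x. ereal (scale_fun a b x0 x))"

section \<open>Integral functionals and moments\<close>

definition locally_integrable :: "(real \<Rightarrow> real) \<Rightarrow> bool" where
  "locally_integrable f \<longleftrightarrow> (\<forall>K. compact K \<longrightarrow> set_integrable lborel K f)"

definition integral_functional :: "(real \<Rightarrow> 'a \<Rightarrow> real) \<Rightarrow> (real \<Rightarrow> real) \<Rightarrow> 'a \<Rightarrow> real" where
  "integral_functional X f \<omega> = (LINT s:{0..}|lborel. f (X s \<omega>))"

text \<open>Powers on \<open>[0,\<infinity>]\<close>, for exponents \<open>p > 0\<close>.\<close>

definition ennreal_rpow :: "ennreal \<Rightarrow> real \<Rightarrow> ennreal" where
  "ennreal_rpow y p = (if y = \<top> then \<top> else ennreal (enn2real y powr p))"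

definition moment_bound ::
  "(real \<Rightarrow> real) \<Rightarrow> (real \<Rightarrow> real) \<Rightarrow> (real \<Rightarrow> real) \<Rightarrow> nat \<Rightarrow> real \<Rightarrow> ennreal" where
  "moment_bound a b f k x =
     (let \<Phi> = (\<lambda>u. e2ennreal (scale_fun_top a b u)); p = 1 / real k in
      ennreal (2 * fact k powr p) *
      ((\<integral>\<^sup>+ u \<in> {x..}. ennreal (\<bar>f u\<bar> / (a u)\<^sup>2) * \<Phi> u \<partial>lborel) +
       ennreal_rpow (\<Phi> x) p *
       (\<integral>\<^sup>+ u \<in> {..x}. ennreal (\<bar>f u\<bar> / (a u)\<^sup>2) * ennreal_rpow (\<Phi> u) (1 - p) *
          ennreal (scale_density a b u x powr p) \<partial>lborel)))"

end

theory Submission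
  imports Defs
begin

text \<open>
  Write \<open>s u = \<Phi>(0,\<infinity>) - \<Phi>(0,u)\<close>, and let \<open>G\<close> be the Green operator of \<open>X\<close>, with kernel
  \<open>2 min(s x, s u) / (\<phi>(0,u) a(u)\<^sup>2)\<close>. For a continuous \<open>\<psi> \<ge> 0\<close> with compact support, \<open>G \<psi>\<close> is
  positive, twice continuously differentiable, and the generator maps it to \<open>- \<psi>\<close>. An Euler scheme with
  the coefficients frozen along \<open>X\<close> itself, compared with \<open>X\<close> through the definition of the Ito
  integral, shows that \<open>E (\<xi> \<integral>\<^sub>r\<^sup>T \<psi>(X\<^sub>s) ds) \<le> E (\<xi> G \<psi>(X\<^sub>r))\<close> for bounded \<open>\<F>\<^sub>r\<close>-measurable
  \<open>\<xi> \<ge> 0\<close>. Neither the Ito formula, nor stopping times, nor the Markov property is needed: for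
  \<open>A = \<integral> g(X\<^sub>s) ds\<close>, the identity \<open>(A\<^sub>T - A\<^sub>r)\<^sup>j\<^sup>+\<^sup>1 = (j+1) \<integral>\<^sub>r\<^sup>T g(X\<^sub>s) (A\<^sub>T - A\<^sub>s)\<^sup>j ds\<close> turns the
  inequality for the first moment into bounds of all moments by the iterates \<open>u\<^sub>j\<^sub>+\<^sub>1 = (j+1) G (g u\<^sub>j)\<close>.
  With \<open>p(x,u) = min(1, s x / s u)\<close>, the probability of hitting \<open>u\<close> from \<open>x\<close>, the inequality
  \<open>p(x,u) p(u,v) \<le> p(x,v)\<close> gives by induction
  \<open>u\<^sub>k x \<le> k! (\<integral> 2 g(u) s(u) p(x,u)\<^sup>1\<^sup>/\<^sup>k / (\<phi>(0,u) a(u)\<^sup>2) du)\<^sup>k\<close>, which is the asserted bound.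
\<close>


section \<open>Wiener increments\<close>

text \<open>Ito integrals are given only as limits in probability, so the scheme and
  \<open>X\<close> can be compared only in probability; a tail bound of Lenglart type, rather than
  the isometry alone, therefore carries the comparison. Convergence in probability is enough because
  the test functions are cut off so as to have bounded, uniformly continuous derivatives: a rare
  event on which the scheme is far from \<open>X\<close> costs at most a constant times its
  probability. The coefficients are merely continuous; evaluating them along \<open>X\<close> turns
  the distance to \<open>X\<close> into quadrature errors, which the continuity of the paths
  controls. All inequalities point one way: the cut-off function lies below \<open>G \<psi>\<close>,
  and the nonnegative terminal value is dropped. The bounded weight \<open>\<xi>\<close> plays the
  part of conditioning on the past. The exponent \<open>1/k\<close> makes the last induction close:
  with \<open>h = p^(1/k)\<close> the Green kernel contains \<open>p = h^k\<close>, which is at most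
  \<open>h * h^j\<close> for \<open>j < k\<close>; one factor stays in the integral, and the other
  \<open>j\<close> move the starting point of the previous bound from \<open>u\<close> back to
  \<open>x\<close>.\<close>

locale wiener_space = complete_filtered_prob_space M F
  for M :: "'a measure" and F :: "real \<Rightarrow> 'a measure" +
  fixes W :: "real \<Rightarrow> 'a \<Rightarrow> real"
  assumes wiener: "wiener_process M F W"
begin

lemma F_mono:
  assumes "f \<in> borel_measurable (F s)" "s \<le> t"
  shows "f \<in> borel_measurable (F t)"
  using assms(1) sets_F_mono[OF assms(2)] space_F
  by (auto simp: measurable_def)

lemma F_measurable: "f \<in> borel_measurable (F s) \<Longrightarrow> f \<in> borel_measurable M"
  using subalgebra_F measurable_from_subalg by blast

lemma W_adapted: "0 \<le> t \<Longrightarrow> W t \<in> borel_measurable (F t)"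
  using wiener by (auto simp: wiener_process_def)

lemma W_measurable: "0 \<le> t \<Longrightarrow> W t \<in> borel_measurable M"
  using W_adapted F_measurable by blast

context
  fixes s t :: real and \<xi> :: "'a \<Rightarrow> real"
  assumes st: "0 \<le> s" "s < t"
begin

lemma increment_distributed:
  "distributed M lborel (\<lambda>\<omega>. W t \<omega> - W s \<omega>) (\<lambda>y. ennreal (normal_density 0 (sqrt (t - s)) y))"
  using wiener st by (auto simp: wiener_process_def)

text \<open>The second moment drives the isometry; the fourth pays for the quartic part of the
  Taylor remainder in \<open>taylor_bound\<close>.\<close>

lemma increment_moments:
  shows "integrable M (\<lambda>\<omega>. (W t \<omega> - W s \<omega>) ^ n)"
    and "expectation (\<lambda>\<omega>. W t \<omega> - W s \<omega>) = 0"
    and "expectation (\<lambda>\<omega>. (W t \<omega> - W s \<omega>)\<^sup>2) = t - s"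
    and "expectation (\<lambda>\<omega>. (W t \<omega> - W s \<omega>) ^ 4) = 3 * (t - s)\<^sup>2"
proof -
  let ?\<sigma> = "sqrt (t - s)"
  have \<sigma>: "?\<sigma> > 0" using st by simp
  note D = increment_distributed
  show "integrable M (\<lambda>\<omega>. (W t \<omega> - W s \<omega>) ^ n)"
    using distributed_integrable[OF D, of "\<lambda>x. x ^ n"] integrable_normal_moment[OF \<sigma>, of 0 n] by simp
  show "expectation (\<lambda>\<omega>. W t \<omega> - W s \<omega>) = 0"
    using distributed_integral[OF D, of "\<lambda>x. x"] integral_normal_moment_odd[OF \<sigma>, of 0 0] by simp
  have p2: "((2::real) / ?\<sigma>\<^sup>2) = 2 / (t - s)" using st by simp
  show "expectation (\<lambda>\<omega>. (W t \<omega> - W s \<omega>)\<^sup>2) = t - s"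
    using distributed_integral[OF D, of "\<lambda>x. x ^ 2"] integral_normal_moment_even[OF \<sigma>, of 0 1] st
    by (simp add: p2)
  have "fact 4 / ((2 / (t - s))\<^sup>2 * fact 2) = 3 * (t - s)\<^sup>2"
  proof -
    have "(2 / (t - s))\<^sup>2 * fact 2 = 8 / (t - s)\<^sup>2" by (simp add: power_divide)
    moreover have "(fact 4 :: real) = 24" by (simp add: fact_numeral)
    ultimately show ?thesis by simp
  qed
  then show "expectation (\<lambda>\<omega>. (W t \<omega> - W s \<omega>) ^ 4) = 3 * (t - s)\<^sup>2"
    using distributed_integral[OF D, of "\<lambda>x. x ^ 4"] integral_normal_moment_even[OF \<sigma>, of 0 2] st
    by (simp add: p2)
qed

lemma increment_indep:
  assumes \<xi>: "\<xi> \<in> borel_measurable (F s)"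
  shows "indep_var borel \<xi> borel (\<lambda>\<omega>. W t \<omega> - W s \<omega>)"
proof -
  let ?Z = "\<lambda>\<omega>. W t \<omega> - W s \<omega>"
  let ?B = "{?Z -` A \<inter> space M | A. A \<in> sets borel}"
  have ind: "indep_set (sets (F s)) ?B"
    using wiener st by (auto simp: wiener_process_def)
  have "{\<xi> -` A \<inter> space M | A. A \<in> sets borel} \<subseteq> sets (F s)"
    using measurable_sets[OF \<xi>] space_F by auto
  then have sub1: "sigma_sets (space M) {\<xi> -` A \<inter> space M | A. A \<in> sets borel} \<subseteq> sets (F s)"
    using sets.sigma_sets_subset[of _ "F s"] by (simp add: space_F)
  \<comment> \<open>The preimages of all Borel sets already form a sigma-algebra, so the
    independence in \<open>wiener_process\<close> is that of the generated sigma-algebra.\<close>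
  have sub2: "sigma_sets (space M) ?B = ?B"
    using sets_vimage_algebra2[of ?Z "space M" borel] sets_vimage_algebra[of "space M" ?Z borel] by simp
  have "random_variable borel \<xi>" "random_variable borel ?Z"
    using F_measurable[OF \<xi>] W_measurable st by auto
  moreover have "indep_set (sigma_sets (space M) {\<xi> -` A \<inter> space M | A. A \<in> sets borel}) (sigma_sets (space M) ?B)"
    using ind sub1 unfolding sub2 indep_sets2_eq by blast
  ultimately show ?thesis
    unfolding indep_var_eq by blast
qed

text \<open>Independence in place of conditioning on \<open>F s\<close>. Only integrability of
  \<open>\<xi>\<close> is asked for, because the lemma will be applied to unbounded partial sums of
  stochastic integrals.\<close>

lemma increment_product:
  assumes \<xi>: "\<xi> \<in> borel_measurable (F s)" and int: "integrable M \<xi>"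
  shows "integrable M (\<lambda>\<omega>. \<xi> \<omega> * (W t \<omega> - W s \<omega>) ^ n)"
    and "expectation (\<lambda>\<omega>. \<xi> \<omega> * (W t \<omega> - W s \<omega>)) = 0"
    and "expectation (\<lambda>\<omega>. \<xi> \<omega> * (W t \<omega> - W s \<omega>)\<^sup>2) = expectation \<xi> * (t - s)"
proof -
  have ind: "indep_var borel \<xi> borel (\<lambda>\<omega>. (W t \<omega> - W s \<omega>) ^ n)" for n
    using indep_var_compose[OF increment_indep[OF \<xi>], of "\<lambda>x. x" borel "\<lambda>x. x ^ n" borel]
    by (simp add: comp_def)
  show "integrable M (\<lambda>\<omega>. \<xi> \<omega> * (W t \<omega> - W s \<omega>) ^ n)"
    using indep_var_integrable[OF ind int increment_moments(1)] .
  have *: "expectation (\<lambda>\<omega>. \<xi> \<omega> * (W t \<omega> - W s \<omega>) ^ n)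
      = expectation \<xi> * expectation (\<lambda>\<omega>. (W t \<omega> - W s \<omega>) ^ n)" for n
    using indep_var_lebesgue_integral[OF ind int increment_moments(1)] .
  show "expectation (\<lambda>\<omega>. \<xi> \<omega> * (W t \<omega> - W s \<omega>)) = 0"
    using *[of 1] increment_moments(2) by simp
  show "expectation (\<lambda>\<omega>. \<xi> \<omega> * (W t \<omega> - W s \<omega>)\<^sup>2) = expectation \<xi> * (t - s)"
    using *[of 2] increment_moments(3) by simp
qed

end

end

section \<open>Stochastic integrals of simple integrands\<close>

context wiener_space
begin

lemma integrable_bounded_times:
  fixes g c :: "'a \<Rightarrow> real"
  assumes "integrable M g" "c \<in> borel_measurable M" "\<And>\<omega>. \<omega> \<in> space M \<Longrightarrow> \<bar>c \<omega>\<bar> \<le> C"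
  shows "integrable M (\<lambda>\<omega>. c \<omega> * g \<omega>)"
proof (rule Bochner_Integration.integrable_bound[where f="\<lambda>\<omega>. C * g \<omega>"])
  show "AE \<omega> in M. norm (c \<omega> * g \<omega>) \<le> norm (C * g \<omega>)"
  proof (rule AE_I2)
    fix \<omega> assume "\<omega> \<in> space M"
    then have "\<bar>c \<omega>\<bar> \<le> \<bar>C\<bar>" using assms(3)[of \<omega>] by linarith
    then show "norm (c \<omega> * g \<omega>) \<le> norm (C * g \<omega>)"
      by (simp add: abs_mult mult_right_mono)
  qed
qed (use assms in auto)

section \<open>Sums over a deterministic grid: isometry and tail bound\<close>

context
  fixes p :: "nat \<Rightarrow> real" and m :: nat
  assumes p0: "0 \<le> p 0" and p_step: "\<And>i. i < m \<Longrightarrow> p i < p (Suc i)"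
begin

lemma grid_mono: "i \<le> j \<Longrightarrow> j \<le> m \<Longrightarrow> p i \<le> p j"
proof (induction j)
  case (Suc j)
  then show ?case using p_step[of j] by (cases "i = Suc j") auto
qed simp

lemma grid_nonneg: "i \<le> m \<Longrightarrow> 0 \<le> p i"
  using grid_mono[of 0 i] p0 by simp

text \<open>Expand the square of \<open>Z (Suc n)\<close>. The cross term vanishes because
  \<open>c n \<omega> * Z n \<omega>\<close> is known at time \<open>p n\<close> and is multiplied
  by the next increment. Measurability and integrability travel through the induction with the
  identity, as the cross term needs both.\<close>

lemma grid_ito_isometry:
  fixes c :: "nat \<Rightarrow> 'a \<Rightarrow> real" and C :: real
  assumes "\<And>i. i < m \<Longrightarrow> c i \<in> borel_measurable (F (p i))"
    and "\<And>i \<omega>. i < m \<Longrightarrow> \<omega> \<in> space M \<Longrightarrow> \<bar>c i \<omega>\<bar> \<le> C" and "n \<le> m"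
  defines "Z \<equiv> \<lambda>n \<omega>. \<Sum>i<n. c i \<omega> * (W (p (Suc i)) \<omega> - W (p i) \<omega>)"
  shows "Z n \<in> borel_measurable (F (p n)) \<and> integrable M (Z n) \<and> integrable M (\<lambda>\<omega>. (Z n \<omega>)\<^sup>2) \<and>
    expectation (\<lambda>\<omega>. (Z n \<omega>)\<^sup>2) = expectation (\<lambda>\<omega>. \<Sum>i<n. (c i \<omega>)\<^sup>2 * (p (Suc i) - p i))"
  using \<open>n \<le> m\<close>
proof (induction n)
  case 0
  then show ?case by (simp add: Z_def)
next
  case (Suc n)
  then have n: "n < m" and IH: "Z n \<in> borel_measurable (F (p n))" "integrable M (Z n)"
    "integrable M (\<lambda>\<omega>. (Z n \<omega>)\<^sup>2)"
    "expectation (\<lambda>\<omega>. (Z n \<omega>)\<^sup>2) = expectation (\<lambda>\<omega>. \<Sum>i<n. (c i \<omega>)\<^sup>2 * (p (Suc i) - p i))"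
    by auto
  have pn: "0 \<le> p n" "p n < p (Suc n)" using grid_nonneg p_step n by auto
  let ?D = "\<lambda>\<omega>. W (p (Suc n)) \<omega> - W (p n) \<omega>"
  have c_meas: "c i \<in> borel_measurable M" if "i < m" for i
    using assms(1)[OF that] F_measurable by blast
  have cint: "integrable M (c n)"
    using assms(2)[OF n] c_meas[OF n] by (intro integrable_const_bound[where B=C]) auto
  have c2int: "integrable M (\<lambda>\<omega>. (c i \<omega>)\<^sup>2)" if "i < m" for i
  proof (rule integrable_const_bound[where B="C\<^sup>2"])
    show "AE \<omega> in M. norm ((c i \<omega>)\<^sup>2) \<le> C\<^sup>2"
    proof (rule AE_I2)
      fix \<omega> assume "\<omega> \<in> space M"
      then show "norm ((c i \<omega>)\<^sup>2) \<le> C\<^sup>2"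
        using power_mono[OF assms(2)[OF that, of \<omega>], of 2] by simp
    qed
  qed (use c_meas[OF that] in auto)
  have Zc_int: "integrable M (\<lambda>\<omega>. c n \<omega> * Z n \<omega>)"
    using integrable_bounded_times[OF IH(2) c_meas[OF n] assms(2)[OF n]] by blast
  have Fc: "c n \<in> borel_measurable (F (p n))" using assms(1)[OF n] .
  have eq: "Z (Suc n) = (\<lambda>\<omega>. Z n \<omega> + c n \<omega> * ?D \<omega>)" by (auto simp: Z_def)
  have sq: "(\<lambda>\<omega>. (Z (Suc n) \<omega>)\<^sup>2) = (\<lambda>\<omega>. (Z n \<omega>)\<^sup>2 + 2 * ((c n \<omega> * Z n \<omega>) * ?D \<omega>) + (c n \<omega>)\<^sup>2 * (?D \<omega>)\<^sup>2)"
    by (auto simp: eq power2_eq_square algebra_simps)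
  note i1 = increment_product(1)[OF pn Fc cint, of 1]
  note i2 = increment_product(1)[OF pn _ Zc_int, of 1] increment_product(2)[OF pn _ Zc_int]
  note i3 = increment_product(1)[OF pn _ c2int[OF n], of 2] increment_product(3)[OF pn _ c2int[OF n]]
  have m: "Z (Suc n) \<in> borel_measurable (F (p (Suc n)))"
    unfolding eq using F_mono[OF IH(1), of "p (Suc n)"] F_mono[OF Fc, of "p (Suc n)"]
      W_adapted[of "p (Suc n)"] F_mono[OF W_adapted[of "p n"], of "p (Suc n)"] pn
    by (intro borel_measurable_add borel_measurable_times borel_measurable_diff) auto
  have int1: "integrable M (Z (Suc n))"
    unfolding eq using IH(2) i1 by auto
  have int2: "integrable M (\<lambda>\<omega>. (c n \<omega> * Z n \<omega>) * ?D \<omega>)" "expectation (\<lambda>\<omega>. (c n \<omega> * Z n \<omega>) * ?D \<omega>) = 0"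
    using i2 Fc IH(1) by auto
  have int3: "integrable M (\<lambda>\<omega>. (c n \<omega>)\<^sup>2 * (?D \<omega>)\<^sup>2)"
    "expectation (\<lambda>\<omega>. (c n \<omega>)\<^sup>2 * (?D \<omega>)\<^sup>2) = expectation (\<lambda>\<omega>. (c n \<omega>)\<^sup>2) * (p (Suc n) - p n)"
    using i3 Fc by auto
  have int4: "integrable M (\<lambda>\<omega>. (Z (Suc n) \<omega>)\<^sup>2)"
    unfolding sq using IH(3) int2 int3 by auto
  have "expectation (\<lambda>\<omega>. (Z (Suc n) \<omega>)\<^sup>2)
      = expectation (\<lambda>\<omega>. (Z n \<omega>)\<^sup>2) + expectation (\<lambda>\<omega>. (c n \<omega>)\<^sup>2) * (p (Suc n) - p n)"
    unfolding sq using IH(3) int2 int3 by simp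
  also have "\<dots> = expectation (\<lambda>\<omega>. \<Sum>i<Suc n. (c i \<omega>)\<^sup>2 * (p (Suc i) - p i))"
  proof -
    have "integrable M (\<lambda>\<omega>. \<Sum>i<n. (c i \<omega>)\<^sup>2 * (p (Suc i) - p i))"
      using c2int n by (intro Bochner_Integration.integrable_sum integrable_mult_left) auto
    then show ?thesis unfolding IH(4) using c2int[OF n] by simp
  qed
  finally show ?case using m int1 int4 by blast
qed

text \<open>Lenglart's inequality. Coefficients are set to 0 as soon as the quadratic variation
  would pass \<open>\<delta>\<close>; the truncated sum has second moment at most
  \<open>\<delta>\<close>, so Chebyshev applies to it, and where \<open>V m\<close> is at most
  \<open>\<delta>\<close> nothing has been truncated.\<close>

lemma grid_tail_bound:
  fixes c :: "nat \<Rightarrow> 'a \<Rightarrow> real" and C :: real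
  assumes "\<And>i. i < m \<Longrightarrow> c i \<in> borel_measurable (F (p i))"
    and "\<And>i \<omega>. i < m \<Longrightarrow> \<omega> \<in> space M \<Longrightarrow> \<bar>c i \<omega>\<bar> \<le> C"
    and B: "B \<in> sets M" and "\<delta> \<ge> 0" "\<epsilon> > 0"
  defines "Z \<equiv> \<lambda>\<omega>. \<Sum>i<m. c i \<omega> * (W (p (Suc i)) \<omega> - W (p i) \<omega>)"
    and "V \<equiv> \<lambda>n \<omega>. \<Sum>i<n. (c i \<omega>)\<^sup>2 * (p (Suc i) - p i)"
  shows "prob {\<omega> \<in> B. \<bar>Z \<omega>\<bar> > \<epsilon>} \<le> \<delta> / \<epsilon>\<^sup>2 + prob {\<omega> \<in> B. V m \<omega> > \<delta>}"
proof -
  \<comment> \<open>\<open>V (Suc i)\<close> includes the i-th cell and is still known at time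
    \<open>p i\<close>, because the coefficient of a cell is fixed at its left end. Hence
    \<open>d\<close> is again adapted.\<close>
  define d where "d i \<omega> = (if V (Suc i) \<omega> \<le> \<delta> then c i \<omega> else 0)" for i \<omega>
  define Z' where "Z' = (\<lambda>\<omega>. \<Sum>i<m. d i \<omega> * (W (p (Suc i)) \<omega> - W (p i) \<omega>))"
  have V_meas: "V (Suc i) \<in> borel_measurable (F (p i))" if "i < m" for i
    unfolding V_def
  proof (intro borel_measurable_sum borel_measurable_times borel_measurable_power borel_measurable_const)
    fix j assume "j \<in> {..<Suc i}"
    then show "c j \<in> borel_measurable (F (p i))"
      using F_mono[OF assms(1)[of j], of "p i"] grid_mono[of j i] that by auto
  qed
  have d_meas: "d i \<in> borel_measurable (F (p i))" if "i < m" for i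
    unfolding d_def using V_meas[OF that] assms(1)[OF that]
    by (intro measurable_If) auto
  have C0: "\<bar>c i \<omega>\<bar> \<le> C \<Longrightarrow> \<bar>d i \<omega>\<bar> \<le> C" for i \<omega>
    by (auto simp: d_def)
  have V_mono: "V i \<omega> \<le> V j \<omega>" if "i \<le> j" "j \<le> m" for i j \<omega>
    unfolding V_def using that p_step by (intro sum_mono2) (auto simp: less_imp_le)
  \<comment> \<open>The bound by \<open>V n\<close> carries the induction: a new term enters only if
    \<open>V (Suc n)\<close> is still at most \<open>\<delta>\<close>.\<close>
  have dV: "(\<Sum>i<n. (d i \<omega>)\<^sup>2 * (p (Suc i) - p i)) \<le> min \<delta> (V n \<omega>)" if "n \<le> m" for n \<omega>
    using that
  proof (induction n)
    case 0 then show ?case using \<open>\<delta> \<ge> 0\<close> by (simp add: V_def)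
  next
    case (Suc n)
    have "V (Suc n) \<omega> = V n \<omega> + (c n \<omega>)\<^sup>2 * (p (Suc n) - p n)" by (simp add: V_def)
    moreover have "(c n \<omega>)\<^sup>2 * (p (Suc n) - p n) \<ge> 0" using p_step[of n] Suc by simp
    ultimately show ?case using Suc by (auto simp: d_def)
  qed
  have iso: "Z' \<in> borel_measurable (F (p m)) \<and> integrable M Z' \<and> integrable M (\<lambda>\<omega>. (Z' \<omega>)\<^sup>2) \<and>
    expectation (\<lambda>\<omega>. (Z' \<omega>)\<^sup>2) = expectation (\<lambda>\<omega>. \<Sum>i<m. (d i \<omega>)\<^sup>2 * (p (Suc i) - p i))"
    unfolding Z'_def by (rule grid_ito_isometry[where c=d and C=C and n=m]) (use d_meas C0 assms(2) in auto)
  have "expectation (\<lambda>\<omega>. (Z' \<omega>)\<^sup>2) \<le> \<delta>"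
  proof -
    have "expectation (\<lambda>\<omega>. \<Sum>i<m. (d i \<omega>)\<^sup>2 * (p (Suc i) - p i)) \<le> expectation (\<lambda>\<omega>. \<delta>)"
      using dV[of m] \<open>\<delta> \<ge> 0\<close> by (intro integral_mono_AE') auto
    then show ?thesis using iso by (simp add: prob_space)
  qed
  then have tail: "prob {\<omega> \<in> space M. (Z' \<omega>)\<^sup>2 \<ge> \<epsilon>\<^sup>2} \<le> \<delta> / \<epsilon>\<^sup>2"
    using integral_Markov_inequality_measure[of M "\<lambda>\<omega>. (Z' \<omega>)\<^sup>2" "{}" "\<epsilon>\<^sup>2"] iso \<open>\<epsilon> > 0\<close>
    by (simp add: divide_right_mono order_trans)
  have [measurable]: "Z' \<in> borel_measurable M" using iso by auto
  have Vm[measurable]: "V m \<in> borel_measurable M"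
    unfolding V_def using F_measurable[OF assms(1)] by (intro borel_measurable_sum) auto
  have "{\<omega> \<in> B. \<bar>Z \<omega>\<bar> > \<epsilon>} \<subseteq> {\<omega> \<in> space M. (Z' \<omega>)\<^sup>2 \<ge> \<epsilon>\<^sup>2} \<union> {\<omega> \<in> B. V m \<omega> > \<delta>}"
  proof
    fix \<omega> assume \<omega>: "\<omega> \<in> {\<omega> \<in> B. \<bar>Z \<omega>\<bar> > \<epsilon>}"
    show "\<omega> \<in> {\<omega> \<in> space M. (Z' \<omega>)\<^sup>2 \<ge> \<epsilon>\<^sup>2} \<union> {\<omega> \<in> B. V m \<omega> > \<delta>}"
    proof (cases "V m \<omega> \<le> \<delta>")
      case True
      then have "d i \<omega> = c i \<omega>" if "i < m" for i
        using V_mono[of "Suc i" m \<omega>] that by (auto simp: d_def)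
      then have "Z' \<omega> = Z \<omega>" by (simp add: Z_def Z'_def)
      moreover have "\<epsilon>\<^sup>2 \<le> (Z \<omega>)\<^sup>2"
        using \<omega> \<open>\<epsilon> > 0\<close> by (intro abs_le_square_iff[THEN iffD1]) auto
      ultimately show ?thesis using \<omega> sets.sets_into_space[OF B] by auto
    qed (use \<omega> in auto)
  qed
  moreover have S1: "{\<omega> \<in> space M. (Z' \<omega>)\<^sup>2 \<ge> \<epsilon>\<^sup>2} \<in> sets M" by measurable
  moreover have S2: "{\<omega> \<in> B. V m \<omega> > \<delta>} \<in> sets M"
  proof -
    have "{\<omega> \<in> B. V m \<omega> > \<delta>} = B \<inter> {\<omega> \<in> space M. V m \<omega> > \<delta>}" using sets.sets_into_space[OF B] by auto
    also have "\<dots> \<in> sets M" using B by auto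
    finally show ?thesis .
  qed
  ultimately have "prob {\<omega> \<in> B. \<bar>Z \<omega>\<bar> > \<epsilon>} \<le> prob ({\<omega> \<in> space M. (Z' \<omega>)\<^sup>2 \<ge> \<epsilon>\<^sup>2} \<union> {\<omega> \<in> B. V m \<omega> > \<delta>})"
    by (intro finite_measure_mono) auto
  also have "\<dots> \<le> prob {\<omega> \<in> space M. (Z' \<omega>)\<^sup>2 \<ge> \<epsilon>\<^sup>2} + prob {\<omega> \<in> B. V m \<omega> > \<delta>}"
    using S1 S2 by (intro measure_Un_le) auto
  finally show ?thesis using tail by linarith
qed

end


section \<open>Simple integrands on a common grid\<close>

lemma simple_value_append: "simple_value (S @ S') s \<omega> = simple_value S s \<omega> + simple_value S' s \<omega>"
  by (simp add: simple_value_def)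

lemma simple_ito_append: "simple_ito V (S @ S') t \<omega> = simple_ito V S t \<omega> + simple_ito V S' t \<omega>"
  by (simp add: simple_ito_def)

lemma simple_integrand_append:
  "simple_integrand F (S @ S') \<longleftrightarrow> simple_integrand F S \<and> simple_integrand F S'"
  by (simp add: simple_integrand_def ball_Un)

lemma simple_value_Cons:
  "simple_value ((u, v, \<xi>) # S) s \<omega> = \<xi> \<omega> * indicator {u<..v} s + simple_value S s \<omega>"
  by (simp add: simple_value_def)

lemma simple_ito_Cons:
  "simple_ito V ((u, v, \<xi>) # S) t \<omega> = \<xi> \<omega> * (V (min t v) \<omega> - V (min t u) \<omega>) + simple_ito V S t \<omega>"
  by (simp add: simple_ito_def)

lemma simple_value_Nil [simp]: "simple_value [] s \<omega> = 0"
  by (simp add: simple_value_def)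

lemma simple_ito_Nil [simp]: "simple_ito V [] s \<omega> = 0"
  by (simp add: simple_ito_def)

lemma simple_integrand_Nil [simp]: "simple_integrand F []"
  by (simp add: simple_integrand_def)

lemma simple_integrand_Cons:
  "simple_integrand F ((u, v, \<xi>) # S) \<longleftrightarrow>
    (0 \<le> u \<and> u \<le> v \<and> \<xi> \<in> borel_measurable (F u) \<and> (\<exists>C. \<forall>\<omega> \<in> space M. \<bar>\<xi> \<omega>\<bar> \<le> C)) \<and> simple_integrand F S"
  by (auto simp: simple_integrand_def space_F)

lemma simple_value_measurable [measurable]: "(\<lambda>s. simple_value S s \<omega>) \<in> borel_measurable borel"
proof (induction S)
  case (Cons a S)
  then show ?case by (cases a) (simp add: simple_value_Cons)
qed simp

lemma simple_ito_measurable: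
  assumes "simple_integrand F S" "0 \<le> t"
  shows "simple_ito W S t \<in> borel_measurable M"
  using assms(1)
proof (induction S)
  case Nil
  then show ?case by (simp add: simple_ito_def)
next
  case (Cons a S)
  obtain u v \<xi> where a: "a = (u, v, \<xi>)" by (cases a)
  have "\<xi> \<in> borel_measurable M" "0 \<le> u" "u \<le> v" "simple_ito W S t \<in> borel_measurable M"
    using Cons F_measurable by (auto simp: a simple_integrand_Cons)
  moreover have "simple_ito W (a # S) t = (\<lambda>\<omega>. \<xi> \<omega> * (W (min t v) \<omega> - W (min t u) \<omega>) + simple_ito W S t \<omega>)"
    by (auto simp: a simple_ito_Cons)
  ultimately show ?case
    using W_measurable[of "min t v"] W_measurable[of "min t u"] \<open>0 \<le> t\<close> by simp
qed

lemma simple_value_bounded: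
  assumes "simple_integrand F S"
  shows "\<exists>C. \<forall>s. \<forall>\<omega> \<in> space M. \<bar>simple_value S s \<omega>\<bar> \<le> C"
  using assms
proof (induction S)
  case Nil
  then show ?case by auto
next
  case (Cons a S)
  obtain u v \<xi> where a: "a = (u, v, \<xi>)" by (cases a)
  obtain C C' where C: "\<forall>s. \<forall>\<omega> \<in> space M. \<bar>simple_value S s \<omega>\<bar> \<le> C" "\<forall>\<omega> \<in> space M. \<bar>\<xi> \<omega>\<bar> \<le> C'"
    using Cons by (auto simp: a simple_integrand_Cons)
  have "\<bar>simple_value (a # S) s \<omega>\<bar> \<le> C' + C" if "\<omega> \<in> space M" for s \<omega>
  proof -
    have "\<bar>\<xi> \<omega> * indicator {u<..v} s\<bar> \<le> \<bar>\<xi> \<omega>\<bar>" by (simp add: indicator_def)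
    moreover have "\<bar>\<xi> \<omega>\<bar> \<le> C'" "\<bar>simple_value S s \<omega>\<bar> \<le> C" using C that by auto
    ultimately show ?thesis unfolding a simple_value_Cons by linarith
  qed
  then show ?case by blast
qed

text \<open>The grid consists of 0, \<open>t\<close> and all end points cut at \<open>t\<close>,
  sorted without repetition. For \<open>t = 0\<close> it is a single point and
  \<open>m = 0\<close>.\<close>

lemma simple_integrand_grid:
  assumes S: "simple_integrand F S" and t: "0 \<le> t"
  obtains p m where "p 0 = 0" "p m = t" "\<And>i. i < m \<Longrightarrow> p i < p (Suc i)"
    "\<And>u v \<xi>. (u, v, \<xi>) \<in> set S \<Longrightarrow> min t u \<in> p ` {..m} \<and> min t v \<in> p ` {..m}"
proof -
  define P where "P = insert 0 (insert t ((\<lambda>(u, v, \<xi>). min t u) ` set S \<union> (\<lambda>(u, v, \<xi>). min t v) ` set S))"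
  define xs where "xs = sorted_list_of_set P"
  have fin: "finite P" by (simp add: P_def)
  have xs: "set xs = P" "sorted xs" "distinct xs" using fin by (auto simp: xs_def)
  have P0: "0 \<le> q \<and> q \<le> t" if "q \<in> P" for q
    using that S t by (force simp: P_def simple_integrand_def)
  have ne: "xs \<noteq> []" using xs by (auto simp: P_def)
  define m where "m = length xs - 1"
  have len: "length xs = Suc m" using ne by (simp add: m_def)
  have strict: "xs ! i < xs ! Suc i" if "i < m" for i
    using xs(2,3) that len by (simp add: sorted_iff_nth_mono nth_eq_iff_index_eq order_le_neq_trans)
  have img: "(!) xs ` {..m} = P"
    using xs(1) len by (auto simp: set_conv_nth less_Suc_eq_le image_iff)
  have "xs ! 0 \<le> q \<and> q \<le> xs ! m" if "q \<in> P" for q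
  proof -
    have "q \<in> (!) xs ` {..m}" using that img by simp
    then obtain i where "i \<le> m" "q = xs ! i" by auto
    then show ?thesis using xs(2) len by (auto simp: sorted_iff_nth_mono)
  qed
  moreover have "0 \<in> P" "t \<in> P" "xs ! 0 \<in> P" "xs ! m \<in> P" using img by (auto simp: P_def)
  ultimately have "xs ! 0 = 0" "xs ! m = t" using P0 by (simp_all add: antisym)
  moreover have "min t u \<in> (!) xs ` {..m} \<and> min t v \<in> (!) xs ` {..m}" if "(u, v, \<xi>) \<in> set S" for u v \<xi>
    unfolding img P_def using that by (force simp: image_iff)
  ultimately show ?thesis using that[of "(!) xs" m] strict by blast
qed

context
  fixes p :: "nat \<Rightarrow> real" and m :: nat and t :: real
  assumes p0: "p 0 = 0" and pm: "p m = t" and p_step: "\<And>i. i < m \<Longrightarrow> p i < p (Suc i)"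
begin

lemma grid_mono': "i \<le> j \<Longrightarrow> j \<le> m \<Longrightarrow> p i \<le> p j"
  using grid_mono[of p m i j] p0 p_step by simp

lemma grid_le_t: "i \<le> m \<Longrightarrow> p i \<le> t"
  using grid_mono'[of i m] pm by simp

lemma grid_less_iff: "i \<le> m \<Longrightarrow> j \<le> m \<Longrightarrow> p i < p j \<longleftrightarrow> i < j"
proof
  show "p i < p j \<Longrightarrow> i < j" if "i \<le> m" "j \<le> m"
    using grid_mono'[of j i] that by (meson leD leI)
  show "i < j \<Longrightarrow> p i < p j" if "i \<le> m" "j \<le> m"
    using grid_mono'[of "Suc i" j] p_step[of i] that by simp
qed

text \<open>No end point lies inside a cell, so the indicator is constant on it. The cells are open
  on the left like the intervals \<open>(u,v]\<close>, which makes the right end point the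
  representative.\<close>

lemma indicator_grid:
  assumes "min t u \<in> p ` {..m}" "min t v \<in> p ` {..m}" "i < m" "p i < s" "s \<le> p (Suc i)"
  shows "indicator {u<..v} s = (indicator {u<..v} (p (Suc i)) :: real)"
proof -
  obtain \<alpha> \<beta> where ab: "min t u = p \<alpha>" "min t v = p \<beta>" "\<alpha> \<le> m" "\<beta> \<le> m"
    using assms by auto
  have si: "s \<le> t" "p (Suc i) \<le> t" using grid_le_t[of "Suc i"] assms by auto
  have ge: "p (Suc i) \<le> p j" if "\<not> j \<le> i" "j \<le> m" for j
    using grid_mono'[of "Suc i" j] that by simp
  have le: "p j \<le> p i" if "j \<le> i" for j
    using grid_mono'[of j i] that assms(3) by simp
  have "u < s \<longleftrightarrow> \<alpha> \<le> i" "u < p (Suc i) \<longleftrightarrow> \<alpha> \<le> i"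
    using si ab(1) ge[OF _ ab(3)] le[of \<alpha>] assms(4,5) by (cases "\<alpha> \<le> i"; linarith)+
  moreover have "s \<le> v \<longleftrightarrow> \<not> \<beta> \<le> i" "p (Suc i) \<le> v \<longleftrightarrow> \<not> \<beta> \<le> i"
    using si ab(2) ge[OF _ ab(4)] le[of \<beta>] assms(4,5) by (cases "\<beta> \<le> i"; linarith)+
  ultimately show ?thesis by (auto simp: indicator_def)
qed

text \<open>The cells inside \<open>(u,v]\<close> are consecutive, running from
  \<open>\<alpha>\<close> to \<open>\<beta>\<close>, and their increments telescope.\<close>

lemma increment_grid:
  fixes V :: "real \<Rightarrow> 'a \<Rightarrow> real"
  assumes "min t u \<in> p ` {..m}" "min t v \<in> p ` {..m}" "u \<le> v"
  shows "V (min t v) \<omega> - V (min t u) \<omega>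
    = (\<Sum>i<m. indicator {u<..v} (p (Suc i)) * (V (p (Suc i)) \<omega> - V (p i) \<omega>))"
proof -
  obtain \<alpha> \<beta> where ab: "min t u = p \<alpha>" "min t v = p \<beta>" "\<alpha> \<le> m" "\<beta> \<le> m"
    using assms by auto
  have le: "\<alpha> \<le> \<beta>"
    using grid_less_iff[of \<beta> \<alpha>] ab \<open>u \<le> v\<close> by linarith
  have ind: "indicator {u<..v} (p (Suc i)) = (if i \<in> {\<alpha>..<\<beta>} then 1 else (0::real))" if "i < m" for i
  proof -
    have "p (Suc i) \<le> t" using grid_le_t[of "Suc i"] that by auto
    then have "u < p (Suc i) \<longleftrightarrow> p \<alpha> < p (Suc i)" "p (Suc i) \<le> v \<longleftrightarrow> p (Suc i) \<le> p \<beta>"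
      using ab by linarith+
    then show ?thesis
      using grid_less_iff[of \<alpha> "Suc i"] grid_less_iff[of \<beta> "Suc i"] ab that
      by (auto simp: indicator_def not_less[symmetric] less_Suc_eq_le)
  qed
  have "(\<Sum>i<m. indicator {u<..v} (p (Suc i)) * (V (p (Suc i)) \<omega> - V (p i) \<omega>))
      = (\<Sum>i<m. if i \<in> {\<alpha>..<\<beta>} then V (p (Suc i)) \<omega> - V (p i) \<omega> else 0)"
    by (intro sum.cong refl) (simp add: ind)
  also have "\<dots> = (\<Sum>i\<in>{\<alpha>..<\<beta>}. V (p (Suc i)) \<omega> - V (p i) \<omega>)"
  proof -
    have "{..<m} \<inter> {\<alpha>..<\<beta>} = {\<alpha>..<\<beta>}" using ab by auto
    then show ?thesis by (subst sum.inter_restrict[symmetric]) auto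
  qed
  also have "\<dots> = V (p \<beta>) \<omega> - V (p \<alpha>) \<omega>"
    by (rule sum_Suc_diff'[OF le])
  finally show ?thesis using ab by simp
qed

lemma simple_value_grid:
  assumes "\<And>u v \<xi>. (u, v, \<xi>) \<in> set S \<Longrightarrow> min t u \<in> p ` {..m} \<and> min t v \<in> p ` {..m}"
    and "i < m" "p i < s" "s \<le> p (Suc i)"
  shows "simple_value S s \<omega> = simple_value S (p (Suc i)) \<omega>"
  using assms(1)
proof (induction S)
  case (Cons a S)
  obtain u v \<xi> where a: "a = (u, v, \<xi>)" by (cases a)
  have "indicator {u<..v} s = (indicator {u<..v} (p (Suc i)) :: real)"
    using Cons(2)[of u v \<xi>] assms(2-4) by (intro indicator_grid) (auto simp: a)
  moreover have "simple_value S s \<omega> = simple_value S (p (Suc i)) \<omega>"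
    by (rule Cons.IH) (use Cons.prems in auto)
  ultimately show ?case by (simp add: a simple_value_Cons)
qed simp

lemma simple_ito_grid:
  assumes "\<And>u v \<xi>. (u, v, \<xi>) \<in> set S \<Longrightarrow> min t u \<in> p ` {..m} \<and> min t v \<in> p ` {..m}"
    and "simple_integrand F S"
  shows "simple_ito W S t \<omega> = (\<Sum>i<m. simple_value S (p (Suc i)) \<omega> * (W (p (Suc i)) \<omega> - W (p i) \<omega>))"
  using assms
proof (induction S)
  case (Cons a S)
  obtain u v \<xi> where a: "a = (u, v, \<xi>)" by (cases a)
  have "W (min t v) \<omega> - W (min t u) \<omega> = (\<Sum>i<m. indicator {u<..v} (p (Suc i)) * (W (p (Suc i)) \<omega> - W (p i) \<omega>))"
    using Cons(2)[of u v \<xi>] Cons(3) by (intro increment_grid) (auto simp: a simple_integrand_Cons)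
  moreover have "simple_ito W S t \<omega> = (\<Sum>i<m. simple_value S (p (Suc i)) \<omega> * (W (p (Suc i)) \<omega> - W (p i) \<omega>))"
    by (rule Cons.IH) (use Cons.prems in \<open>auto simp: a simple_integrand_Cons\<close>)
  ultimately show ?case
    by (simp only: a simple_value_Cons simple_ito_Cons sum_distrib_left distrib_right sum.distrib mult.assoc)
qed simp

text \<open>Although the value is read off at the right end \<open>p (Suc i)\<close>, it is known at
  \<open>p i\<close>: a term contributes only if \<open>u < p (Suc i)\<close>, and \<open>u\<close>
  is then itself a grid point, so that \<open>u \<le> p i\<close>.\<close>

lemma simple_value_grid_measurable:
  assumes "\<And>u v \<xi>. (u, v, \<xi>) \<in> set S \<Longrightarrow> min t u \<in> p ` {..m} \<and> min t v \<in> p ` {..m}"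
    and "simple_integrand F S" "i < m"
  shows "simple_value S (p (Suc i)) \<in> borel_measurable (F (p i))"
  using assms(1,2)
proof (induction S)
  case Nil
  then show ?case by (simp add: simple_value_def)
next
  case (Cons a S)
  obtain u v \<xi> where a: "a = (u, v, \<xi>)" by (cases a)
  obtain \<alpha> where ab: "min t u = p \<alpha>" "\<alpha> \<le> m"
    using Cons(2)[of u v \<xi>] by (auto simp: a)
  have "(\<lambda>\<omega>. \<xi> \<omega> * indicator {u<..v} (p (Suc i))) \<in> borel_measurable (F (p i))"
  proof (cases "u < p (Suc i)")
    case True
    then have "p \<alpha> < p (Suc i)" using ab by linarith
    then have "\<alpha> \<le> i" using grid_less_iff[of \<alpha> "Suc i"] ab \<open>i < m\<close> by auto
    moreover have "u = p \<alpha>" using ab(1) True grid_le_t[of "Suc i"] \<open>i < m\<close> by simp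
    ultimately have "u \<le> p i" using grid_mono'[of \<alpha> i] \<open>i < m\<close> by simp
    moreover have "\<xi> \<in> borel_measurable (F u)" using Cons(3) by (simp add: a simple_integrand_Cons)
    ultimately have "\<xi> \<in> borel_measurable (F (p i))" using F_mono by blast
    then show ?thesis by (intro borel_measurable_times borel_measurable_const)
  next
    case False
    then show ?thesis by simp
  qed
  moreover have "simple_value S (p (Suc i)) \<in> borel_measurable (F (p i))"
    by (rule Cons.IH) (use Cons.prems in \<open>auto simp: a simple_integrand_Cons\<close>)
  ultimately have "(\<lambda>\<omega>. \<xi> \<omega> * indicator {u<..v} (p (Suc i)) + simple_value S (p (Suc i)) \<omega>) \<in> borel_measurable (F (p i))"
    by (rule borel_measurable_add)
  then show ?case
    unfolding a simple_value_Cons[abs_def] by simp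
qed

text \<open>The cells are disjoint, so at each \<open>s\<close> at most one summand is nonzero, and
  there it equals the square of the value at \<open>s\<close>.\<close>

lemma simple_value_grid_integral:
  assumes "\<And>u v \<xi>. (u, v, \<xi>) \<in> set S \<Longrightarrow> min t u \<in> p ` {..m} \<and> min t v \<in> p ` {..m}"
  shows "ennreal (\<Sum>i<m. (simple_value S (p (Suc i)) \<omega>)\<^sup>2 * (p (Suc i) - p i))
    \<le> (\<integral>\<^sup>+ s \<in> {0..t}. ennreal ((simple_value S s \<omega>)\<^sup>2) \<partial>lborel)"
proof -
  let ?c = "\<lambda>i. (simple_value S (p (Suc i)) \<omega>)\<^sup>2"
  have "ennreal (\<Sum>i<m. ?c i * (p (Suc i) - p i)) = (\<Sum>i<m. ennreal (?c i * (p (Suc i) - p i)))"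
    using p_step by (intro sum_ennreal[symmetric] mult_nonneg_nonneg) (auto simp: less_imp_le)
  also have "\<dots> = (\<Sum>i<m. \<integral>\<^sup>+ s. ennreal (?c i) * indicator {p i<..p (Suc i)} s \<partial>lborel)"
    using p_step by (intro sum.cong refl) (simp add: nn_integral_cmult ennreal_mult less_imp_le)
  also have "\<dots> = (\<integral>\<^sup>+ s. (\<Sum>i<m. ennreal (?c i) * indicator {p i<..p (Suc i)} s) \<partial>lborel)"
    by (rule nn_integral_sum[symmetric]) simp
  also have "\<dots> \<le> (\<integral>\<^sup>+ s \<in> {0..t}. ennreal ((simple_value S s \<omega>)\<^sup>2) \<partial>lborel)"
  proof (rule nn_integral_mono)
    fix s
    show "(\<Sum>i<m. ennreal (?c i) * indicator {p i<..p (Suc i)} s) \<le> ennreal ((simple_value S s \<omega>)\<^sup>2) * indicator {0..t} s"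
    proof (cases "\<exists>j<m. s \<in> {p j<..p (Suc j)}")
      case True
      then obtain j where j: "j < m" "s \<in> {p j<..p (Suc j)}" by blast
      have other: "s \<notin> {p i<..p (Suc i)}" if "i < m" "i \<noteq> j" for i
      proof (cases "i < j")
        case True
        then show ?thesis using grid_mono'[of "Suc i" j] j that by auto
      next
        case False
        then show ?thesis using grid_mono'[of "Suc j" i] j that by auto
      qed
      have "(\<Sum>i<m. ennreal (?c i) * indicator {p i<..p (Suc i)} s) = (\<Sum>i<m. if i = j then ennreal (?c j) else 0)"
        using other j by (intro sum.cong refl) (auto simp: indicator_def)
      also have "\<dots> = ennreal (?c j)" using j by simp
      also have "\<dots> = ennreal ((simple_value S s \<omega>)\<^sup>2)"
        using simple_value_grid[where S=S and i=j and s=s and \<omega>=\<omega>] assms j by simp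
      finally show ?thesis
        using j grid_mono'[of 0 j] grid_le_t[of "Suc j"] p0 by (auto simp: indicator_def)
    next
      case False
      then have "(\<Sum>i<m. ennreal (?c i) * indicator {p i<..p (Suc i)} s) = 0"
        by (intro sum.neutral) auto
      then show ?thesis by simp
    qed
  qed
  finally show ?thesis .
qed

end

text \<open>\<open>Q\<close> will collect the events on which an approximation in probability is
  still bad; outside \<open>Q\<close> the quadratic variation is bounded pathwise, so
  \<open>Q\<close> enters only through its probability.\<close>

lemma simple_ito_tail_bound:
  assumes S: "simple_integrand F S" and t: "0 \<le> t" and B: "B \<in> sets M" and Q: "Q \<in> sets M"
    and le: "\<And>\<omega>. \<omega> \<in> B - Q \<Longrightarrow> (\<integral>\<^sup>+ s \<in> {0..t}. ennreal ((simple_value S s \<omega>)\<^sup>2) \<partial>lborel) \<le> ennreal \<delta>"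
    and "\<delta> \<ge> 0" "\<epsilon> > 0"
  shows "prob {\<omega> \<in> B. \<bar>simple_ito W S t \<omega>\<bar> > \<epsilon>} \<le> \<delta> / \<epsilon>\<^sup>2 + prob Q"
proof -
  obtain p m where p: "p 0 = 0" "p m = t" "\<And>i. i < m \<Longrightarrow> p i < p (Suc i)"
    and *: "\<And>u v \<xi>. (u, v, \<xi>) \<in> set S \<Longrightarrow> min t u \<in> p ` {..m} \<and> min t v \<in> p ` {..m}"
    using simple_integrand_grid[OF S t] by blast
  obtain C where C: "\<forall>s. \<forall>\<omega> \<in> space M. \<bar>simple_value S s \<omega>\<bar> \<le> C"
    using simple_value_bounded[OF S] by blast
  let ?V = "\<lambda>\<omega>. \<Sum>i<m. (simple_value S (p (Suc i)) \<omega>)\<^sup>2 * (p (Suc i) - p i)"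
  have eq: "simple_ito W S t \<omega> = (\<Sum>i<m. simple_value S (p (Suc i)) \<omega> * (W (p (Suc i)) \<omega> - W (p i) \<omega>))" for \<omega>
    by (rule simple_ito_grid) (use p * S in auto)
  have "prob {\<omega> \<in> B. \<bar>simple_ito W S t \<omega>\<bar> > \<epsilon>} \<le> \<delta> / \<epsilon>\<^sup>2 + prob {\<omega> \<in> B. ?V \<omega> > \<delta>}"
    unfolding eq
    by (rule grid_tail_bound[where C=C])
      (use p C B \<open>\<delta> \<ge> 0\<close> \<open>\<epsilon> > 0\<close> simple_value_grid_measurable[OF p * S] in auto)
  also have "prob {\<omega> \<in> B. ?V \<omega> > \<delta>} \<le> prob Q"
  proof (rule finite_measure_mono)
    show "{\<omega> \<in> B. ?V \<omega> > \<delta>} \<subseteq> Q"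
    proof
      fix \<omega> assume \<omega>: "\<omega> \<in> {\<omega> \<in> B. ?V \<omega> > \<delta>}"
      show "\<omega> \<in> Q"
      proof (rule ccontr)
        assume "\<omega> \<notin> Q"
        have "ennreal (?V \<omega>) \<le> (\<integral>\<^sup>+ s \<in> {0..t}. ennreal ((simple_value S s \<omega>)\<^sup>2) \<partial>lborel)"
          by (rule simple_value_grid_integral) (use p * in auto)
        also have "\<dots> \<le> ennreal \<delta>"
          using le[of \<omega>] \<omega> \<open>\<omega> \<notin> Q\<close> by simp
        finally have "ennreal (?V \<omega>) \<le> ennreal \<delta>" .
        then show False using \<omega> \<open>\<delta> \<ge> 0\<close> by (simp add: ennreal_le_iff)
      qed
    qed
  qed (rule Q)
  finally show ?thesis by simp
qed

end

section \<open>Increments of Ito integrals defined by limits in probability\<close>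

lemma null_in_probability_sets:
  assumes "null_in_probability M Y"
  shows "{\<omega> \<in> space M. Y n \<omega> > c} \<in> sets M"
proof -
  have [measurable]: "Y n \<in> borel_measurable M"
    using assms by (simp add: null_in_probability_def)
  show ?thesis by measurable
qed

lemma null_in_probability_tendsto:
  "null_in_probability M Y \<Longrightarrow> \<epsilon> > 0 \<Longrightarrow> (\<lambda>n. measure M {\<omega> \<in> space M. Y n \<omega> > ennreal \<epsilon>}) \<longlonglongrightarrow> 0"
  by (simp add: null_in_probability_def)

context wiener_space
begin

lemma simple_integrand_neg:
  assumes "simple_integrand F S"
  obtains S' where "simple_integrand F S'" "\<And>s \<omega>. simple_value S' s \<omega> = - simple_value S s \<omega>"
    "\<And>t \<omega>. simple_ito W S' t \<omega> = - simple_ito W S t \<omega>"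
proof -
  define S' where "S' = map (\<lambda>(u, v, \<xi>). (u, v, \<lambda>\<omega>. - \<xi> \<omega>)) S"
  have "simple_integrand F S'"
    using assms unfolding S'_def by (induction S) (auto simp: simple_integrand_Cons)
  moreover have "simple_value S' s \<omega> = - simple_value S s \<omega>" for s \<omega>
    unfolding S'_def by (induction S) (auto simp: simple_value_Cons)
  moreover have "simple_ito W S' t \<omega> = - simple_ito W S t \<omega>" for t \<omega>
    unfolding S'_def by (induction S) (auto simp: simple_ito_Cons)
  ultimately show ?thesis by (rule that)
qed

lemma simple_integrand_clip:
  assumes "simple_integrand F S"
  obtains S' where "simple_integrand F S'" "\<And>s \<omega>. simple_value S' s \<omega> = (if s \<le> r then simple_value S s \<omega> else 0)"
    "\<And>t \<omega>. r \<le> t \<Longrightarrow> simple_ito W S' t \<omega> = simple_ito W S r \<omega>"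
proof -
  \<comment> \<open>The outer \<open>max u\<close> turns an interval lying beyond \<open>r\<close>
    into the empty \<open>(u,u]\<close>, which keeps the required order of the end points.\<close>
  define S' where "S' = map (\<lambda>(u, v, \<xi>). (u, max u (min v r), \<xi>)) S"
  have "simple_integrand F S'"
    using assms unfolding S'_def by (induction S) (auto simp: simple_integrand_Cons)
  moreover have "simple_value S' s \<omega> = (if s \<le> r then simple_value S s \<omega> else 0)" for s \<omega>
    unfolding S'_def by (induction S) (auto simp: simple_value_Cons indicator_def)
  moreover have "simple_ito W S' t \<omega> = simple_ito W S r \<omega>" if "r \<le> t" for t \<omega>
    using assms that unfolding S'_def
  proof (induction S)
    case (Cons a S)
    obtain u v \<xi> where a: "a = (u, v, \<xi>)" by (cases a)
    have "u \<le> v" using Cons(2) by (simp add: a simple_integrand_Cons)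
    then have "W (min t (max u (min v r))) \<omega> - W (min t u) \<omega> = W (min r v) \<omega> - W (min r u) \<omega>"
      using \<open>r \<le> t\<close> by (cases "u \<le> r") (auto simp: max_def min_def)
    then show ?case using Cons by (simp add: a simple_ito_Cons simple_integrand_Cons)
  qed simp
  ultimately show ?thesis by (rule that)
qed

text \<open>Subtracting approximating integrands of \<open>H\<close> on \<open>[0,t]\<close> and on \<open>[0,r]\<close> leaves a single simple
  integrand, to which the tail bound applies.\<close>

lemma ito_increment_tail_bound:
  assumes rt: "0 \<le> r" "r \<le> t"
    and I: "has_ito_integral M F W H t I" "I \<in> borel_measurable M"
    and J: "has_ito_integral M F W H r J" "J \<in> borel_measurable M"
    and H: "\<And>\<omega>. \<omega> \<in> space M \<Longrightarrow> (\<lambda>s. H s \<omega>) \<in> borel_measurable borel"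
    and S: "simple_integrand F S" "\<And>s \<omega>. s \<le> r \<Longrightarrow> simple_value S s \<omega> = 0"
    and B: "B \<in> sets M" and Q: "Q \<in> sets M"
    and le: "\<And>\<omega>. \<omega> \<in> B - Q \<Longrightarrow>
      (\<integral>\<^sup>+ s \<in> {r<..t}. ennreal ((simple_value S s \<omega> - H s \<omega>)\<^sup>2) \<partial>lborel) \<le> ennreal \<delta>"
    and "\<delta> > 0" "\<epsilon> > 0"
  shows "prob {\<omega> \<in> B. \<bar>simple_ito W S t \<omega> - (I \<omega> - J \<omega>)\<bar> > 3 * \<epsilon>} \<le> 6 * \<delta> / \<epsilon>\<^sup>2 + prob Q"
proof -
  obtain S1 where S1: "\<And>n. simple_integrand F (S1 n)"
    and Y1: "null_in_probability M (\<lambda>n \<omega>. \<integral>\<^sup>+ s \<in> {0..t}. ennreal ((simple_value (S1 n) s \<omega> - H s \<omega>)\<^sup>2) \<partial>lborel)"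
    and Z1: "null_in_probability M (\<lambda>n \<omega>. ennreal \<bar>simple_ito W (S1 n) t \<omega> - I \<omega>\<bar>)"
    using I unfolding has_ito_integral_def by blast
  obtain S2 where S2: "\<And>n. simple_integrand F (S2 n)"
    and Y2: "null_in_probability M (\<lambda>n \<omega>. \<integral>\<^sup>+ s \<in> {0..r}. ennreal ((simple_value (S2 n) s \<omega> - H s \<omega>)\<^sup>2) \<partial>lborel)"
    and Z2: "null_in_probability M (\<lambda>n \<omega>. ennreal \<bar>simple_ito W (S2 n) r \<omega> - J \<omega>\<bar>)"
    using J unfolding has_ito_integral_def by blast
  let ?Y1 = "\<lambda>n \<omega>. \<integral>\<^sup>+ s \<in> {0..t}. ennreal ((simple_value (S1 n) s \<omega> - H s \<omega>)\<^sup>2) \<partial>lborel"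
  let ?Y2 = "\<lambda>n \<omega>. \<integral>\<^sup>+ s \<in> {0..r}. ennreal ((simple_value (S2 n) s \<omega> - H s \<omega>)\<^sup>2) \<partial>lborel"
  let ?Z1 = "\<lambda>n \<omega>. ennreal \<bar>simple_ito W (S1 n) t \<omega> - I \<omega>\<bar>"
  let ?Z2 = "\<lambda>n \<omega>. ennreal \<bar>simple_ito W (S2 n) r \<omega> - J \<omega>\<bar>"
  \<comment> \<open>The four events on which the n-th approximations are still bad; for fixed
    \<open>\<delta>\<close> and \<open>\<epsilon>\<close> their probabilities tend to 0.\<close>
  define y1 where "y1 n = {\<omega> \<in> space M. ?Y1 n \<omega> > ennreal \<delta>}" for n
  define y2 where "y2 n = {\<omega> \<in> space M. ?Y2 n \<omega> > ennreal \<delta>}" for n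
  define z1 where "z1 n = {\<omega> \<in> space M. ?Z1 n \<omega> > ennreal \<epsilon>}" for n
  define z2 where "z2 n = {\<omega> \<in> space M. ?Z2 n \<omega> > ennreal \<epsilon>}" for n
  have sets: "y1 n \<in> sets M" "y2 n \<in> sets M" "z1 n \<in> sets M" "z2 n \<in> sets M" for n
    unfolding y1_def y2_def z1_def z2_def
    by (intro null_in_probability_sets Y1 Y2 Z1 Z2)+
  have lims: "(\<lambda>n. prob (y1 n)) \<longlonglongrightarrow> 0" "(\<lambda>n. prob (y2 n)) \<longlonglongrightarrow> 0"
    "(\<lambda>n. prob (z1 n)) \<longlonglongrightarrow> 0" "(\<lambda>n. prob (z2 n)) \<longlonglongrightarrow> 0"
    unfolding y1_def y2_def z1_def z2_def
    by (intro null_in_probability_tendsto Y1 Y2 Z1 Z2 \<open>\<delta> > 0\<close> \<open>\<epsilon> > 0\<close>)+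
  let ?A = "{\<omega> \<in> B. \<bar>simple_ito W S t \<omega> - (I \<omega> - J \<omega>)\<bar> > 3 * \<epsilon>}"
  have bound: "prob ?A \<le> 6 * \<delta> / \<epsilon>\<^sup>2 + prob Q + (prob (y1 n) + prob (y2 n) + prob (z1 n) + prob (z2 n))" for n
  proof -
    obtain N1 where N1: "simple_integrand F N1" "\<And>s \<omega>. simple_value N1 s \<omega> = - simple_value (S1 n) s \<omega>"
      "\<And>t \<omega>. simple_ito W N1 t \<omega> = - simple_ito W (S1 n) t \<omega>"
      using simple_integrand_neg[OF S1] by blast
    obtain N2 where N2: "simple_integrand F N2"
      "\<And>s \<omega>. simple_value N2 s \<omega> = (if s \<le> r then simple_value (S2 n) s \<omega> else 0)"
      "\<And>t \<omega>. r \<le> t \<Longrightarrow> simple_ito W N2 t \<omega> = simple_ito W (S2 n) r \<omega>"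
      using simple_integrand_clip[OF S2[of n], where r=r] by blast
    \<comment> \<open>The integral of \<open>D\<close> is that of \<open>S\<close> minus the n-th
      approximation of \<open>I - J\<close>. Its value on \<open>[0,t]\<close> is always a
      difference of two approximation errors, so \<open>H\<close> cancels: on \<open>[0,r]\<close>
      the errors of \<open>S2 n\<close> and \<open>S1 n\<close>, on \<open>(r,t]\<close> those of
      \<open>S\<close> and \<open>S1 n\<close>.\<close>
    define D where "D = S @ N1 @ N2"
    have D: "simple_integrand F D" using S N1 N2 by (simp add: D_def simple_integrand_append)
    have ito: "simple_ito W D t \<omega> = simple_ito W S t \<omega> - simple_ito W (S1 n) t \<omega> + simple_ito W (S2 n) r \<omega>" for \<omega>
      using N1(3) N2(3) rt by (simp add: D_def simple_ito_append)
    have val: "simple_value D s \<omega> = simple_value S s \<omega> - simple_value (S1 n) s \<omega> + (if s \<le> r then simple_value (S2 n) s \<omega> else 0)" for s \<omega>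
      using N1(2) N2(2) by (simp add: D_def simple_value_append)
    have pt: "ennreal ((simple_value D s \<omega>)\<^sup>2) * indicator {0..t} s
      \<le> 2 * (ennreal ((simple_value S s \<omega> - H s \<omega>)\<^sup>2) * indicator {r<..t} s
        + ennreal ((simple_value (S1 n) s \<omega> - H s \<omega>)\<^sup>2) * indicator {0..t} s
        + ennreal ((simple_value (S2 n) s \<omega> - H s \<omega>)\<^sup>2) * indicator {0..r} s)" for s \<omega>
    proof -
      have sq: "(x - y)\<^sup>2 \<le> 2 * (x\<^sup>2 + y\<^sup>2)" for x y :: real
        using sum_squares_bound[of x "-y"] by (simp add: power2_diff)
      have en: "ennreal x \<le> 2 * (ennreal y + ennreal z)" if "x \<le> 2 * (y + z)" "0 \<le> y" "0 \<le> z" for x y z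
        using that by (metis add_nonneg_nonneg ennreal_leI ennreal_mult ennreal_numeral ennreal_plus zero_le_numeral)
      consider "s \<in> {0..r}" | "s \<in> {r<..t}" | "s \<notin> {0..t}" using rt by force
      then show ?thesis
      proof cases
        case 1
        then have "simple_value D s \<omega> = (simple_value (S2 n) s \<omega> - H s \<omega>) - (simple_value (S1 n) s \<omega> - H s \<omega>)"
          using S(2) by (simp add: val)
        then have "ennreal ((simple_value D s \<omega>)\<^sup>2) \<le> 2 * (ennreal ((simple_value (S1 n) s \<omega> - H s \<omega>)\<^sup>2)
            + ennreal ((simple_value (S2 n) s \<omega> - H s \<omega>)\<^sup>2))"
          by (intro en) (use sq[of "simple_value (S2 n) s \<omega> - H s \<omega>" "simple_value (S1 n) s \<omega> - H s \<omega>"] in auto)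
        then show ?thesis using 1 rt by simp
      next
        case 2
        then have "simple_value D s \<omega> = (simple_value S s \<omega> - H s \<omega>) - (simple_value (S1 n) s \<omega> - H s \<omega>)"
          by (simp add: val)
        then have "ennreal ((simple_value D s \<omega>)\<^sup>2) \<le> 2 * (ennreal ((simple_value S s \<omega> - H s \<omega>)\<^sup>2)
            + ennreal ((simple_value (S1 n) s \<omega> - H s \<omega>)\<^sup>2))"
          by (intro en) (use sq[of "simple_value S s \<omega> - H s \<omega>" "simple_value (S1 n) s \<omega> - H s \<omega>"] in auto)
        then show ?thesis using 2 rt by simp
      qed simp
    qed
    let ?QQ = "Q \<union> y1 n \<union> y2 n"
    \<comment> \<open>Three squared distances of at most \<open>\<delta>\<close> each, and the
      factor 2 from \<open>(x - y)\<^sup>2 \<le> 2 * (x\<^sup>2 + y\<^sup>2)\<close>, give the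
      \<open>6 * \<delta>\<close>.\<close>
    have "prob {\<omega> \<in> B. \<bar>simple_ito W D t \<omega>\<bar> > \<epsilon>} \<le> 6 * \<delta> / \<epsilon>\<^sup>2 + prob ?QQ"
    proof (rule simple_ito_tail_bound[OF D _ B])
      fix \<omega> assume \<omega>: "\<omega> \<in> B - (Q \<union> y1 n \<union> y2 n)"
      then have sp: "\<omega> \<in> space M" using sets.sets_into_space[OF B] by auto
      note [measurable] = H[OF sp]
      have "(\<integral>\<^sup>+ s \<in> {0..t}. ennreal ((simple_value D s \<omega>)\<^sup>2) \<partial>lborel)
        \<le> (\<integral>\<^sup>+ s. 2 * (ennreal ((simple_value S s \<omega> - H s \<omega>)\<^sup>2) * indicator {r<..t} s
        + ennreal ((simple_value (S1 n) s \<omega> - H s \<omega>)\<^sup>2) * indicator {0..t} s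
        + ennreal ((simple_value (S2 n) s \<omega> - H s \<omega>)\<^sup>2) * indicator {0..r} s) \<partial>lborel)"
        by (rule nn_integral_mono) (rule pt)
      also have "\<dots> = 2 * ((\<integral>\<^sup>+ s \<in> {r<..t}. ennreal ((simple_value S s \<omega> - H s \<omega>)\<^sup>2) \<partial>lborel) + ?Y1 n \<omega> + ?Y2 n \<omega>)"
        by (simp add: nn_integral_cmult nn_integral_add)
      also have "\<dots> \<le> 2 * (ennreal \<delta> + ennreal \<delta> + ennreal \<delta>)"
        using le[of \<omega>] \<omega> sp by (intro mult_left_mono add_mono) (auto simp: y1_def y2_def not_less)
      also have "\<dots> = ennreal (6 * \<delta>)"
        using \<open>\<delta> > 0\<close> by (simp add: ennreal_plus[symmetric] ennreal_mult[symmetric] ennreal_numeral[symmetric] del: ennreal_plus ennreal_numeral)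
      finally show "(\<integral>\<^sup>+ s \<in> {0..t}. ennreal ((simple_value D s \<omega>)\<^sup>2) \<partial>lborel) \<le> ennreal (6 * \<delta>)" .
    qed (use rt Q sets \<open>\<delta> > 0\<close> \<open>\<epsilon> > 0\<close> in auto)
    moreover have "prob ?QQ \<le> prob Q + prob (y1 n) + prob (y2 n)"
      using measure_Un_le[of "Q \<union> y1 n" M "y2 n"] measure_Un_le[of Q M "y1 n"] Q sets[of n] by auto
    \<comment> \<open>The threshold \<open>3 * \<epsilon>\<close> allows \<open>\<epsilon>\<close>
      for \<open>D\<close> and \<open>\<epsilon>\<close> for each of the approximations of
      \<open>I\<close> and \<open>J\<close>.\<close>
    moreover have "prob ?A \<le> prob ({\<omega> \<in> B. \<bar>simple_ito W D t \<omega>\<bar> > \<epsilon>} \<union> z1 n \<union> z2 n)"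
    proof (rule finite_measure_mono)
      show "?A \<subseteq> {\<omega> \<in> B. \<bar>simple_ito W D t \<omega>\<bar> > \<epsilon>} \<union> z1 n \<union> z2 n"
      proof
        fix \<omega> assume \<omega>: "\<omega> \<in> ?A"
        then have sp: "\<omega> \<in> space M" using sets.sets_into_space[OF B] by auto
        show "\<omega> \<in> {\<omega> \<in> B. \<bar>simple_ito W D t \<omega>\<bar> > \<epsilon>} \<union> z1 n \<union> z2 n"
        proof (rule ccontr)
          assume "\<not> ?thesis"
          then have "\<bar>simple_ito W D t \<omega>\<bar> \<le> \<epsilon>" "\<bar>simple_ito W (S1 n) t \<omega> - I \<omega>\<bar> \<le> \<epsilon>"
            "\<bar>simple_ito W (S2 n) r \<omega> - J \<omega>\<bar> \<le> \<epsilon>"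
            using \<omega> sp \<open>\<epsilon> > 0\<close> by (auto simp: z1_def z2_def not_less ennreal_le_iff)
          then have "\<bar>simple_ito W S t \<omega> - (I \<omega> - J \<omega>)\<bar> \<le> 3 * \<epsilon>"
            unfolding ito by linarith
          then show False using \<omega> by simp
        qed
      qed
      have "{\<omega> \<in> B. \<bar>simple_ito W D t \<omega>\<bar> > \<epsilon>} = B \<inter> {\<omega> \<in> space M. \<bar>simple_ito W D t \<omega>\<bar> > \<epsilon>}"
        using sets.sets_into_space[OF B] by auto
      also have "\<dots> \<in> sets M"
        using B simple_ito_measurable[OF D, of t] rt by auto
      finally show "{\<omega> \<in> B. \<bar>simple_ito W D t \<omega>\<bar> > \<epsilon>} \<union> z1 n \<union> z2 n \<in> sets M"
        using sets[of n] by auto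
    qed
    moreover have "prob ({\<omega> \<in> B. \<bar>simple_ito W D t \<omega>\<bar> > \<epsilon>} \<union> z1 n \<union> z2 n)
      \<le> prob {\<omega> \<in> B. \<bar>simple_ito W D t \<omega>\<bar> > \<epsilon>} + prob (z1 n) + prob (z2 n)"
    proof -
      have "{\<omega> \<in> B. \<bar>simple_ito W D t \<omega>\<bar> > \<epsilon>} = B \<inter> {\<omega> \<in> space M. \<bar>simple_ito W D t \<omega>\<bar> > \<epsilon>}"
        using sets.sets_into_space[OF B] by auto
      also have "\<dots> \<in> sets M"
        using B simple_ito_measurable[OF D, of t] rt by auto
      finally have b: "{\<omega> \<in> B. \<bar>simple_ito W D t \<omega>\<bar> > \<epsilon>} \<in> sets M" .
      then have "{\<omega> \<in> B. \<bar>simple_ito W D t \<omega>\<bar> > \<epsilon>} \<union> z1 n \<in> sets M" using sets[of n] by auto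
      from measure_Un_le[OF this sets(4)[of n]] measure_Un_le[OF b sets(3)[of n]]
      show ?thesis by linarith
    qed
    ultimately show ?thesis by linarith
  qed
  \<comment> \<open>Only the bad events depend on \<open>n\<close>, so they disappear in the
    limit.\<close>
  have "(\<lambda>n. 6 * \<delta> / \<epsilon>\<^sup>2 + prob Q + (prob (y1 n) + prob (y2 n) + prob (z1 n) + prob (z2 n)))
      \<longlonglongrightarrow> 6 * \<delta> / \<epsilon>\<^sup>2 + prob Q + (0 + 0 + 0 + 0)"
    by (intro tendsto_add tendsto_const lims)
  from LIMSEQ_le_const[OF this, of "prob ?A"] bound show ?thesis by auto
qed

end

section \<open>Diffusion paths and their discretisation\<close>

text \<open>The left end point of the cell of \<open>s\<close> in the grid of mesh \<open>h\<close> starting at \<open>r\<close>, the cells being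
  \<open>(r + j h, r + (j + 1) h]\<close>.\<close>

definition grid_left :: "real \<Rightarrow> real \<Rightarrow> real \<Rightarrow> real" where
  "grid_left r h s = r + h * (\<lceil>(s - r) / h\<rceil> - 1)"

lemma grid_left_measurable [measurable]: "grid_left r h \<in> borel_measurable borel"
  unfolding grid_left_def by measurable

lemma grid_left_eq:
  assumes "h > 0" "r + real j * h < s" "s \<le> r + real (Suc j) * h"
  shows "grid_left r h s = r + real j * h"
proof -
  have "\<lceil>(s - r) / h\<rceil> = int (Suc j)"
    using assms by (intro ceiling_unique) (auto simp: field_simps)
  then show ?thesis by (simp add: grid_left_def)
qed

lemma grid_left_bounds:
  assumes "h > 0"
  shows "grid_left r h s < s" "s \<le> grid_left r h s + h" "r < s \<Longrightarrow> r \<le> grid_left r h s"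
proof -
  define c where "c = real_of_int \<lceil>(s - r) / h\<rceil>"
  have "c < (s - r) / h + 1" "(s - r) / h \<le> c"
    unfolding c_def by linarith+
  then have "h * (c - 1) < s - r" "s - r \<le> h * c"
    using assms by (auto simp: field_simps)
  then show "grid_left r h s < s" "s \<le> grid_left r h s + h"
    by (auto simp: grid_left_def c_def algebra_simps)
  assume "r < s"
  then have "0 < (s - r) / h" using assms by simp
  then have "1 \<le> \<lceil>(s - r) / h\<rceil>" by linarith
  then have "(0::real) \<le> real_of_int \<lceil>(s - r) / h\<rceil> - 1" by linarith
  then show "r \<le> grid_left r h s" using assms by (simp add: grid_left_def)
qed

lemma grid_left_integral:
  fixes g :: "real \<Rightarrow> real"
  assumes "h > 0"
  shows "set_integrable lborel {r<..r + real i * h} (\<lambda>s. g (grid_left r h s)) \<and>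
    (LINT s:{r<..r + real i * h}|lborel. g (grid_left r h s)) = (\<Sum>j<i. g (r + real j * h) * h)"
proof (induction i)
  case 0
  then show ?case by (simp add: set_integrable_def set_lebesgue_integral_def)
next
  case (Suc i)
  let ?A = "{r<..r + real i * h}" and ?B = "{r + real i * h<..r + real (Suc i) * h}"
  have eq: "{r<..r + real (Suc i) * h} = ?A \<union> ?B"
    using assms by (auto simp: field_simps) (smt (verit) mult_nonneg_nonneg of_nat_0_le_iff)
  have disj: "?A \<inter> ?B = {}" by auto
  have cB: "(\<lambda>s. indicator ?B s *\<^sub>R g (grid_left r h s)) = (\<lambda>s. indicator ?B s *\<^sub>R g (r + real i * h))"
    using grid_left_eq[OF assms] by (auto simp: fun_eq_iff indicator_def)
  have iB: "set_integrable lborel ?B (\<lambda>s. g (grid_left r h s))"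
    unfolding set_integrable_def cB using assms by (intro integrable_scaleR_left) auto
  have "(LINT s:?B|lborel. g (grid_left r h s)) = h * g (r + real i * h)"
    unfolding set_lebesgue_integral_def cB using assms by (simp add: algebra_simps)
  then show ?case
    unfolding eq using Suc iB set_integral_Un[OF disj, of lborel "\<lambda>s. g (grid_left r h s)"]
      set_integrable_Un[of lborel ?A "\<lambda>s. g (grid_left r h s)" ?B] by simp
qed

text \<open>A version of the solution without exceptional paths, extended to negative times;
  \<open>continuous_modification\<close> provides it. Continuity on the whole line makes time
  integrals differentiable at 0 as well.\<close>

locale diffusion_path = wiener_space M F W
  for M :: "'a measure" and F :: "real \<Rightarrow> 'a measure" and W :: "real \<Rightarrow> 'a \<Rightarrow> real" +
  fixes a b :: "real \<Rightarrow> real" and x :: real and X :: "real \<Rightarrow> 'a \<Rightarrow> real"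
  assumes a_cont: "continuous_on UNIV a" and b_cont: "continuous_on UNIV b"
    and X_adapted: "\<And>t. X t \<in> borel_measurable (F (max 0 t))"
    and X_cont: "\<And>\<omega>. \<omega> \<in> space M \<Longrightarrow> continuous_on UNIV (\<lambda>t. X t \<omega>)"
    and X_ito: "\<And>t. 0 \<le> t \<Longrightarrow> has_ito_integral M F W (\<lambda>s \<omega>. a (X s \<omega>)) t
        (\<lambda>\<omega>. X t \<omega> - x - (LBINT s=0..t. b (X s \<omega>)))"
begin

lemma X_adapted': "0 \<le> t \<Longrightarrow> X t \<in> borel_measurable (F t)"
  using X_adapted[of t] by simp

lemma X_measurable [measurable]: "X t \<in> borel_measurable M"
  using X_adapted F_measurable by blast

text \<open>Rounding time down to multiples of \<open>1 / real (Suc n)\<close> leaves countably many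
  time points, for which joint measurability is clear; continuity of the paths passes it to the
  limit.\<close>

lemma X_joint_measurable: "(\<lambda>(s, \<omega>). X s \<omega>) \<in> borel_measurable (borel \<Otimes>\<^sub>M M)"
proof (rule borel_measurable_LIMSEQ_real)
  let ?q = "\<lambda>n s. real_of_int \<lfloor>s * real (Suc n)\<rfloor> / real (Suc n)"
  fix z :: "real \<times> 'a" assume z: "z \<in> space (borel \<Otimes>\<^sub>M M)"
  obtain s \<omega> where [simp]: "z = (s, \<omega>)" by (cases z)
  have "\<omega> \<in> space M" using z by (auto simp: space_pair_measure)
  have "(\<lambda>n. ?q n s) \<longlonglongrightarrow> s"
  proof (rule LIMSEQ_I)
    fix e :: real assume "e > 0"
    then obtain N where N: "inverse (real (Suc N)) < e" using reals_Archimedean by blast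
    show "\<exists>no. \<forall>n\<ge>no. norm (?q n s - s) < e"
    proof (intro exI allI impI)
      fix n assume "n \<ge> N"
      then have "inverse (real (Suc n)) < e" using N by (smt (verit) Suc_le_mono inverse_le_imp_le inverse_less_imp_less of_nat_0_less_iff of_nat_le_iff zero_less_Suc)
      moreover have "\<bar>?q n s - s\<bar> \<le> 1 / real (Suc n)"
      proof -
        have "\<bar>real_of_int \<lfloor>s * real (Suc n)\<rfloor> - s * real (Suc n)\<bar> \<le> 1" by linarith
        moreover have "?q n s - s = (real_of_int \<lfloor>s * real (Suc n)\<rfloor> - s * real (Suc n)) / real (Suc n)"
          by (simp add: field_simps del: of_nat_Suc)
        ultimately show ?thesis by (simp add: divide_right_mono del: of_nat_Suc)
      qed
      ultimately show "norm (?q n s - s) < e" by (simp add: inverse_eq_divide)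
    qed
  qed
  moreover have "isCont (\<lambda>t. X t \<omega>) s"
    using X_cont[OF \<open>\<omega> \<in> space M\<close>] by (simp add: continuous_on_eq_continuous_at)
  ultimately have "(\<lambda>n. X (?q n s) \<omega>) \<longlonglongrightarrow> X s \<omega>"
    using isCont_tendsto_compose by blast
  then show "(\<lambda>n. (\<lambda>(s, \<omega>). X (?q n s) \<omega>) z) \<longlonglongrightarrow> (\<lambda>(s, \<omega>). X s \<omega>) z" by simp
next
  fix n
  let ?q = "\<lambda>s. real_of_int \<lfloor>s * real (Suc n)\<rfloor> / real (Suc n)"
  have "(\<lambda>z. (\<lambda>i z. X (real_of_int i / real (Suc n)) (snd z)) \<lfloor>fst z * real (Suc n)\<rfloor> z)
      \<in> borel_measurable (borel \<Otimes>\<^sub>M M)"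
    by (rule measurable_compose_countable) measurable
  then show "(\<lambda>(s, \<omega>). X (?q s) \<omega>) \<in> borel_measurable (borel \<Otimes>\<^sub>M M)"
    by (simp add: case_prod_beta')
qed

lemma X_comp_measurable:
  assumes [measurable]: "g \<in> borel_measurable N" "f \<in> measurable N M"
  shows "(\<lambda>z. X (g z) (f z)) \<in> borel_measurable N"
  using measurable_compose[OF _ X_joint_measurable, of "\<lambda>z. (g z, f z)" N] by simp

lemma X_path_measurable: "\<omega> \<in> space M \<Longrightarrow> (\<lambda>s. X s \<omega>) \<in> borel_measurable borel"
  using X_cont by (rule borel_measurable_continuous_onI)

lemma path_bounded:
  assumes "\<omega> \<in> space M"
  obtains R :: nat where "\<And>s. s \<in> {r..T} \<Longrightarrow> \<bar>X s \<omega>\<bar> \<le> real R"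
proof -
  have "continuous_on {r..T} (\<lambda>s. X s \<omega>)"
    by (rule continuous_on_subset[OF X_cont[OF assms]]) simp
  then have "bounded ((\<lambda>s. X s \<omega>) ` {r..T})"
    by (intro compact_imp_bounded compact_continuous_image compact_Icc)
  then obtain B where B: "\<And>y. y \<in> (\<lambda>s. X s \<omega>) ` {r..T} \<Longrightarrow> norm y \<le> B"
    unfolding bounded_iff by blast
  obtain R :: nat where R: "B \<le> real R" using real_arch_simple by blast
  have "\<bar>X s \<omega>\<bar> \<le> real R" if "s \<in> {r..T}" for s
    using B[OF imageI[OF that]] R by simp
  then show ?thesis by (rule that)
qed

text \<open>The error of freezing \<open>q\<close> along the path at the left end points of
  \<open>N\<close> cells. The exponent \<open>n\<close> is 1 for Riemann sums and 2 for the distance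
  between integrands of Ito integrals.\<close>

definition path_osc :: "real \<Rightarrow> real \<Rightarrow> (real \<Rightarrow> real) \<Rightarrow> nat \<Rightarrow> nat \<Rightarrow> 'a \<Rightarrow> ennreal" where
  "path_osc r T q n N \<omega> = (\<integral>\<^sup>+ s \<in> {r<..T}.
      ennreal (\<bar>q (X (grid_left r ((T - r) / real N) s) \<omega>) - q (X s \<omega>)\<bar> ^ n) \<partial>lborel)"

lemma path_osc_measurable [measurable]:
  assumes "continuous_on UNIV q"
  shows "path_osc r T q n N \<in> borel_measurable M"
proof -
  have [measurable]: "q \<in> borel_measurable borel"
    using assms by (rule borel_measurable_continuous_onI)
  note [measurable (raw)] = X_comp_measurable
  show ?thesis unfolding path_osc_def by measurable
qed

lemma path_osc_tendsto:
  assumes q: "continuous_on UNIV q" and \<omega>: "\<omega> \<in> space M" and "r < T" "n > 0"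
  shows "(\<lambda>N. path_osc r T q n N \<omega>) \<longlonglongrightarrow> 0"
proof (rule tendsto_zero_ennreal)
  fix e :: real assume "e > 0"
  \<comment> \<open>The cap 1 gives \<open>\<eta> ^ n \<le> \<eta>\<close>; the other bound makes
    the integral at most \<open>e / 2\<close>.\<close>
  define \<eta> where "\<eta> = min 1 (e / (2 * (T - r)))"
  have \<eta>: "\<eta> > 0" "\<eta> \<le> 1" "\<eta> * (T - r) < e"
  proof -
    have "\<eta> * (T - r) \<le> e / (2 * (T - r)) * (T - r)"
      using \<open>r < T\<close> by (intro mult_right_mono) (auto simp: \<eta>_def)
    also have "\<dots> = e / 2" using \<open>r < T\<close> by (simp add: divide_simps)
    also have "\<dots> < e" using \<open>e > 0\<close> by simp
    finally show "\<eta> * (T - r) < e" .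
  qed (use \<open>e > 0\<close> \<open>r < T\<close> in \<open>auto simp: \<eta>_def\<close>)
  have "continuous_on {r..T} (\<lambda>s. q (X s \<omega>))"
    using continuous_on_compose2[OF q X_cont[OF \<omega>]] continuous_on_subset by blast
  then have "uniformly_continuous_on {r..T} (\<lambda>s. q (X s \<omega>))"
    by (intro compact_uniformly_continuous) auto
  then obtain d where d: "d > 0" "\<And>s s'. s \<in> {r..T} \<Longrightarrow> s' \<in> {r..T} \<Longrightarrow> \<bar>s' - s\<bar> < d \<Longrightarrow> \<bar>q (X s' \<omega>) - q (X s \<omega>)\<bar> < \<eta>"
    using \<eta>(1) unfolding uniformly_continuous_on_def dist_real_def by metis
  obtain N0 :: nat where N0: "(T - r) / d < real N0" using reals_Archimedean2 by blast
  show "\<forall>\<^sub>F N in sequentially. path_osc r T q n N \<omega> < ennreal e"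
  proof (rule eventually_sequentiallyI)
    fix N assume "N \<ge> N0"
    then have "(T - r) / d < real N" using N0 by linarith
    moreover have "0 < (T - r) / d" using d(1) \<open>r < T\<close> by simp
    ultimately have Npos: "0 < real N" and "T - r < d * real N"
      using d(1) by (linarith, simp add: pos_divide_less_eq mult.commute)
    then have N: "(T - r) / real N < d" "0 < (T - r) / real N"
      using \<open>r < T\<close> by (simp_all add: pos_divide_less_eq)
    let ?\<kappa> = "grid_left r ((T - r) / real N)"
    have "path_osc r T q n N \<omega> \<le> (\<integral>\<^sup>+ s. ennreal \<eta> * indicator {r<..T} s \<partial>lborel)"
      unfolding path_osc_def
    proof (rule nn_integral_mono)
      fix s
      show "ennreal (\<bar>q (X (?\<kappa> s) \<omega>) - q (X s \<omega>)\<bar> ^ n) * indicator {r<..T} s \<le> ennreal \<eta> * indicator {r<..T} s"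
      proof (cases "s \<in> {r<..T}")
        case True
        then have "\<bar>q (X (?\<kappa> s) \<omega>) - q (X s \<omega>)\<bar> < \<eta>"
          using grid_left_bounds[OF N(2), where r=r and s=s] N(1) by (intro d(2)) auto
        then have "\<bar>q (X (?\<kappa> s) \<omega>) - q (X s \<omega>)\<bar> ^ n \<le> \<eta> ^ n"
          by (intro power_mono) auto
        also have "\<dots> \<le> \<eta> ^ 1" using \<eta> \<open>n > 0\<close> by (intro power_decreasing) auto
        finally show ?thesis using True by (simp add: ennreal_leI)
      qed simp
    qed
    also have "\<dots> = ennreal (\<eta> * (T - r))"
      using \<open>r < T\<close> \<eta> by (simp add: nn_integral_cmult ennreal_mult)
    also have "\<dots> < ennreal e" using \<eta> \<open>r < T\<close> by (simp add: ennreal_less_iff)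
    finally show "path_osc r T q n N \<omega> < ennreal e" .
  qed
qed

text \<open>The modulus of continuity varies with the path, so the pathwise limit is passed to
  probabilities by dominated convergence of the indicators.\<close>

lemma path_osc_in_probability:
  assumes q: "continuous_on UNIV q" and "r < T" "n > 0" "\<delta> > 0"
  shows "(\<lambda>N. prob {\<omega> \<in> space M. path_osc r T q n N \<omega> > ennreal \<delta>}) \<longlonglongrightarrow> 0"
proof -
  note [measurable] = path_osc_measurable[OF q]
  let ?A = "\<lambda>N. {\<omega> \<in> space M. path_osc r T q n N \<omega> > ennreal \<delta>}"
  have "(\<lambda>N. \<integral>\<omega>. indicator (?A N) \<omega> \<partial>M) \<longlonglongrightarrow> (\<integral>\<omega>. 0 \<partial>M :: real)"
  proof (rule integral_dominated_convergence[where w="\<lambda>_. 1"])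
    show "AE \<omega> in M. (\<lambda>N. indicator (?A N) \<omega> :: real) \<longlonglongrightarrow> 0"
    proof (rule AE_I2)
      fix \<omega> assume "\<omega> \<in> space M"
      then have "\<forall>\<^sub>F N in sequentially. path_osc r T q n N \<omega> < ennreal \<delta>"
        using path_osc_tendsto[OF q _ \<open>r < T\<close> \<open>n > 0\<close>] \<open>\<delta> > 0\<close> by (intro order_tendstoD(2)) auto
      then show "(\<lambda>N. indicator (?A N) \<omega> :: real) \<longlonglongrightarrow> 0"
        by (intro tendsto_eventually) (auto elim!: eventually_mono simp: indicator_def dest: order.asym)
    qed
  qed (auto simp: indicator_def)
  then show ?thesis by simp
qed

text \<open>A single bound serves all partial sums \<open>i \<le> N\<close>, because the oscillation
  is integrated over the whole of \<open>(r,T]\<close>.\<close>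

lemma riemann_sum_osc:
  assumes q: "continuous_on UNIV q" and \<omega>: "\<omega> \<in> space M" and "r < T" "N > 0" "i \<le> N"
  defines "h \<equiv> (T - r) / real N"
  shows "ennreal \<bar>(\<Sum>j<i. q (X (r + real j * h) \<omega>) * h) - (LINT s:{r<..r + real i * h}|lborel. q (X s \<omega>))\<bar>
    \<le> path_osc r T q 1 N \<omega>"
proof -
  have h: "h > 0" using assms by simp
  let ?A = "{r<..r + real i * h}"
  have sub: "?A \<subseteq> {r<..T}"
  proof -
    have "real i * h \<le> real N * h" using \<open>i \<le> N\<close> h by (intro mult_right_mono) auto
    also have "\<dots> = T - r" using \<open>N > 0\<close> by (simp add: h_def)
    finally show ?thesis by auto
  qed
  have g: "set_integrable lborel ?A (\<lambda>s. q (X (grid_left r h s) \<omega>))"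
    "(LINT s:?A|lborel. q (X (grid_left r h s) \<omega>)) = (\<Sum>j<i. q (X (r + real j * h) \<omega>) * h)"
    using grid_left_integral[OF h, of r i "\<lambda>s. q (X s \<omega>)"] by auto
  have "continuous_on {r..r + real i * h} (\<lambda>s. q (X s \<omega>))"
    using continuous_on_compose2[OF q X_cont[OF \<omega>]] continuous_on_subset by blast
  then have "set_integrable lborel {r..r + real i * h} (\<lambda>s. q (X s \<omega>))"
    by (rule borel_integrable_atLeastAtMost')
  then have c: "set_integrable lborel ?A (\<lambda>s. q (X s \<omega>))"
    by (rule set_integrable_subset) auto
  have d: "set_integrable lborel ?A (\<lambda>s. q (X (grid_left r h s) \<omega>) - q (X s \<omega>))"
    using g(1) c by (rule set_integral_diff(1))
  have "ennreal \<bar>(\<Sum>j<i. q (X (r + real j * h) \<omega>) * h) - (LINT s:?A|lborel. q (X s \<omega>))\<bar>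
    = ennreal (norm (\<integral>s. indicator ?A s *\<^sub>R (q (X (grid_left r h s) \<omega>) - q (X s \<omega>)) \<partial>lborel))"
    unfolding g(2)[symmetric] using set_integral_diff(2)[OF g(1) c]
    by (simp add: set_lebesgue_integral_def)
  also have "\<dots> \<le> (\<integral>\<^sup>+s. norm (indicator ?A s *\<^sub>R (q (X (grid_left r h s) \<omega>) - q (X s \<omega>))) \<partial>lborel)"
    by (rule integral_norm_bound_ennreal) (use d in \<open>simp add: set_integrable_def\<close>)
  also have "\<dots> \<le> path_osc r T q 1 N \<omega>"
    unfolding path_osc_def h_def[symmetric]
    by (rule nn_integral_mono) (use sub in \<open>auto simp: indicator_def\<close>)
  finally show ?thesis .
qed

end

section \<open>One step of the Euler scheme\<close>

text \<open>Test functions: the last two conditions hold for twice continuously differentiable functions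
  with compact support.\<close>

locale test_function =
  fixes v v' v'' :: "real \<Rightarrow> real" and B :: real
  assumes deriv1: "\<And>y. (v has_real_derivative v' y) (at y)"
    and deriv2: "\<And>y. (v' has_real_derivative v'' y) (at y)"
    and bounds: "\<And>y. \<bar>v y\<bar> \<le> B" "\<And>y. \<bar>v' y\<bar> \<le> B" "\<And>y. \<bar>v'' y\<bar> \<le> B"
    and unif: "uniformly_continuous_on UNIV v''"
begin

lemma B_nonneg: "0 \<le> B"
  using bounds(1)[of 0] by linarith

lemma v_cont: "continuous_on UNIV v" "continuous_on UNIV v'" "continuous_on UNIV v''"
proof -
  show "continuous_on UNIV v" "continuous_on UNIV v'"
    using DERIV_isCont[OF deriv1] DERIV_isCont[OF deriv2] by (auto simp: continuous_on_eq_continuous_at)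
  show "continuous_on UNIV v''"
    using unif by (rule uniformly_continuous_imp_continuous)
qed

lemma v_measurable [measurable]:
  "v \<in> borel_measurable borel" "v' \<in> borel_measurable borel" "v'' \<in> borel_measurable borel"
  using v_cont by (auto intro: borel_measurable_continuous_onI)

text \<open>The remainder is half of \<open>(v'' (y + t) - v'' y) * d\<^sup>2\<close>. For
  \<open>t\<close> below the modulus of continuity \<open>\<eta>\<close> of \<open>v''\<close> it is
  small; otherwise \<open>\<bar>d\<bar> \<ge> \<eta>\<close>, and the crude bound
  \<open>2 * B\<close> on the difference is at most
  \<open>2 * B * d\<^sup>2 / \<eta>\<^sup>2\<close>, which makes the error quartic in
  \<open>d\<close>.\<close>

lemma taylor_bound:
  assumes "\<epsilon> > 0"
  obtains C where "C \<ge> 0" "\<And>y d. v (y + d) \<le> v y + v' y * d + v'' y * d\<^sup>2 / 2 + \<epsilon> * d\<^sup>2 + C * d ^ 4"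
proof -
  obtain \<eta> where \<eta>: "\<eta> > 0" "\<And>y z. \<bar>z - y\<bar> < \<eta> \<Longrightarrow> \<bar>v'' z - v'' y\<bar> < \<epsilon>"
    using unif assms unfolding uniformly_continuous_on_def dist_real_def by (metis UNIV_I)
  define C where "C = B / \<eta>\<^sup>2"
  have "C \<ge> 0" using B_nonneg by (simp add: C_def)
  moreover have "v (y + d) \<le> v y + v' y * d + v'' y * d\<^sup>2 / 2 + \<epsilon> * d\<^sup>2 + C * d ^ 4" for y d
  proof -
    let ?diff = "\<lambda>m::nat. if m = 0 then (\<lambda>d. v (y + d)) else if m = 1 then (\<lambda>d. v' (y + d)) else (\<lambda>d. v'' (y + d))"
    have "\<exists>t. \<bar>t\<bar> \<le> \<bar>d\<bar> \<and> v (y + d) = (\<Sum>m<2. ?diff m 0 / fact m * d ^ m) + ?diff 2 t / fact 2 * d ^ 2"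
    proof (rule Maclaurin_bi_le)
      show "\<forall>m t. m < 2 \<and> \<bar>t\<bar> \<le> \<bar>d\<bar> \<longrightarrow> (?diff m has_real_derivative ?diff (Suc m) t) (at t)"
      proof (intro allI impI)
        fix m :: nat and t :: real assume "m < 2 \<and> \<bar>t\<bar> \<le> \<bar>d\<bar>"
        then have "m = 0 \<or> m = 1" by auto
        then show "(?diff m has_real_derivative ?diff (Suc m) t) (at t)"
        proof
          assume "m = 0"
          then show ?thesis using DERIV_shift[of v "v' (y + t)" t y] deriv1[of "y + t"]
            by (simp add: add.commute)
        next
          assume "m = 1"
          then show ?thesis using DERIV_shift[of v' "v'' (y + t)" t y] deriv2[of "y + t"]
            by (simp add: add.commute)
        qed
      qed
    qed simp
    then obtain t where t: "\<bar>t\<bar> \<le> \<bar>d\<bar>" "v (y + d) = v y + v' y * d + v'' (y + t) * d\<^sup>2 / 2"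
      by (auto simp: numeral_2_eq_2 fact_numeral)
    have "v'' (y + t) - v'' y \<le> 2 * (\<epsilon> + C * d\<^sup>2)"
    proof (cases "\<bar>t\<bar> < \<eta>")
      case True
      then have "\<bar>v'' (y + t) - v'' y\<bar> < \<epsilon>" by (intro \<eta>(2)) simp
      moreover have "C * d\<^sup>2 \<ge> 0" using \<open>C \<ge> 0\<close> by simp
      ultimately show ?thesis using assms by argo
    next
      case False
      then have "\<eta>\<^sup>2 \<le> d\<^sup>2" using t(1) \<eta>(1) by (intro abs_le_square_iff[THEN iffD1]) auto
      then have "C * \<eta>\<^sup>2 \<le> C * d\<^sup>2" using \<open>C \<ge> 0\<close> by (rule mult_left_mono)
      moreover have "C * \<eta>\<^sup>2 = B" using \<eta>(1) by (simp add: C_def)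
      ultimately have "B \<le> C * d\<^sup>2" by simp
      then show ?thesis using bounds(3)[of "y + t"] bounds(3)[of y] assms by argo
    qed
    then have "(v'' (y + t) - v'' y) * d\<^sup>2 \<le> (2 * (\<epsilon> + C * d\<^sup>2)) * d\<^sup>2"
      by (rule mult_right_mono) simp
    moreover have "(2 * (\<epsilon> + C * d\<^sup>2)) * d\<^sup>2 = 2 * (\<epsilon> * d\<^sup>2 + C * d ^ 4)"
      by (simp add: power4_eq_xxxx power2_eq_square algebra_simps)
    ultimately have "(v'' (y + t) - v'' y) * d\<^sup>2 \<le> 2 * (\<epsilon> * d\<^sup>2 + C * d ^ 4)" by simp
    then show ?thesis using t(2) by (simp add: algebra_simps)
  qed
  ultimately show ?thesis by (rule that)
qed

end

context wiener_space
begin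

lemma integrable_bounded:
  fixes g :: "'a \<Rightarrow> real"
  assumes "g \<in> borel_measurable M" "\<And>\<omega>. \<omega> \<in> space M \<Longrightarrow> \<bar>g \<omega>\<bar> \<le> C"
  shows "integrable M g"
  using assms by (intro integrable_const_bound[where B=C]) auto

text \<open>Taylor expansion of \<open>v\<close> around \<open>Y\<close>, sorted by powers of the
  Wiener increment. The coefficients are known at time \<open>t\<close>, so the first power averages
  out, the second gives \<open>h\<close>, and the fourth gives \<open>3 * h\<^sup>2\<close>. What
  exceeds the generator term is of order \<open>\<epsilon> * h\<close> or \<open>h\<^sup>2\<close>,
  hence still small after summation over about \<open>1 / h\<close> steps.\<close>

lemma euler_step:
  assumes v: "test_function v v' v'' B"
    and \<epsilon>C: "0 \<le> \<epsilon>" "0 \<le> C" "\<And>y d. v (y + d) \<le> v y + v' y * d + v'' y * d\<^sup>2 / 2 + \<epsilon> * d\<^sup>2 + C * d ^ 4"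
    and t: "0 \<le> t" and h: "0 < h" "h \<le> 1"
    and meas: "\<xi> \<in> borel_measurable (F t)" "Y \<in> borel_measurable (F t)"
      "\<beta> \<in> borel_measurable (F t)" "\<sigma> \<in> borel_measurable (F t)"
    and \<xi>: "\<And>\<omega>. \<omega> \<in> space M \<Longrightarrow> 0 \<le> \<xi> \<omega> \<and> \<xi> \<omega> \<le> c"
    and K: "\<And>\<omega>. \<omega> \<in> space M \<Longrightarrow> \<bar>\<beta> \<omega>\<bar> \<le> K" "\<And>\<omega>. \<omega> \<in> space M \<Longrightarrow> \<bar>\<sigma> \<omega>\<bar> \<le> K"
  shows "expectation (\<lambda>\<omega>. \<xi> \<omega> * v (Y \<omega> + (\<beta> \<omega> * h + \<sigma> \<omega> * (W (t + h) \<omega> - W t \<omega>))))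
    \<le> expectation (\<lambda>\<omega>. \<xi> \<omega> * v (Y \<omega>))
      + h * expectation (\<lambda>\<omega>. \<xi> \<omega> * (v' (Y \<omega>) * \<beta> \<omega> + v'' (Y \<omega>) * (\<sigma> \<omega>)\<^sup>2 / 2))
      + c * (4 * \<epsilon> * K\<^sup>2 * h + (B * K\<^sup>2 + 32 * C * K ^ 4) * h\<^sup>2)"
proof -
  interpret test_function v v' v'' B by (rule v)
  let ?D = "\<lambda>\<omega>. W (t + h) \<omega> - W t \<omega>"
  obtain \<omega>0 where "\<omega>0 \<in> space M" using not_empty by blast
  then have c: "0 \<le> c" and K0: "0 \<le> K" using \<xi>[of \<omega>0] K(1)[of \<omega>0] by linarith+
  note [measurable] = meas
  \<comment> \<open>\<open>G0\<close>, \<open>G1\<close> and \<open>G2\<close> collect the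
    coefficients of the powers 0, 1 and 2 of \<open>?D\<close>. The Taylor remainder is put under
    the constant bound \<open>c\<close> of \<open>\<xi>\<close> instead of \<open>\<xi>\<close>
    itself.\<close>
  define G0 where "G0 \<omega> = \<xi> \<omega> * v (Y \<omega>) + h * (\<xi> \<omega> * (v' (Y \<omega>) * \<beta> \<omega>)) + h\<^sup>2 * (\<xi> \<omega> * (v'' (Y \<omega>) * (\<beta> \<omega>)\<^sup>2 / 2))
    + c * (2 * \<epsilon> * K\<^sup>2 * h\<^sup>2 + 8 * C * K ^ 4 * h ^ 4)" for \<omega>
  define G1 where "G1 \<omega> = \<xi> \<omega> * (v' (Y \<omega>) * \<sigma> \<omega> + v'' (Y \<omega>) * (\<beta> \<omega> * h * \<sigma> \<omega>))" for \<omega>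
  define G2 where "G2 \<omega> = \<xi> \<omega> * (v'' (Y \<omega>) * (\<sigma> \<omega>)\<^sup>2 / 2) + 2 * c * \<epsilon> * K\<^sup>2" for \<omega>
  have pt: "\<xi> \<omega> * v (Y \<omega> + (\<beta> \<omega> * h + \<sigma> \<omega> * ?D \<omega>)) \<le> G0 \<omega> + G1 \<omega> * ?D \<omega> + G2 \<omega> * (?D \<omega>)\<^sup>2 + 8 * c * C * K ^ 4 * ?D \<omega> ^ 4"
    if \<omega>: "\<omega> \<in> space M" for \<omega>
  proof -
    let ?b = "\<beta> \<omega>" and ?s = "\<sigma> \<omega>" and ?d = "\<beta> \<omega> * h + \<sigma> \<omega> * ?D \<omega>"
    have b2: "?b\<^sup>2 \<le> K\<^sup>2" "?s\<^sup>2 \<le> K\<^sup>2"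
      using K[OF \<omega>] K0 by (auto intro!: abs_le_square_iff[THEN iffD1])
    have d2: "?d\<^sup>2 \<le> 2 * (K\<^sup>2 * h\<^sup>2 + K\<^sup>2 * (?D \<omega>)\<^sup>2)"
    proof -
      have "?d\<^sup>2 \<le> 2 * ((?b * h)\<^sup>2 + (?s * ?D \<omega>)\<^sup>2)"
        using sum_squares_bound[of "?b * h" "?s * ?D \<omega>"] by (simp add: power2_sum)
      also have "\<dots> \<le> 2 * (K\<^sup>2 * h\<^sup>2 + K\<^sup>2 * (?D \<omega>)\<^sup>2)"
        unfolding power_mult_distrib using b2 by (intro mult_left_mono add_mono mult_right_mono) auto
      finally show ?thesis .
    qed
    \<comment> \<open>Square of the previous bound, with
      \<open>(2 * (p + q))\<^sup>2 \<le> 8 * (p\<^sup>2 + q\<^sup>2)\<close>; this is the source of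
      the 8.\<close>
    have d4: "?d ^ 4 \<le> 8 * K ^ 4 * h ^ 4 + 8 * K ^ 4 * ?D \<omega> ^ 4"
    proof -
      have "?d ^ 4 = (?d\<^sup>2)\<^sup>2" by simp
      also have "\<dots> \<le> (2 * (K\<^sup>2 * h\<^sup>2 + K\<^sup>2 * (?D \<omega>)\<^sup>2))\<^sup>2"
        using d2 by (intro power_mono) auto
      also have "\<dots> \<le> 8 * ((K\<^sup>2 * h\<^sup>2)\<^sup>2 + (K\<^sup>2 * (?D \<omega>)\<^sup>2)\<^sup>2)"
        using sum_squares_bound[of "K\<^sup>2 * h\<^sup>2" "K\<^sup>2 * (?D \<omega>)\<^sup>2"] by (simp add: power2_sum power_mult_distrib)
      also have "\<dots> = 8 * K ^ 4 * h ^ 4 + 8 * K ^ 4 * ?D \<omega> ^ 4"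
        by (simp add: power_mult_distrib)
      finally show ?thesis .
    qed
    define q where "q = \<epsilon> * (2 * (K\<^sup>2 * h\<^sup>2 + K\<^sup>2 * (?D \<omega>)\<^sup>2)) + C * (8 * K ^ 4 * h ^ 4 + 8 * K ^ 4 * ?D \<omega> ^ 4)"
    have "q \<ge> 0" using \<epsilon>C(1,2) K0 h by (auto simp: q_def intro!: add_nonneg_nonneg mult_nonneg_nonneg)
    have "\<epsilon> * ?d\<^sup>2 + C * ?d ^ 4 \<le> q"
      unfolding q_def using d2 d4 \<epsilon>C(1,2) by (intro add_mono mult_left_mono)
    then have "v (Y \<omega> + ?d) \<le> v (Y \<omega>) + v' (Y \<omega>) * ?d + v'' (Y \<omega>) * ?d\<^sup>2 / 2 + q"
      using \<epsilon>C(3)[of "Y \<omega>" ?d] by linarith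
    then have "\<xi> \<omega> * v (Y \<omega> + ?d) \<le> \<xi> \<omega> * (v (Y \<omega>) + v' (Y \<omega>) * ?d + v'' (Y \<omega>) * ?d\<^sup>2 / 2 + q)"
      using \<xi>[OF \<omega>] by (intro mult_left_mono) auto
    also have "\<dots> \<le> \<xi> \<omega> * (v (Y \<omega>) + v' (Y \<omega>) * ?d + v'' (Y \<omega>) * ?d\<^sup>2 / 2) + c * q"
      using \<xi>[OF \<omega>] mult_right_mono[of "\<xi> \<omega>" c q] \<open>q \<ge> 0\<close> by (simp add: distrib_left)
    also have "\<dots> = G0 \<omega> + G1 \<omega> * ?D \<omega> + G2 \<omega> * (?D \<omega>)\<^sup>2 + 8 * c * C * K ^ 4 * ?D \<omega> ^ 4"
    proof -
      define D where "D = ?D \<omega>"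
      show ?thesis
        unfolding G0_def G1_def G2_def q_def D_def[symmetric]
        by (simp add: power2_eq_square field_simps)
    qed
    finally show ?thesis .
  qed
  have bnd: "\<bar>\<xi> \<omega> * z\<bar> \<le> c * k" if "\<omega> \<in> space M" "\<bar>z\<bar> \<le> k" for \<omega> z k
    using \<xi>[OF that(1)] that(2) c by (auto simp: abs_mult intro!: mult_mono)
  have K2: "\<bar>(\<beta> \<omega>)\<^sup>2\<bar> \<le> K\<^sup>2" "\<bar>(\<sigma> \<omega>)\<^sup>2\<bar> \<le> K\<^sup>2" if "\<omega> \<in> space M" for \<omega>
    using K[OF that] K0 by (auto intro!: abs_le_square_iff[THEN iffD1])
  have bm: "\<bar>p * q\<bar> \<le> B * k" if "\<bar>p\<bar> \<le> B" "\<bar>q\<bar> \<le> k" for p q k :: real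
    using that B_nonneg by (auto simp: abs_mult intro!: mult_mono)
  have mM [measurable]: "\<xi> \<in> borel_measurable M" "Y \<in> borel_measurable M" "\<beta> \<in> borel_measurable M" "\<sigma> \<in> borel_measurable M"
    using meas F_measurable by blast+
  have i0: "integrable M (\<lambda>\<omega>. \<xi> \<omega> * v (Y \<omega>))"
    by (rule integrable_bounded[where C="c * B"]) (use bnd bounds in auto)
  have i1: "integrable M (\<lambda>\<omega>. \<xi> \<omega> * (v' (Y \<omega>) * \<beta> \<omega>))"
    by (rule integrable_bounded[where C="c * (B * K)"]) (use bnd bm bounds K in auto)
  have i1': "integrable M (\<lambda>\<omega>. \<xi> \<omega> * (v' (Y \<omega>) * \<sigma> \<omega>))"
    by (rule integrable_bounded[where C="c * (B * K)"]) (use bnd bm bounds K in auto)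
  have i2: "integrable M (\<lambda>\<omega>. \<xi> \<omega> * (v'' (Y \<omega>) * (\<beta> \<omega>)\<^sup>2))"
    by (rule integrable_bounded[where C="c * (B * K\<^sup>2)"]) (use bnd bm bounds K2 in auto)
  have i3: "integrable M (\<lambda>\<omega>. \<xi> \<omega> * (v'' (Y \<omega>) * (\<sigma> \<omega>)\<^sup>2))"
    by (rule integrable_bounded[where C="c * (B * K\<^sup>2)"]) (use bnd bm bounds K2 in auto)
  have i4: "integrable M (\<lambda>\<omega>. \<xi> \<omega> * (v'' (Y \<omega>) * (\<beta> \<omega> * \<sigma> \<omega>)))"
  proof (rule integrable_bounded[where C="c * (B * (K * K))"])
    fix \<omega> assume \<omega>: "\<omega> \<in> space M"
    have "\<bar>\<beta> \<omega> * \<sigma> \<omega>\<bar> \<le> K * K"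
      using K[OF \<omega>] K0 by (auto simp: abs_mult intro!: mult_mono)
    then show "\<bar>\<xi> \<omega> * (v'' (Y \<omega>) * (\<beta> \<omega> * \<sigma> \<omega>))\<bar> \<le> c * (B * (K * K))"
      using bnd[OF \<omega>] bm bounds(3) by blast
  qed simp
  have i2': "integrable M (\<lambda>\<omega>. \<xi> \<omega> * (v'' (Y \<omega>) * (\<beta> \<omega>)\<^sup>2 / 2))"
    and i3': "integrable M (\<lambda>\<omega>. \<xi> \<omega> * (v'' (Y \<omega>) * (\<sigma> \<omega>)\<^sup>2 / 2))"
    using integrable_divide[OF i2, of 2] integrable_divide[OF i3, of 2] by simp_all
  have G0: "integrable M G0" "expectation G0 = expectation (\<lambda>\<omega>. \<xi> \<omega> * v (Y \<omega>)) + h * expectation (\<lambda>\<omega>. \<xi> \<omega> * (v' (Y \<omega>) * \<beta> \<omega>))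
     + h\<^sup>2 * expectation (\<lambda>\<omega>. \<xi> \<omega> * (v'' (Y \<omega>) * (\<beta> \<omega>)\<^sup>2 / 2)) + c * (2 * \<epsilon> * K\<^sup>2 * h\<^sup>2 + 8 * C * K ^ 4 * h ^ 4)"
  proof -
    define e2 where "e2 \<omega> = \<xi> \<omega> * (v'' (Y \<omega>) * (\<beta> \<omega>)\<^sup>2 / 2)" for \<omega>
    have G0_eq: "G0 = (\<lambda>\<omega>. \<xi> \<omega> * v (Y \<omega>) + h * (\<xi> \<omega> * (v' (Y \<omega>) * \<beta> \<omega>)) + h\<^sup>2 * e2 \<omega>
        + c * (2 * \<epsilon> * K\<^sup>2 * h\<^sup>2 + 8 * C * K ^ 4 * h ^ 4))"
      by (simp only: G0_def[abs_def] e2_def)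
    show "integrable M G0" "expectation G0 = expectation (\<lambda>\<omega>. \<xi> \<omega> * v (Y \<omega>)) + h * expectation (\<lambda>\<omega>. \<xi> \<omega> * (v' (Y \<omega>) * \<beta> \<omega>))
     + h\<^sup>2 * expectation (\<lambda>\<omega>. \<xi> \<omega> * (v'' (Y \<omega>) * (\<beta> \<omega>)\<^sup>2 / 2)) + c * (2 * \<epsilon> * K\<^sup>2 * h\<^sup>2 + 8 * C * K ^ 4 * h ^ 4)"
      using i0 i1 i2' unfolding G0_eq e2_def[symmetric] by (simp_all add: prob_space)
  qed
  have G1: "integrable M G1"
  proof -
    have "G1 = (\<lambda>\<omega>. \<xi> \<omega> * (v' (Y \<omega>) * \<sigma> \<omega>) + h * (\<xi> \<omega> * (v'' (Y \<omega>) * (\<beta> \<omega> * \<sigma> \<omega>))))"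
      by (auto simp: G1_def algebra_simps)
    then show ?thesis using i1' i4 by simp
  qed
  have G2: "integrable M G2" "expectation G2 = expectation (\<lambda>\<omega>. \<xi> \<omega> * (v'' (Y \<omega>) * (\<sigma> \<omega>)\<^sup>2 / 2)) + 2 * c * \<epsilon> * K\<^sup>2"
  proof -
    define e3 where "e3 \<omega> = \<xi> \<omega> * (v'' (Y \<omega>) * (\<sigma> \<omega>)\<^sup>2 / 2)" for \<omega>
    have G2_eq: "G2 = (\<lambda>\<omega>. e3 \<omega> + 2 * c * \<epsilon> * K\<^sup>2)"
      by (simp only: G2_def[abs_def] e3_def)
    show "integrable M G2" "expectation G2 = expectation (\<lambda>\<omega>. \<xi> \<omega> * (v'' (Y \<omega>) * (\<sigma> \<omega>)\<^sup>2 / 2)) + 2 * c * \<epsilon> * K\<^sup>2"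
      using i3' unfolding G2_eq e3_def[symmetric] by (simp_all add: prob_space)
  qed
  have GF: "G1 \<in> borel_measurable (F t)" "G2 \<in> borel_measurable (F t)"
    unfolding G1_def G2_def by measurable
  have th: "t < t + h" using h by simp
  have D4: "integrable M (\<lambda>\<omega>. ?D \<omega> ^ 4)" "expectation (\<lambda>\<omega>. ?D \<omega> ^ 4) = 3 * h\<^sup>2"
    using increment_moments(1)[OF t th, of 4] increment_moments(4)[OF t th] by simp_all
  have P1: "integrable M (\<lambda>\<omega>. G1 \<omega> * ?D \<omega>)" "expectation (\<lambda>\<omega>. G1 \<omega> * ?D \<omega>) = 0"
    using increment_product(1)[OF t th GF(1) G1, of 1] increment_product(2)[OF t th GF(1) G1] by simp_all
  have P2: "integrable M (\<lambda>\<omega>. G2 \<omega> * (?D \<omega>)\<^sup>2)" "expectation (\<lambda>\<omega>. G2 \<omega> * (?D \<omega>)\<^sup>2) = expectation G2 * h"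
    using increment_product(1)[OF t th GF(2) G2(1), of 2] increment_product(3)[OF t th GF(2) G2(1)] by simp_all
  have W [measurable]: "W (t + h) \<in> borel_measurable M" "W t \<in> borel_measurable M"
    using W_measurable t h by auto
  have "expectation (\<lambda>\<omega>. \<xi> \<omega> * v (Y \<omega> + (\<beta> \<omega> * h + \<sigma> \<omega> * ?D \<omega>)))
    \<le> expectation (\<lambda>\<omega>. G0 \<omega> + G1 \<omega> * ?D \<omega> + G2 \<omega> * (?D \<omega>)\<^sup>2 + 8 * c * C * K ^ 4 * ?D \<omega> ^ 4)"
  proof (rule integral_mono)
    show "integrable M (\<lambda>\<omega>. \<xi> \<omega> * v (Y \<omega> + (\<beta> \<omega> * h + \<sigma> \<omega> * ?D \<omega>)))"
      by (rule integrable_bounded[where C="c * B"]) (use bnd bounds in auto)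
  qed (use pt G0 P1 P2 D4 in auto)
  also have "\<dots> = expectation G0 + h * expectation G2 + 24 * c * C * K ^ 4 * h\<^sup>2"
    using G0(1) P1 P2 D4 by simp
  also have "\<dots> = expectation (\<lambda>\<omega>. \<xi> \<omega> * v (Y \<omega>))
      + h * (expectation (\<lambda>\<omega>. \<xi> \<omega> * (v' (Y \<omega>) * \<beta> \<omega>)) + expectation (\<lambda>\<omega>. \<xi> \<omega> * (v'' (Y \<omega>) * (\<sigma> \<omega>)\<^sup>2 / 2)))
      + (h\<^sup>2 * expectation (\<lambda>\<omega>. \<xi> \<omega> * (v'' (Y \<omega>) * (\<beta> \<omega>)\<^sup>2 / 2))
      + c * (2 * \<epsilon> * K\<^sup>2 * h\<^sup>2 + 8 * C * K ^ 4 * h ^ 4 + 2 * \<epsilon> * K\<^sup>2 * h + 24 * C * K ^ 4 * h\<^sup>2))"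
    unfolding G0 G2 by (simp add: algebra_simps)
  also have "expectation (\<lambda>\<omega>. \<xi> \<omega> * (v' (Y \<omega>) * \<beta> \<omega>)) + expectation (\<lambda>\<omega>. \<xi> \<omega> * (v'' (Y \<omega>) * (\<sigma> \<omega>)\<^sup>2 / 2))
    = expectation (\<lambda>\<omega>. \<xi> \<omega> * (v' (Y \<omega>) * \<beta> \<omega> + v'' (Y \<omega>) * (\<sigma> \<omega>)\<^sup>2 / 2))"
    unfolding distrib_left by (rule Bochner_Integration.integral_add[OF i1 i3', symmetric])
  also have "h\<^sup>2 * expectation (\<lambda>\<omega>. \<xi> \<omega> * (v'' (Y \<omega>) * (\<beta> \<omega>)\<^sup>2 / 2))
      + c * (2 * \<epsilon> * K\<^sup>2 * h\<^sup>2 + 8 * C * K ^ 4 * h ^ 4 + 2 * \<epsilon> * K\<^sup>2 * h + 24 * C * K ^ 4 * h\<^sup>2)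
    \<le> c * (4 * \<epsilon> * K\<^sup>2 * h + (B * K\<^sup>2 + 32 * C * K ^ 4) * h\<^sup>2)"
  proof -
    have "expectation (\<lambda>\<omega>. \<xi> \<omega> * (v'' (Y \<omega>) * (\<beta> \<omega>)\<^sup>2 / 2)) \<le> expectation (\<lambda>\<omega>. c * (B * K\<^sup>2))"
    proof (rule integral_mono[OF i2'])
      fix \<omega> assume \<omega>: "\<omega> \<in> space M"
      have "\<bar>v'' (Y \<omega>) * (\<beta> \<omega>)\<^sup>2\<bar> \<le> B * K\<^sup>2" by (intro bm bounds K2 \<omega>)
      then have "\<bar>v'' (Y \<omega>) * (\<beta> \<omega>)\<^sup>2 / 2\<bar> \<le> B * K\<^sup>2" by linarith
      from bnd[OF \<omega> this] show "\<xi> \<omega> * (v'' (Y \<omega>) * (\<beta> \<omega>)\<^sup>2 / 2) \<le> c * (B * K\<^sup>2)" by linarith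
    qed simp
    then have "h\<^sup>2 * expectation (\<lambda>\<omega>. \<xi> \<omega> * (v'' (Y \<omega>) * (\<beta> \<omega>)\<^sup>2 / 2)) \<le> h\<^sup>2 * (c * (B * K\<^sup>2))"
      by (intro mult_left_mono) (auto simp: prob_space)
    \<comment> \<open>Here \<open>h \<le> 1\<close> enters, through \<open>h\<^sup>2 \<le> h\<close>
      and \<open>h ^ 4 \<le> h\<^sup>2\<close>. The constant 32 is 8 plus 24, the latter being 8
      times the 3 of the fourth moment.\<close>
    moreover have "c * (2 * \<epsilon> * K\<^sup>2 * h\<^sup>2 + 8 * C * K ^ 4 * h ^ 4 + 2 * \<epsilon> * K\<^sup>2 * h + 24 * C * K ^ 4 * h\<^sup>2)
      \<le> c * (2 * \<epsilon> * K\<^sup>2 * h + 8 * C * K ^ 4 * h\<^sup>2 + 2 * \<epsilon> * K\<^sup>2 * h + 24 * C * K ^ 4 * h\<^sup>2)"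
    proof -
      have "h\<^sup>2 \<le> h" "h ^ 4 \<le> h\<^sup>2"
        using h power_decreasing[of 1 2 h] power_decreasing[of 2 4 h] by auto
      then show ?thesis using c \<epsilon>C K0
        by (intro mult_left_mono add_mono order_refl) auto
    qed
    ultimately show ?thesis by (simp add: algebra_simps)
  qed
  finally show ?thesis by simp
qed

end

lemma continuous_bounded_on_interval:
  fixes q :: "real \<Rightarrow> real"
  assumes "continuous_on UNIV q"
  obtains K where "K \<ge> 0" "\<And>y. \<bar>y\<bar> \<le> R \<Longrightarrow> \<bar>q y\<bar> \<le> K"
proof -
  have "continuous_on {-R..R} q" using assms by (rule continuous_on_subset) simp
  then have "bounded (q ` {-R..R})"
    by (intro compact_imp_bounded compact_continuous_image compact_Icc)
  then obtain K where "K > 0" and K: "\<And>z. z \<in> q ` {-R..R} \<Longrightarrow> norm z \<le> K"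
    unfolding bounded_pos by blast
  have "\<bar>q y\<bar> \<le> K" if "\<bar>y\<bar> \<le> R" for y
    using K[of "q y"] that by (simp add: abs_le_iff)
  then show ?thesis using that[of K] \<open>K > 0\<close> by simp
qed

section \<open>The Euler scheme along the path\<close>

context diffusion_path
begin

definition node :: "real \<Rightarrow> real \<Rightarrow> nat \<Rightarrow> nat \<Rightarrow> real" where
  "node r T N i = r + real i * ((T - r) / real N)"

text \<open>A discrete substitute for the exit time from \<open>[-R,R]\<close>: only the nodes up to
  \<open>i\<close> are inspected, so it is adapted, and as a product it stays 0 once it is
  0.\<close>

definition alive :: "real \<Rightarrow> real \<Rightarrow> real \<Rightarrow> nat \<Rightarrow> nat \<Rightarrow> 'a \<Rightarrow> real" where
  "alive r T R N i \<omega> = (\<Prod>j\<le>i. if \<bar>X (node r T N j) \<omega>\<bar> \<le> R then 1 else 0)"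

text \<open>The coefficients are evaluated along \<open>X\<close> itself, and the scheme is frozen once \<open>X\<close> has been
  seen outside \<open>[-R,R]\<close> at a node.\<close>

definition euler :: "real \<Rightarrow> real \<Rightarrow> real \<Rightarrow> nat \<Rightarrow> nat \<Rightarrow> 'a \<Rightarrow> real" where
  "euler r T R N n \<omega> = X r \<omega> + (\<Sum>j<n. alive r T R N j \<omega> *
     (b (X (node r T N j) \<omega>) * ((T - r) / real N) +
      a (X (node r T N j) \<omega>) * (W (node r T N (Suc j)) \<omega> - W (node r T N j) \<omega>)))"

lemma alive_cases: "alive r T R N i \<omega> = 0 \<or> alive r T R N i \<omega> = 1"
proof (cases "\<forall>j\<le>i. \<bar>X (node r T N j) \<omega>\<bar> \<le> R")
  case True
  then show ?thesis by (simp add: alive_def)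
next
  case False
  then show ?thesis unfolding alive_def by (intro disjI1 prod_zero) auto
qed

lemma alive_eq_1_iff: "alive r T R N i \<omega> = 1 \<longleftrightarrow> (\<forall>j\<le>i. \<bar>X (node r T N j) \<omega>\<bar> \<le> R)"
proof (cases "\<forall>j\<le>i. \<bar>X (node r T N j) \<omega>\<bar> \<le> R")
  case True
  then show ?thesis by (simp add: alive_def)
next
  case False
  then have "alive r T R N i \<omega> = 0" unfolding alive_def by (intro prod_zero) auto
  then show ?thesis using False by auto
qed

lemma a_measurable [measurable]: "a \<in> borel_measurable borel"
  and b_measurable [measurable]: "b \<in> borel_measurable borel"
  using a_cont b_cont by (auto intro: borel_measurable_continuous_onI)

context
  fixes r T :: real and R :: real and N :: nat
  assumes r: "0 \<le> r" and rT: "r < T" and N: "N > 0"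
begin

lemma mesh_pos: "0 < (T - r) / real N"
  using rT N by simp

lemma node_Suc: "node r T N (Suc i) = node r T N i + (T - r) / real N"
  unfolding node_def of_nat_Suc distrib_right by simp

lemma node_mono: "i \<le> j \<Longrightarrow> node r T N i \<le> node r T N j"
  unfolding node_def using mesh_pos by (intro add_left_mono mult_right_mono) auto

lemma node_ge: "r \<le> node r T N i"
  using node_mono[of 0 i] by (simp add: node_def)

lemma node_less: "node r T N i < node r T N (Suc i)"
  using mesh_pos by (simp add: node_Suc)

lemma node_le_T: "i \<le> N \<Longrightarrow> node r T N i \<le> T"
  using node_mono[of i N] N by (simp add: node_def)

lemma X_node_adapted: "j \<le> i \<Longrightarrow> X (node r T N j) \<in> borel_measurable (F (node r T N i))"
  using F_mono[OF X_adapted'[of "node r T N j"]] node_mono[of j i] node_ge[of j] r by simp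

lemma alive_adapted: "alive r T R N i \<in> borel_measurable (F (node r T N i))"
  unfolding alive_def[abs_def]
proof (intro borel_measurable_prod)
  fix j assume "j \<in> {..i}"
  then have [measurable]: "X (node r T N j) \<in> borel_measurable (F (node r T N i))"
    using X_node_adapted by simp
  show "(\<lambda>\<omega>. if \<bar>X (node r T N j) \<omega>\<bar> \<le> R then 1 else 0 :: real) \<in> borel_measurable (F (node r T N i))"
    by measurable
qed

lemma alive_measurable [measurable]: "alive r T R N i \<in> borel_measurable M"
  using alive_adapted F_measurable by blast

lemma W_node_measurable [measurable]: "W (node r T N i) \<in> borel_measurable M"
  using W_measurable node_ge[of i] r by simp

lemma euler_measurable [measurable]: "euler r T R N n \<in> borel_measurable M"
  unfolding euler_def[abs_def] by measurable

lemma euler_adapted: "euler r T R N n \<in> borel_measurable (F (node r T N n))"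
  unfolding euler_def[abs_def]
proof (intro borel_measurable_add borel_measurable_sum borel_measurable_times borel_measurable_diff)
  show "X r \<in> borel_measurable (F (node r T N n))"
    using F_mono[OF X_adapted'[OF r] node_ge] .
  fix j assume j: "j \<in> {..<n}"
  then have jn: "node r T N j \<le> node r T N n" "node r T N (Suc j) \<le> node r T N n"
    using node_mono by auto
  show "alive r T R N j \<in> borel_measurable (F (node r T N n))"
    using F_mono[OF alive_adapted jn(1)] .
  have [measurable]: "X (node r T N j) \<in> borel_measurable (F (node r T N n))"
    using X_node_adapted j by simp
  show "(\<lambda>\<omega>. b (X (node r T N j) \<omega>)) \<in> borel_measurable (F (node r T N n))"
    "(\<lambda>\<omega>. a (X (node r T N j) \<omega>)) \<in> borel_measurable (F (node r T N n))"
    by measurable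
  show "W (node r T N (Suc j)) \<in> borel_measurable (F (node r T N n))"
    "W (node r T N j) \<in> borel_measurable (F (node r T N n))"
    using F_mono[OF W_adapted jn(1)] F_mono[OF W_adapted jn(2)] node_ge[of j] node_ge[of "Suc j"] r by auto
qed auto

text \<open>The simple integrand whose Ito integral is the martingale part of \<open>euler\<close>;
  it makes the scheme accessible to \<open>ito_increment_tail_bound\<close>.\<close>

definition euler_integrand :: "nat \<Rightarrow> 'a simple_integrand" where
  "euler_integrand i = map (\<lambda>j. (node r T N j, node r T N (Suc j),
      \<lambda>\<omega>. alive r T R N j \<omega> * a (X (node r T N j) \<omega>))) [0..<i]"

lemma euler_integrand_simple:
  assumes K: "\<And>y. \<bar>y\<bar> \<le> R \<Longrightarrow> \<bar>a y\<bar> \<le> K"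
  shows "simple_integrand F (euler_integrand i)"
proof (induction i)
  case 0
  then show ?case by (simp add: euler_integrand_def)
next
  case (Suc i)
  have "\<bar>alive r T R N i \<omega> * a (X (node r T N i) \<omega>)\<bar> \<le> \<bar>K\<bar>" for \<omega>
    using alive_cases[of r T R N i \<omega>] alive_eq_1_iff[of r T R N i \<omega>] K[of "X (node r T N i) \<omega>"] by auto
  moreover have "(\<lambda>\<omega>. alive r T R N i \<omega> * a (X (node r T N i) \<omega>)) \<in> borel_measurable (F (node r T N i))"
    by (intro borel_measurable_times alive_adapted measurable_compose[OF X_node_adapted a_measurable]) simp
  ultimately have "simple_integrand F [(node r T N i, node r T N (Suc i),
      \<lambda>\<omega>. alive r T R N i \<omega> * a (X (node r T N i) \<omega>))]"
    unfolding simple_integrand_Cons using node_ge[of i] r node_less[of i] by auto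
  moreover have "euler_integrand (Suc i) = euler_integrand i @ [(node r T N i, node r T N (Suc i),
      \<lambda>\<omega>. alive r T R N i \<omega> * a (X (node r T N i) \<omega>))]"
    by (simp add: euler_integrand_def)
  ultimately show ?case using Suc by (simp add: simple_integrand_append)
qed

lemma euler_integrand_ito:
  "simple_ito W (euler_integrand i) (node r T N i) \<omega> = (\<Sum>j<i. alive r T R N j \<omega> *
      a (X (node r T N j) \<omega>) * (W (node r T N (Suc j)) \<omega> - W (node r T N j) \<omega>))"
proof -
  have "simple_ito W (euler_integrand i) t \<omega> = (\<Sum>j<i. alive r T R N j \<omega> *
      a (X (node r T N j) \<omega>) * (W (node r T N (Suc j)) \<omega> - W (node r T N j) \<omega>))" if "node r T N i \<le> t" for t
    using that
  proof (induction i)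
    case 0
    then show ?case by (simp add: euler_integrand_def)
  next
    case (Suc i)
    have "node r T N i \<le> t" using Suc(2) node_less[of i] by simp
    moreover have "euler_integrand (Suc i) = euler_integrand i @ [(node r T N i, node r T N (Suc i),
        \<lambda>\<omega>. alive r T R N i \<omega> * a (X (node r T N i) \<omega>))]"
      by (simp add: euler_integrand_def)
    ultimately show ?case using Suc by (simp add: simple_ito_append simple_ito_Cons min_absorb2)
  qed
  then show ?thesis by simp
qed

lemma euler_integrand_value_0:
  assumes "s \<le> r"
  shows "simple_value (euler_integrand i) s \<omega> = 0"
proof (induction i)
  case 0
  then show ?case by (simp add: euler_integrand_def)
next
  case (Suc i)
  have eq: "euler_integrand (Suc i) = euler_integrand i @ [(node r T N i, node r T N (Suc i),
      \<lambda>\<omega>. alive r T R N i \<omega> * a (X (node r T N i) \<omega>))]"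
    by (simp add: euler_integrand_def)
  have "s \<notin> {node r T N i<..node r T N (Suc i)}" using assms node_ge[of i] by simp
  then show ?case unfolding eq simple_value_append Suc simple_value_Cons by simp
qed

text \<open>On surviving paths the squared distance to \<open>a (X s \<omega>)\<close> thus becomes
  the quantity that \<open>path_osc\<close> measures with exponent 2.\<close>

lemma euler_integrand_value:
  assumes "\<And>j. j < i \<Longrightarrow> alive r T R N j \<omega> = 1"
  shows "simple_value (euler_integrand i) s \<omega>
    = (if r < s \<and> s \<le> node r T N i then a (X (grid_left r ((T - r) / real N) s) \<omega>) else 0)"
  using assms
proof (induction i)
  case 0
  then show ?case by (simp add: euler_integrand_def node_def)
next
  case (Suc i)
  have eq: "euler_integrand (Suc i) = euler_integrand i @ [(node r T N i, node r T N (Suc i),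
      \<lambda>\<omega>. alive r T R N i \<omega> * a (X (node r T N i) \<omega>))]"
    by (simp add: euler_integrand_def)
  have IH: "simple_value (euler_integrand i) s \<omega>
    = (if r < s \<and> s \<le> node r T N i then a (X (grid_left r ((T - r) / real N) s) \<omega>) else 0)"
    by (rule Suc.IH) (use Suc.prems in auto)
  have "grid_left r ((T - r) / real N) s = node r T N i" if "node r T N i < s" "s \<le> node r T N (Suc i)"
    using grid_left_eq[OF mesh_pos, of r i s] that by (simp add: node_def)
  then show ?case
    unfolding eq simple_value_append IH simple_value_Cons
    using Suc.prems[of i] node_ge[of i] node_less[of i] by (auto simp: indicator_def)
qed

end

lemma ito_remainder_measurable:
  assumes "0 \<le> t"
  shows "(\<lambda>\<omega>. X t \<omega> - x - (LBINT s=0..t. b (X s \<omega>))) \<in> borel_measurable M"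
proof -
  note [measurable (raw)] = X_comp_measurable
  show ?thesis
    using assms by (simp add: zero_ereal_def interval_integral_Icc set_lebesgue_integral_def)
qed

lemma path_drift_integrable:
  fixes q :: "real \<Rightarrow> real"
  assumes "continuous_on UNIV q" "\<omega> \<in> space M"
  shows "set_integrable lborel {s..t} (\<lambda>s. q (X s \<omega>))"
proof (rule borel_integrable_atLeastAtMost')
  show "continuous_on {s..t} (\<lambda>s. q (X s \<omega>))"
    using continuous_on_compose2[OF assms(1) X_cont[OF assms(2)]] continuous_on_subset by blast
qed

lemma ito_increment_eq:
  assumes "0 \<le> r" "r \<le> t" "\<omega> \<in> space M"
  shows "(X t \<omega> - x - (LBINT s=0..t. b (X s \<omega>))) - (X r \<omega> - x - (LBINT s=0..r. b (X s \<omega>)))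
    = X t \<omega> - X r \<omega> - (LINT s:{r<..t}|lborel. b (X s \<omega>))"
proof -
  have "(LBINT s=ereal 0..ereal r. b (X s \<omega>)) + (LBINT s=ereal r..ereal t. b (X s \<omega>)) = (LBINT s=ereal 0..ereal t. b (X s \<omega>))"
  proof (rule interval_integral_sum)
    have "interval_lebesgue_integrable lborel (ereal 0) (ereal t) (\<lambda>s. b (X s \<omega>))"
      unfolding interval_lebesgue_integrable_def using assms
      by (auto intro!: set_integrable_subset[OF path_drift_integrable[OF b_cont assms(3), of 0 t]])
    then show "interval_lebesgue_integrable lborel (min (ereal 0) (min (ereal r) (ereal t))) (max (ereal 0) (max (ereal r) (ereal t))) (\<lambda>s. b (X s \<omega>))"
      using assms by (simp add: max_def min_def)
  qed
  moreover have "(LBINT s=ereal r..ereal t. b (X s \<omega>)) = (LINT s:{r<..t}|lborel. b (X s \<omega>))"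
    using assms by (simp add: interval_integral_Ioc)
  ultimately show ?thesis by (simp add: zero_ereal_def)
qed

text \<open>On surviving paths \<open>euler\<close> is \<open>X r\<close> plus a left Riemann sum of
  the drift plus the integral of a step approximation of \<open>a (X s \<omega>)\<close>. Each of
  the last two differs from its counterpart for \<open>X\<close> by at most
  \<open>\<eta> / 2\<close> outside a small event. The oscillations are taken over all of
  \<open>(r,T]\<close>, so one threshold for \<open>N\<close> serves all nodes.\<close>

lemma euler_close:
  assumes r: "0 \<le> r" and rT: "r < T" and "\<eta> > 0" "\<kappa> > 0"
  shows "\<forall>\<^sub>F N in sequentially. \<forall>i\<le>N. prob {\<omega> \<in> space M. alive r T R N i \<omega> = 1 \<and>
    \<bar>euler r T R N i \<omega> - X (node r T N i) \<omega>\<bar> > \<eta>} \<le> \<kappa>"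
proof -
  obtain K where K: "K \<ge> 0" "\<And>y. \<bar>y\<bar> \<le> R \<Longrightarrow> \<bar>a y\<bar> \<le> K"
    using continuous_bounded_on_interval[OF a_cont, where R=R] by blast
  \<comment> \<open>\<open>3 * \<epsilon> = \<eta> / 2\<close> matches the threshold in
    \<open>ito_increment_tail_bound\<close>, and
    \<open>6 * \<delta> / \<epsilon>\<^sup>2 = \<kappa> / 4\<close> leaves room for the two
    oscillation events, each of probability below \<open>\<kappa> / 4\<close>.\<close>
  define \<epsilon> where "\<epsilon> = \<eta> / 6"
  define \<delta> where "\<delta> = \<kappa> * \<epsilon>\<^sup>2 / 24"
  have \<epsilon>\<delta>: "\<epsilon> > 0" "\<delta> > 0" "6 * \<delta> / \<epsilon>\<^sup>2 = \<kappa> / 4" using \<open>\<eta> > 0\<close> \<open>\<kappa> > 0\<close> by (auto simp: \<epsilon>_def \<delta>_def)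
  let ?Qa = "\<lambda>N. {\<omega> \<in> space M. path_osc r T a 2 N \<omega> > ennreal \<delta>}"
  let ?Qb = "\<lambda>N. {\<omega> \<in> space M. path_osc r T b 1 N \<omega> > ennreal (\<eta> / 2)}"
  have "\<forall>\<^sub>F N in sequentially. prob (?Qa N) < \<kappa> / 4"
    using path_osc_in_probability[OF a_cont rT, of 2 \<delta>] \<epsilon>\<delta> \<open>\<kappa> > 0\<close> by (intro order_tendstoD(2)) auto
  moreover have "\<forall>\<^sub>F N in sequentially. prob (?Qb N) < \<kappa> / 4"
    using path_osc_in_probability[OF b_cont rT, of 1 "\<eta> / 2"] \<open>\<eta> > 0\<close> \<open>\<kappa> > 0\<close> by (intro order_tendstoD(2)) auto
  ultimately show ?thesis
    using eventually_gt_at_top[of 0]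
  proof eventually_elim
    case (elim N)
    then have N: "N > 0" by simp
    show ?case
    proof (intro allI impI)
      fix i assume i: "i \<le> N"
      let ?t = "node r T N i"
      let ?S = "euler_integrand r T R N i"
      let ?B = "{\<omega> \<in> space M. alive r T R N i \<omega> = 1}"
      let ?I = "\<lambda>\<omega>. X ?t \<omega> - x - (LBINT s=0..?t. b (X s \<omega>))"
      let ?J = "\<lambda>\<omega>. X r \<omega> - x - (LBINT s=0..r. b (X s \<omega>))"
      note facts = r rT N
      note [measurable] = alive_measurable[OF facts] path_osc_measurable[OF a_cont] path_osc_measurable[OF b_cont]
        euler_measurable[OF facts]
      have rt: "r \<le> ?t" using node_ge[OF facts] .
      have t0: "0 \<le> ?t" using rt r by simp
      have B: "?B \<in> sets M" by measurable
      have Qa: "?Qa N \<in> sets M" and Qb: "?Qb N \<in> sets M" by measurable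
      have alive_le: "alive r T R N j \<omega> = 1" if "alive r T R N i \<omega> = 1" "j \<le> i" for j \<omega>
        using that unfolding alive_eq_1_iff by auto
      have P: "prob {\<omega> \<in> ?B. \<bar>simple_ito W ?S ?t \<omega> - (?I \<omega> - ?J \<omega>)\<bar> > 3 * \<epsilon>} \<le> 6 * \<delta> / \<epsilon>\<^sup>2 + prob (?Qa N)"
      proof (rule ito_increment_tail_bound[OF r rt X_ito[OF t0] ito_remainder_measurable[OF t0] X_ito[OF r] ito_remainder_measurable[OF r] _ _ _ B Qa _ \<epsilon>\<delta>(2,1)])
        show "(\<lambda>s. a (X s \<omega>)) \<in> borel_measurable borel" if "\<omega> \<in> space M" for \<omega>
          using X_path_measurable[OF that] by measurable
        show "simple_integrand F ?S" by (rule euler_integrand_simple[OF facts K(2)])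
        show "simple_value ?S s \<omega> = 0" if "s \<le> r" for s \<omega>
          using that by (rule euler_integrand_value_0[OF facts])
        fix \<omega> assume \<omega>: "\<omega> \<in> ?B - ?Qa N"
        have val: "simple_value ?S s \<omega> = a (X (grid_left r ((T - r) / real N) s) \<omega>)" if "s \<in> {r<..?t}" for s
          using euler_integrand_value[OF facts, of i R \<omega> s] alive_le[of \<omega>] \<omega> that by auto
        have "(\<integral>\<^sup>+ s \<in> {r<..?t}. ennreal ((simple_value ?S s \<omega> - a (X s \<omega>))\<^sup>2) \<partial>lborel) \<le> path_osc r T a 2 N \<omega>"
          unfolding path_osc_def
        proof (rule nn_integral_mono)
          fix s
          show "ennreal ((simple_value ?S s \<omega> - a (X s \<omega>))\<^sup>2) * indicator {r<..?t} s
            \<le> ennreal (\<bar>a (X (grid_left r ((T - r) / real N) s) \<omega>) - a (X s \<omega>)\<bar>\<^sup>2) * indicator {r<..T} s"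
            using val[of s] node_le_T[OF facts i] by (auto simp: indicator_def)
        qed
        also have "\<dots> \<le> ennreal \<delta>" using \<omega> by (auto simp: not_less)
        finally show "(\<integral>\<^sup>+ s \<in> {r<..?t}. ennreal ((simple_value ?S s \<omega> - a (X s \<omega>))\<^sup>2) \<partial>lborel) \<le> ennreal \<delta>" .
      qed
      let ?A = "{\<omega> \<in> ?B. \<bar>simple_ito W ?S ?t \<omega> - (?I \<omega> - ?J \<omega>)\<bar> > 3 * \<epsilon>}"
      have A: "?A \<in> sets M"
      proof -
        have [measurable]: "simple_ito W ?S ?t \<in> borel_measurable M"
          by (rule simple_ito_measurable[OF euler_integrand_simple[OF facts K(2)] t0])
        note [measurable] = ito_remainder_measurable[OF t0] ito_remainder_measurable[OF r]
        show ?thesis using B by measurable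
      qed
      have "prob {\<omega> \<in> space M. alive r T R N i \<omega> = 1 \<and> \<bar>euler r T R N i \<omega> - X ?t \<omega>\<bar> > \<eta>} \<le> prob (?A \<union> ?Qb N)"
      proof (rule finite_measure_mono)
        show "{\<omega> \<in> space M. alive r T R N i \<omega> = 1 \<and> \<bar>euler r T R N i \<omega> - X ?t \<omega>\<bar> > \<eta>} \<subseteq> ?A \<union> ?Qb N"
        proof (rule subsetI, rule ccontr)
          fix \<omega> assume \<omega>: "\<omega> \<in> {\<omega> \<in> space M. alive r T R N i \<omega> = 1 \<and> \<bar>euler r T R N i \<omega> - X ?t \<omega>\<bar> > \<eta>}"
            and n: "\<omega> \<notin> ?A \<union> ?Qb N"
          then have sp: "\<omega> \<in> space M" and al: "alive r T R N i \<omega> = 1" by auto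
          let ?h = "(T - r) / real N"
          have d: "\<bar>(\<Sum>j<i. b (X (node r T N j) \<omega>) * ?h) - (LINT s:{r<..?t}|lborel. b (X s \<omega>))\<bar> \<le> \<eta> / 2"
          proof -
            have "ennreal \<bar>(\<Sum>j<i. b (X (node r T N j) \<omega>) * ?h) - (LINT s:{r<..?t}|lborel. b (X s \<omega>))\<bar> \<le> path_osc r T b 1 N \<omega>"
              using riemann_sum_osc[OF b_cont sp rT N i] by (simp add: node_def)
            also have "\<dots> \<le> ennreal (\<eta> / 2)" using n sp by (auto simp: not_less)
            finally show ?thesis using \<open>\<eta> > 0\<close> by (subst (asm) ennreal_le_iff) auto
          qed
          have m: "\<bar>simple_ito W ?S ?t \<omega> - (?I \<omega> - ?J \<omega>)\<bar> \<le> \<eta> / 2"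
            using n sp al by (auto simp: not_less \<epsilon>_def)
          have "euler r T R N i \<omega> = X r \<omega> + (\<Sum>j<i. b (X (node r T N j) \<omega>) * ?h) + simple_ito W ?S ?t \<omega>"
            unfolding euler_integrand_ito[OF facts] euler_def
            using alive_le[OF al] by (simp add: distrib_left sum.distrib)
          then have "\<bar>euler r T R N i \<omega> - X ?t \<omega>\<bar> \<le> \<eta>"
            using d m ito_increment_eq[OF r rt sp] by linarith
          then show False using \<omega> by simp
        qed
      qed (use A Qb in auto)
      also have "\<dots> \<le> prob ?A + prob (?Qb N)" using A Qb by (rule measure_Un_le)
      also have "\<dots> \<le> \<kappa>" using P elim \<open>\<kappa> > 0\<close> unfolding \<epsilon>\<delta>(3) by linarith
      finally show "prob {\<omega> \<in> space M. alive r T R N i \<omega> = 1 \<and> \<bar>euler r T R N i \<omega> - X ?t \<omega>\<bar> > \<eta>} \<le> \<kappa>" .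
    qed
  qed
qed

end

section \<open>From Euler steps to an occupation bound\<close>

lemma (in test_function) v'_lipschitz: "\<bar>v' z - v' y\<bar> \<le> B * \<bar>z - y\<bar>"
proof -
  have "norm (v' z - v' y) \<le> B * norm (z - y)"
    by (rule field_differentiable_bound[of UNIV v' v'' B])
      (use deriv2 bounds(3) in \<open>auto intro: has_field_derivative_at_within\<close>)
  then show ?thesis by simp
qed

text \<open>The derivatives of \<open>v\<close> are taken at the scheme \<open>y\<close>, the
  coefficients at \<open>X\<close>, here \<open>z\<close>. If the two are close, uniform continuity
  gives the error \<open>\<epsilon>\<close>; otherwise the bound \<open>2 * B\<close> on differences
  of derivatives is paid, but only on an event that \<open>euler_close\<close> makes rare.\<close>

lemma (in test_function) drift_perturbation:
  assumes "\<epsilon> > 0" "K \<ge> 0"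
  obtains \<eta> where "\<eta> > 0" "\<And>y z \<beta> \<alpha>. \<bar>\<beta>\<bar> \<le> K \<Longrightarrow> \<bar>\<alpha>\<bar> \<le> K \<Longrightarrow>
    v' y * \<beta> + v'' y * \<alpha>\<^sup>2 / 2 \<le> v' z * \<beta> + v'' z * \<alpha>\<^sup>2 / 2
      + (\<epsilon> + 2 * B * (K + K\<^sup>2) * (if \<bar>y - z\<bar> > \<eta> then 1 else 0))"
proof -
  \<comment> \<open>Chosen so that \<open>\<epsilon>1 * (K + K\<^sup>2) \<le> \<epsilon>\<close>;
    the summand 1 avoids division by 0.\<close>
  define \<epsilon>1 where "\<epsilon>1 = \<epsilon> / (K + K\<^sup>2 + 1)"
  have Kpos: "K + K\<^sup>2 + 1 > 0" using assms by (simp add: add_nonneg_pos)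
  have \<epsilon>1: "\<epsilon>1 > 0" using Kpos \<open>\<epsilon> > 0\<close> by (simp add: \<epsilon>1_def)
  have "\<epsilon>1 * (K + K\<^sup>2) \<le> \<epsilon>1 * (K + K\<^sup>2 + 1)" using \<epsilon>1 by (intro mult_left_mono) auto
  also have "\<dots> = \<epsilon>" using Kpos by (simp add: \<epsilon>1_def)
  finally have \<epsilon>1': "\<epsilon>1 * (K + K\<^sup>2) \<le> \<epsilon>" .
  obtain \<eta>2 where \<eta>2: "\<eta>2 > 0" "\<And>y z. \<bar>z - y\<bar> < \<eta>2 \<Longrightarrow> \<bar>v'' z - v'' y\<bar> < \<epsilon>1"
    using unif \<epsilon>1 unfolding uniformly_continuous_on_def dist_real_def by (metis UNIV_I)
  define \<eta> where "\<eta> = min (\<eta>2 / 2) (\<epsilon>1 / (B + 1))"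
  have \<eta>: "\<eta> > 0" using \<eta>2(1) \<epsilon>1 B_nonneg by (simp add: \<eta>_def)
  have \<eta>v': "\<bar>v' y - v' z\<bar> \<le> \<epsilon>1" if "\<bar>y - z\<bar> \<le> \<eta>" for y z
  proof -
    have "B * \<bar>y - z\<bar> \<le> (B + 1) * (\<epsilon>1 / (B + 1))"
      using that B_nonneg by (intro mult_mono) (auto simp: \<eta>_def)
    also have "\<dots> = \<epsilon>1" using B_nonneg by simp
    finally show ?thesis using v'_lipschitz[of y z] by linarith
  qed
  have \<eta>v'': "\<bar>v'' y - v'' z\<bar> \<le> \<epsilon>1" if "\<bar>y - z\<bar> \<le> \<eta>" for y z
  proof -
    have "\<eta> < \<eta>2" using \<eta>2(1) by (auto simp: \<eta>_def)
    then show ?thesis using \<eta>2(2)[of y z] that by linarith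
  qed
  have prod_le: "p * \<beta> + q * \<alpha>\<^sup>2 / 2 \<le> k * (K + K\<^sup>2)"
    if "\<bar>p\<bar> \<le> k" "\<bar>q\<bar> \<le> k" "\<bar>\<beta>\<bar> \<le> K" "\<bar>\<alpha>\<bar> \<le> K" for p q k \<beta> \<alpha>
  proof -
    have k: "0 \<le> k" using that(1) by linarith
    have a2: "\<alpha>\<^sup>2 \<le> K\<^sup>2" using assms(2) that(4) by (intro abs_le_square_iff[THEN iffD1]) simp
    have "\<bar>p * \<beta>\<bar> \<le> k * K"
      unfolding abs_mult using that k by (intro mult_mono) auto
    moreover have "q * \<alpha>\<^sup>2 \<le> k * K\<^sup>2"
      using that(2) a2 k by (intro mult_mono) auto
    moreover have "0 \<le> k * K\<^sup>2" using k by simp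
    ultimately show ?thesis unfolding distrib_left by linarith
  qed
  have "v' y * \<beta> + v'' y * \<alpha>\<^sup>2 / 2 \<le> v' z * \<beta> + v'' z * \<alpha>\<^sup>2 / 2
      + (\<epsilon> + 2 * B * (K + K\<^sup>2) * (if \<bar>y - z\<bar> > \<eta> then 1 else 0))"
    if "\<bar>\<beta>\<bar> \<le> K" "\<bar>\<alpha>\<bar> \<le> K" for y z \<beta> \<alpha>
  proof -
    have split: "v' y * \<beta> + v'' y * \<alpha>\<^sup>2 / 2
      = (v' z * \<beta> + v'' z * \<alpha>\<^sup>2 / 2) + ((v' y - v' z) * \<beta> + (v'' y - v'' z) * \<alpha>\<^sup>2 / 2)"
      by (simp add: field_simps)
    show ?thesis
    proof (cases "\<bar>y - z\<bar> > \<eta>")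
      case False
      then have "(v' y - v' z) * \<beta> + (v'' y - v'' z) * \<alpha>\<^sup>2 / 2 \<le> \<epsilon>1 * (K + K\<^sup>2)"
        using that by (intro prod_le \<eta>v' \<eta>v'') auto
      then show ?thesis using split \<epsilon>1' False by simp
    next
      case True
      have "\<bar>v' y - v' z\<bar> \<le> 2 * B" "\<bar>v'' y - v'' z\<bar> \<le> 2 * B"
        using bounds(2)[of y] bounds(2)[of z] bounds(3)[of y] bounds(3)[of z] by linarith+
      then have "(v' y - v' z) * \<beta> + (v'' y - v'' z) * \<alpha>\<^sup>2 / 2 \<le> (2 * B) * (K + K\<^sup>2)"
        using that by (intro prod_le)
      then show ?thesis using split True \<open>\<epsilon> > 0\<close> by simp
    qed
  qed
  then show ?thesis using that[OF \<eta>] by blast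
qed

context diffusion_path
begin

text \<open>The nodes of all grids form a countable set, so the event is measurable; it does not
  depend on \<open>N\<close> and guarantees survival of the scheme for every
  \<open>N\<close>.\<close>

definition stays_in :: "real \<Rightarrow> real \<Rightarrow> real \<Rightarrow> 'a set" where
  "stays_in r T R = {\<omega> \<in> space M. \<forall>N. \<forall>i\<le>N. \<bar>X (node r T N i) \<omega>\<bar> \<le> R}"

lemma stays_in_sets [measurable]: "stays_in r T R \<in> sets M"
  unfolding stays_in_def by measurable

lemma stays_in_alive: "\<omega> \<in> stays_in r T R \<Longrightarrow> i \<le> N \<Longrightarrow> alive r T R N i \<omega> = 1"
  by (auto simp: stays_in_def alive_eq_1_iff)

text \<open>Where \<open>alive\<close> is 1, the current value of \<open>X\<close> lies in
  \<open>[-R,R]\<close> and the perturbed generator inequality applies; where it is 0, the drift and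
  the \<open>\<psi>\<close> term both vanish. Integration against \<open>\<xi>\<close> charges
  \<open>L\<close> for the event that the scheme is far from \<open>X\<close>.\<close>

lemma euler_drift_bound:
  assumes v: "test_function v v' v'' B" and \<psi>: "continuous_on UNIV \<psi>"
    and \<xi>M: "\<xi> \<in> borel_measurable M" and \<xi>: "\<And>\<omega>. \<omega> \<in> space M \<Longrightarrow> 0 \<le> \<xi> \<omega> \<and> \<xi> \<omega> \<le> c"
    and K: "K \<ge> 0" "\<And>y. \<bar>y\<bar> \<le> R \<Longrightarrow> \<bar>a y\<bar> \<le> K" "\<And>y. \<bar>y\<bar> \<le> R \<Longrightarrow> \<bar>b y\<bar> \<le> K"
    and facts: "0 \<le> r" "r < T" "N > 0" and \<epsilon>: "0 \<le> \<epsilon>" and L: "0 \<le> L"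
    and Q: "\<And>y z. \<bar>z\<bar> \<le> R \<Longrightarrow> v' y * b z + v'' y * (a z)\<^sup>2 / 2 \<le> - \<psi> z + (\<epsilon> + L * (if \<bar>y - z\<bar> > \<eta> then 1 else 0))"
  shows "expectation (\<lambda>\<omega>. \<xi> \<omega> * (v' (euler r T R N n \<omega>) * (alive r T R N n \<omega> * b (X (node r T N n) \<omega>))
      + v'' (euler r T R N n \<omega>) * (alive r T R N n \<omega> * a (X (node r T N n) \<omega>))\<^sup>2 / 2))
    \<le> - expectation (\<lambda>\<omega>. \<xi> \<omega> * (alive r T R N n \<omega> * \<psi> (X (node r T N n) \<omega>)))
      + c * (\<epsilon> + L * prob {\<omega> \<in> space M. alive r T R N n \<omega> = 1 \<and> \<bar>euler r T R N n \<omega> - X (node r T N n) \<omega>\<bar> > \<eta>})"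
proof -
  interpret test_function v v' v'' B by (rule v)
  obtain \<omega>0 where "\<omega>0 \<in> space M" using not_empty by blast
  then have c: "0 \<le> c" using \<xi>[of \<omega>0] by linarith
  note [measurable] = alive_measurable[OF facts] euler_measurable[OF facts] v_measurable \<xi>M
  have [measurable]: "\<psi> \<in> borel_measurable borel" using \<psi> by (rule borel_measurable_continuous_onI)
  define e where "e = alive r T R N n"
  define Z where "Z = X (node r T N n)"
  define Y where "Y = euler r T R N n"
  have [measurable]: "e \<in> borel_measurable M" "Z \<in> borel_measurable M" "Y \<in> borel_measurable M"
    unfolding e_def Z_def Y_def by measurable
  let ?A = "{\<omega> \<in> space M. e \<omega> = 1 \<and> \<bar>Y \<omega> - Z \<omega>\<bar> > \<eta>}"
  let ?q = "\<lambda>\<omega>. v' (Y \<omega>) * (e \<omega> * b (Z \<omega>)) + v'' (Y \<omega>) * (e \<omega> * a (Z \<omega>))\<^sup>2 / 2"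
  let ?k = "\<lambda>\<omega>. c * (\<epsilon> + L * indicator ?A \<omega>)"
  have A: "?A \<in> sets M" by measurable
  obtain P where P: "P \<ge> 0" "\<And>y. \<bar>y\<bar> \<le> R \<Longrightarrow> \<bar>\<psi> y\<bar> \<le> P"
    using continuous_bounded_on_interval[OF \<psi>, where R=R] by blast
  have e01: "e \<omega> = 0 \<or> e \<omega> = 1" for \<omega> using alive_cases by (simp add: e_def)
  have eZ: "\<bar>Z \<omega>\<bar> \<le> R" if "e \<omega> = 1" for \<omega>
    using that unfolding e_def Z_def alive_eq_1_iff by simp
  have q_le: "\<bar>?q \<omega>\<bar> \<le> B * K + B * K\<^sup>2" for \<omega>
  proof (cases "e \<omega> = 1")
    case True
    have b1: "\<bar>b (Z \<omega>)\<bar> \<le> K" and a1: "(a (Z \<omega>))\<^sup>2 \<le> K\<^sup>2"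
      using K eZ[OF True] by (auto intro!: abs_le_square_iff[THEN iffD1])
    have "\<bar>v' (Y \<omega>) * b (Z \<omega>)\<bar> \<le> B * K"
      unfolding abs_mult using bounds(2) b1 B_nonneg by (intro mult_mono) auto
    moreover have "\<bar>v'' (Y \<omega>) * (a (Z \<omega>))\<^sup>2\<bar> \<le> B * K\<^sup>2"
      unfolding abs_mult using bounds(3) a1 B_nonneg by (intro mult_mono) auto
    ultimately show ?thesis unfolding True mult_1 by linarith
  next
    case False
    then show ?thesis using e01[of \<omega>] B_nonneg K(1) by auto
  qed
  have \<psi>_le: "\<bar>e \<omega> * \<psi> (Z \<omega>)\<bar> \<le> P" for \<omega>
    using e01[of \<omega>] eZ[of \<omega>] P by auto
  have \<xi>_mult: "\<bar>\<xi> \<omega> * y\<bar> \<le> c * k" if "\<omega> \<in> space M" "\<bar>y\<bar> \<le> k" for \<omega> y k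
    unfolding abs_mult using \<xi>[OF that(1)] that(2) c by (intro mult_mono) auto
  have i1: "integrable M (\<lambda>\<omega>. \<xi> \<omega> * ?q \<omega>)"
    by (rule integrable_bounded[OF _ \<xi>_mult[OF _ q_le]]) measurable
  have i2: "integrable M (\<lambda>\<omega>. \<xi> \<omega> * (e \<omega> * \<psi> (Z \<omega>)))"
    by (rule integrable_bounded[OF _ \<xi>_mult[OF _ \<psi>_le]]) measurable
  have i3: "integrable M ?k" "expectation ?k = c * (\<epsilon> + L * prob ?A)"
  proof -
    define A' where "A' = ?A"
    have "A' \<in> sets M" using A by (simp add: A'_def)
    then have "integrable M (\<lambda>\<omega>. L * indicator A' \<omega> :: real)" 
      using L by (intro integrable_bounded[where C=L]) (auto simp: indicator_def)
    then show "integrable M ?k" "expectation ?k = c * (\<epsilon> + L * prob ?A)"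
      using \<open>A' \<in> sets M\<close> unfolding A'_def[symmetric] by (simp_all add: prob_space)
  qed
  have i4: "integrable M (\<lambda>\<omega>. - (\<xi> \<omega> * (e \<omega> * \<psi> (Z \<omega>))) + ?k \<omega>)"
    by (intro Bochner_Integration.integrable_add Bochner_Integration.integrable_minus i2 i3)
  have "expectation (\<lambda>\<omega>. \<xi> \<omega> * ?q \<omega>) \<le> expectation (\<lambda>\<omega>. - (\<xi> \<omega> * (e \<omega> * \<psi> (Z \<omega>))) + ?k \<omega>)"
  proof (rule integral_mono[OF i1 i4])
    fix \<omega> assume \<omega>: "\<omega> \<in> space M"
    let ?l = "\<epsilon> + L * indicator ?A \<omega>"
    have l: "0 \<le> ?l" using L \<epsilon> by simp
    show "\<xi> \<omega> * ?q \<omega> \<le> - (\<xi> \<omega> * (e \<omega> * \<psi> (Z \<omega>))) + c * ?l"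
    proof (cases "e \<omega> = 1")
      case True
      have "(if \<bar>Y \<omega> - Z \<omega>\<bar> > \<eta> then 1 else 0) = (indicator ?A \<omega> :: real)"
        using True \<omega> by (simp add: indicator_def)
      then have "v' (Y \<omega>) * b (Z \<omega>) + v'' (Y \<omega>) * (a (Z \<omega>))\<^sup>2 / 2 \<le> - \<psi> (Z \<omega>) + ?l"
        using Q[OF eZ[OF True], of "Y \<omega>"] by (simp only:)
      then have "\<xi> \<omega> * (v' (Y \<omega>) * b (Z \<omega>) + v'' (Y \<omega>) * (a (Z \<omega>))\<^sup>2 / 2) \<le> \<xi> \<omega> * (- \<psi> (Z \<omega>) + ?l)"
        using \<xi>[OF \<omega>] by (intro mult_left_mono) auto
      also have "\<dots> = - (\<xi> \<omega> * \<psi> (Z \<omega>)) + \<xi> \<omega> * ?l" by (simp only: distrib_left mult_minus_right)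
      also have "\<dots> \<le> - (\<xi> \<omega> * \<psi> (Z \<omega>)) + c * ?l"
        using \<xi>[OF \<omega>] l by (intro add_left_mono mult_right_mono) auto
      finally show ?thesis unfolding True mult_1 .
    next
      case False
      then have "e \<omega> = 0" using e01 by blast
      moreover have "0 \<le> c * ?l" using c l by (rule mult_nonneg_nonneg)
      ultimately show ?thesis by simp
    qed
  qed
  also have "\<dots> = - expectation (\<lambda>\<omega>. \<xi> \<omega> * (e \<omega> * \<psi> (Z \<omega>))) + c * (\<epsilon> + L * prob ?A)"
    using Bochner_Integration.integral_add[OF Bochner_Integration.integrable_minus[OF i2] i3(1)] i3(2) by simp
  finally show ?thesis unfolding e_def Y_def Z_def .
qed

text \<open>The one-step estimates telescope, and the terminal expectation is dropped because
  \<open>v\<close> is nonnegative. In \<open>4 * K\<^sup>2 + 3\<close> the first term is the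
  quadratic Taylor error; the 3 counts one \<open>\<epsilon>\<close> each from
  \<open>drift_perturbation\<close>, from the event that the scheme is far, and from the terms of
  order \<open>h\<^sup>2\<close>.\<close>

lemma euler_sum_bound:
  assumes v: "test_function v v' v'' B" and v0: "\<And>y. 0 \<le> v y"
    and \<psi>: "continuous_on UNIV \<psi>" "\<And>y. 0 \<le> \<psi> y"
    and gen: "\<And>y. \<bar>y\<bar> \<le> R \<Longrightarrow> v' y * b y + v'' y * (a y)\<^sup>2 / 2 \<le> - \<psi> y"
    and r: "0 \<le> r" and rT: "r < T"
    and \<xi>: "\<xi> \<in> borel_measurable (F r)" "\<And>\<omega>. \<omega> \<in> space M \<Longrightarrow> 0 \<le> \<xi> \<omega> \<and> \<xi> \<omega> \<le> c"
    and K: "K \<ge> 0" "\<And>y. \<bar>y\<bar> \<le> R \<Longrightarrow> \<bar>a y\<bar> \<le> K" "\<And>y. \<bar>y\<bar> \<le> R \<Longrightarrow> \<bar>b y\<bar> \<le> K" and "\<epsilon> > 0"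
  shows "\<forall>\<^sub>F N in sequentially. (\<Sum>j<N. (T - r) / real N *
      expectation (\<lambda>\<omega>. \<xi> \<omega> * (alive r T R N j \<omega> * \<psi> (X (node r T N j) \<omega>))))
    \<le> expectation (\<lambda>\<omega>. \<xi> \<omega> * v (X r \<omega>)) + (T - r) * (c * (\<epsilon> * (4 * K\<^sup>2 + 3)))"
proof -
  interpret test_function v v' v'' B by (rule v)
  obtain C where C: "C \<ge> 0" "\<And>y d. v (y + d) \<le> v y + v' y * d + v'' y * d\<^sup>2 / 2 + \<epsilon> * d\<^sup>2 + C * d ^ 4"
    using taylor_bound[OF \<open>\<epsilon> > 0\<close>] by blast
  obtain \<omega>0 where "\<omega>0 \<in> space M" using not_empty by blast
  then have c: "0 \<le> c" using \<xi>(2)[of \<omega>0] by linarith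
  define L where "L = 2 * B * (K + K\<^sup>2)"
  have L: "L \<ge> 0" using B_nonneg K(1) by (simp add: L_def)
  obtain \<eta> where \<eta>: "\<eta> > 0" and pert: "\<And>y z \<beta> \<alpha>. \<bar>\<beta>\<bar> \<le> K \<Longrightarrow> \<bar>\<alpha>\<bar> \<le> K \<Longrightarrow>
      v' y * \<beta> + v'' y * \<alpha>\<^sup>2 / 2 \<le> v' z * \<beta> + v'' z * \<alpha>\<^sup>2 / 2 + (\<epsilon> + L * (if \<bar>y - z\<bar> > \<eta> then 1 else 0))"
    using drift_perturbation[OF \<open>\<epsilon> > 0\<close> K(1)] unfolding L_def by blast
  have Q: "v' y * b z + v'' y * (a z)\<^sup>2 / 2 \<le> - \<psi> z + (\<epsilon> + L * (if \<bar>y - z\<bar> > \<eta> then 1 else 0))"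
    if "\<bar>z\<bar> \<le> R" for y z
    using pert[OF K(3)[OF that] K(2)[OF that], of y z] gen[OF that] by linarith
  \<comment> \<open>Makes the price \<open>L * \<kappa>\<close> of the far event at most
    \<open>\<epsilon>\<close>, also when \<open>L = 0\<close>.\<close>
  define \<kappa> where "\<kappa> = \<epsilon> / (L + 1)"
  have \<kappa>: "\<kappa> > 0" "L * \<kappa> \<le> \<epsilon>"
  proof -
    show "\<kappa> > 0" using L \<open>\<epsilon> > 0\<close> by (simp add: \<kappa>_def)
    have "L * \<kappa> \<le> (L + 1) * \<kappa>" using \<open>\<kappa> > 0\<close> by (intro mult_right_mono) auto
    also have "\<dots> = \<epsilon>" using L by (simp add: \<kappa>_def)
    finally show "L * \<kappa> \<le> \<epsilon>" .
  qed
  define C' where "C' = B * K\<^sup>2 + 32 * C * K ^ 4"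
  have h_lim: "(\<lambda>N. (T - r) / real N) \<longlonglongrightarrow> 0" by (rule lim_const_over_n)
  have "\<forall>\<^sub>F N in sequentially. (T - r) / real N < 1"
    using h_lim by (intro order_tendstoD(2)) auto
  moreover have "\<forall>\<^sub>F N in sequentially. C' * ((T - r) / real N) < \<epsilon>"
    using tendsto_mult_left[OF h_lim, of C'] \<open>\<epsilon> > 0\<close> by (intro order_tendstoD(2)) auto
  ultimately show ?thesis
    using euler_close[OF r rT \<eta> \<kappa>(1), of R] eventually_gt_at_top[of 0]
  proof eventually_elim
    case (elim N)
    then have N: "N > 0" by simp
    define h where "h = (T - r) / real N"
    have h: "0 < h" "h \<le> 1" "C' * h \<le> \<epsilon>" using elim rT N by (auto simp: h_def)
    note facts = r rT N
    note [measurable] = alive_measurable[OF facts] euler_measurable[OF facts] v_measurable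
    have [measurable]: "\<psi> \<in> borel_measurable borel" using \<psi>(1) by (rule borel_measurable_continuous_onI)
    have \<xi>M [measurable]: "\<xi> \<in> borel_measurable M" using F_measurable[OF \<xi>(1)] .
    let ?e = "\<lambda>n \<omega>. alive r T R N n \<omega>" and ?X = "\<lambda>n \<omega>. X (node r T N n) \<omega>" and ?Y = "\<lambda>n \<omega>. euler r T R N n \<omega>"
    let ?A = "\<lambda>n. {\<omega> \<in> space M. ?e n \<omega> = 1 \<and> \<bar>?Y n \<omega> - ?X n \<omega>\<bar> > \<eta>}"
    let ?P = "\<lambda>n. expectation (\<lambda>\<omega>. \<xi> \<omega> * (?e n \<omega> * \<psi> (?X n \<omega>)))"
    let ?D = "\<lambda>n. expectation (\<lambda>\<omega>. \<xi> \<omega> * v (?Y n \<omega>))"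
    obtain R\<psi> where R\<psi>: "\<And>y. \<bar>y\<bar> \<le> R \<Longrightarrow> \<bar>\<psi> y\<bar> \<le> R\<psi>"
      using continuous_bounded_on_interval[OF \<psi>(1)] by blast
    have aliveX: "\<bar>?X n \<omega>\<bar> \<le> R" if "?e n \<omega> = 1" for n \<omega>
      using that unfolding alive_eq_1_iff by simp
    have step: "?D (Suc n) \<le> ?D n - h * ?P n + h * (c * (\<epsilon> * (4 * K\<^sup>2 + 3)))" if n: "n < N" for n
    proof -
      let ?t = "node r T N n"
      have t: "0 \<le> ?t" using node_ge[OF facts, of n] r by simp
      have th: "node r T N (Suc n) = ?t + h" using node_Suc[OF facts] by (simp add: h_def)
      have mX: "X ?t \<in> borel_measurable (F ?t)" using X_adapted'[OF t] .
      have Yeq: "?Y (Suc n) \<omega> = ?Y n \<omega> + ((?e n \<omega> * b (?X n \<omega>)) * h + (?e n \<omega> * a (?X n \<omega>)) * (W (?t + h) \<omega> - W ?t \<omega>))" for \<omega>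
        unfolding th[symmetric] by (simp add: euler_def h_def algebra_simps)
      have "?D (Suc n) \<le> ?D n + h * expectation (\<lambda>\<omega>. \<xi> \<omega> * (v' (?Y n \<omega>) * (?e n \<omega> * b (?X n \<omega>)) + v'' (?Y n \<omega>) * (?e n \<omega> * a (?X n \<omega>))\<^sup>2 / 2))
        + c * (4 * \<epsilon> * K\<^sup>2 * h + (B * K\<^sup>2 + 32 * C * K ^ 4) * h\<^sup>2)"
        unfolding Yeq
      proof (rule euler_step[OF v _ C t h(1,2)])
        show "\<xi> \<in> borel_measurable (F ?t)" using F_mono[OF \<xi>(1) node_ge[OF facts]] .
        show "(\<lambda>\<omega>. ?e n \<omega> * b (?X n \<omega>)) \<in> borel_measurable (F ?t)" "(\<lambda>\<omega>. ?e n \<omega> * a (?X n \<omega>)) \<in> borel_measurable (F ?t)"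
          using alive_adapted[OF facts] measurable_compose[OF mX a_measurable] measurable_compose[OF mX b_measurable]
          by (auto intro!: borel_measurable_times)
        fix \<omega>
        show "\<bar>?e n \<omega> * b (?X n \<omega>)\<bar> \<le> K" "\<bar>?e n \<omega> * a (?X n \<omega>)\<bar> \<le> K"
          using alive_cases[of r T R N n \<omega>] aliveX[of n \<omega>] K by auto
      qed (use euler_adapted[OF facts] \<xi>(2) \<open>\<epsilon> > 0\<close> in auto)
      also have "expectation (\<lambda>\<omega>. \<xi> \<omega> * (v' (?Y n \<omega>) * (?e n \<omega> * b (?X n \<omega>)) + v'' (?Y n \<omega>) * (?e n \<omega> * a (?X n \<omega>))\<^sup>2 / 2))
        \<le> - ?P n + c * (\<epsilon> + L * prob (?A n))"
        by (rule euler_drift_bound[OF v \<psi>(1) \<xi>M \<xi>(2) K r rT N less_imp_le[OF \<open>\<epsilon> > 0\<close>] L Q])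
      also have "c * (\<epsilon> + L * prob (?A n)) \<le> c * (2 * \<epsilon>)"
      proof -
        have "L * prob (?A n) \<le> L * \<kappa>" using elim n L by (intro mult_left_mono) auto
        then show ?thesis using \<kappa>(2) c by (intro mult_left_mono) auto
      qed
      finally have "?D (Suc n) \<le> ?D n + h * (- ?P n + c * (2 * \<epsilon>)) + c * (4 * \<epsilon> * K\<^sup>2 * h + (B * K\<^sup>2 + 32 * C * K ^ 4) * h\<^sup>2)"
        using h(1) by (simp add: mult_left_mono)
      also have "c * (4 * \<epsilon> * K\<^sup>2 * h + (B * K\<^sup>2 + 32 * C * K ^ 4) * h\<^sup>2) = h * (c * (4 * \<epsilon> * K\<^sup>2 + C' * h))"
        by (simp add: C'_def power2_eq_square algebra_simps)
      also have "\<dots> \<le> h * (c * (4 * \<epsilon> * K\<^sup>2 + \<epsilon>))"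
        using h c by (intro mult_left_mono add_left_mono) auto
      finally show ?thesis by (simp add: algebra_simps)
    qed
    have sum: "?D n + (\<Sum>j<n. h * ?P j) \<le> ?D 0 + real n * (h * (c * (\<epsilon> * (4 * K\<^sup>2 + 3))))" if "n \<le> N" for n
      using that
    proof (induction n)
      case (Suc n)
      then show ?case using step[of n] by (simp add: algebra_simps)
    qed simp
    have "?D N \<ge> 0" using \<xi>(2) v0 by (intro integral_nonneg_AE AE_I2) auto
    moreover have "real N * h = T - r" using N by (simp add: h_def)
    ultimately show ?case
      using sum[of N] unfolding mult.assoc[symmetric] h_def[symmetric] by (simp add: euler_def)
  qed
qed

lemma occupation_bound_localized:
  assumes v: "test_function v v' v'' B" and v0: "\<And>y. 0 \<le> v y"
    and \<psi>: "continuous_on UNIV \<psi>" "\<And>y. 0 \<le> \<psi> y"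
    and gen: "\<And>y. \<bar>y\<bar> \<le> R \<Longrightarrow> v' y * b y + v'' y * (a y)\<^sup>2 / 2 \<le> - \<psi> y"
    and r: "0 \<le> r" and rT: "r < T"
    and \<xi>: "\<xi> \<in> borel_measurable (F r)" "\<And>\<omega>. \<omega> \<in> space M \<Longrightarrow> 0 \<le> \<xi> \<omega> \<and> \<xi> \<omega> \<le> c"
  shows "expectation (\<lambda>\<omega>. \<xi> \<omega> * (indicator (stays_in r T R) \<omega> * (LINT s:{r<..T}|lborel. \<psi> (X s \<omega>))))
    \<le> expectation (\<lambda>\<omega>. \<xi> \<omega> * v (X r \<omega>))"
proof -
  obtain Ka where Ka: "Ka \<ge> 0" "\<And>y. \<bar>y\<bar> \<le> R \<Longrightarrow> \<bar>a y\<bar> \<le> Ka"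
    using continuous_bounded_on_interval[OF a_cont, where R=R] by blast
  obtain Kb where Kb: "Kb \<ge> 0" "\<And>y. \<bar>y\<bar> \<le> R \<Longrightarrow> \<bar>b y\<bar> \<le> Kb"
    using continuous_bounded_on_interval[OF b_cont, where R=R] by blast
  obtain P where P: "P \<ge> 0" "\<And>y. \<bar>y\<bar> \<le> R \<Longrightarrow> \<bar>\<psi> y\<bar> \<le> P"
    using continuous_bounded_on_interval[OF \<psi>(1), where R=R] by blast
  define K where "K = max Ka Kb"
  have K: "K \<ge> 0" "\<And>y. \<bar>y\<bar> \<le> R \<Longrightarrow> \<bar>a y\<bar> \<le> K" "\<And>y. \<bar>y\<bar> \<le> R \<Longrightarrow> \<bar>b y\<bar> \<le> K"
    using Ka Kb by (force simp: K_def)+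
  obtain \<omega>0 where "\<omega>0 \<in> space M" using not_empty by blast
  then have c: "0 \<le> c" using \<xi>(2)[of \<omega>0] by linarith
  have [measurable]: "\<psi> \<in> borel_measurable borel" using \<psi>(1) by (rule borel_measurable_continuous_onI)
  have \<xi>M [measurable]: "\<xi> \<in> borel_measurable M" using F_measurable[OF \<xi>(1)] .
  let ?G = "stays_in r T R"
  let ?R = "\<lambda>N \<omega>. \<Sum>j<N. \<psi> (X (node r T N j) \<omega>) * ((T - r) / real N)"
  have R_le: "\<bar>\<xi> \<omega> * (indicator ?G \<omega> * ?R N \<omega>)\<bar> \<le> c * ((T - r) * P)" if \<omega>: "\<omega> \<in> space M" for N \<omega>
  proof (cases "\<omega> \<in> ?G \<and> N > 0")
    case True
    have "?R N \<omega> \<le> (\<Sum>j<N. P * ((T - r) / real N))"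
    proof (intro sum_mono mult_right_mono)
      fix j assume "j \<in> {..<N}"
      then have "\<bar>X (node r T N j) \<omega>\<bar> \<le> R" using True by (auto simp: stays_in_def)
      then show "\<psi> (X (node r T N j) \<omega>) \<le> P" using P(2) abs_le_D1 by blast
    qed (use rT in auto)
    also have "\<dots> = (T - r) * P" using True by simp
    finally have "?R N \<omega> \<le> (T - r) * P" .
    moreover have "0 \<le> ?R N \<omega>" using \<psi>(2) rT by (intro sum_nonneg mult_nonneg_nonneg) auto
    ultimately show ?thesis using \<xi>(2)[OF \<omega>] True c
      by (simp add: abs_mult mult_mono)
  next
    case False
    then show ?thesis using c P rT by auto
  qed
  have lim: "(\<lambda>N. expectation (\<lambda>\<omega>. \<xi> \<omega> * (indicator ?G \<omega> * ?R N \<omega>)))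
    \<longlonglongrightarrow> expectation (\<lambda>\<omega>. \<xi> \<omega> * (indicator ?G \<omega> * (LINT s:{r<..T}|lborel. \<psi> (X s \<omega>))))"
  proof (rule integral_dominated_convergence[where w="\<lambda>_. c * ((T - r) * P)"])
    show "(\<lambda>\<omega>. \<xi> \<omega> * (indicator ?G \<omega> * (LINT s:{r<..T}|lborel. \<psi> (X s \<omega>)))) \<in> borel_measurable M"
      unfolding set_lebesgue_integral_def
      supply [measurable (raw)] = X_comp_measurable by measurable
    show "AE \<omega> in M. (\<lambda>N. \<xi> \<omega> * (indicator ?G \<omega> * ?R N \<omega>)) \<longlonglongrightarrow> \<xi> \<omega> * (indicator ?G \<omega> * (LINT s:{r<..T}|lborel. \<psi> (X s \<omega>)))"
    proof (intro AE_I2 tendsto_mult tendsto_const)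
      fix \<omega> assume \<omega>: "\<omega> \<in> space M"
      show "(\<lambda>N. ?R N \<omega>) \<longlonglongrightarrow> (LINT s:{r<..T}|lborel. \<psi> (X s \<omega>))"
      proof (rule LIMSEQ_I)
        fix e :: real assume "e > 0"
        have "\<forall>\<^sub>F N in sequentially. path_osc r T \<psi> 1 N \<omega> < ennreal e"
          using path_osc_tendsto[OF \<psi>(1) \<omega> rT, of 1] \<open>e > 0\<close> by (intro order_tendstoD(2)) auto
        then have "\<forall>\<^sub>F N in sequentially. norm (?R N \<omega> - (LINT s:{r<..T}|lborel. \<psi> (X s \<omega>))) < e"
          using eventually_gt_at_top[of 0]
        proof eventually_elim
          case (elim N)
          then have "ennreal \<bar>?R N \<omega> - (LINT s:{r<..T}|lborel. \<psi> (X s \<omega>))\<bar> < ennreal e"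
            using riemann_sum_osc[OF \<psi>(1) \<omega> rT, of N N] by (simp add: node_def)
          then show ?case by (simp add: ennreal_less_iff)
        qed
        then show "\<exists>no. \<forall>N\<ge>no. norm (?R N \<omega> - (LINT s:{r<..T}|lborel. \<psi> (X s \<omega>))) < e"
          by (simp add: eventually_sequentially)
      qed
    qed
  qed (use R_le in auto)
  have main: "expectation (\<lambda>\<omega>. \<xi> \<omega> * (indicator ?G \<omega> * (LINT s:{r<..T}|lborel. \<psi> (X s \<omega>))))
    \<le> expectation (\<lambda>\<omega>. \<xi> \<omega> * v (X r \<omega>)) + (T - r) * (c * (\<epsilon> * (4 * K\<^sup>2 + 3)))" if "\<epsilon> > 0" for \<epsilon>
  proof (rule tendsto_upperbound[OF lim])
    have sum_le: "\<forall>\<^sub>F N in sequentially. (\<Sum>j<N. (T - r) / real N *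
        expectation (\<lambda>\<omega>. \<xi> \<omega> * (alive r T R N j \<omega> * \<psi> (X (node r T N j) \<omega>))))
      \<le> expectation (\<lambda>\<omega>. \<xi> \<omega> * v (X r \<omega>)) + (T - r) * (c * (\<epsilon> * (4 * K\<^sup>2 + 3)))"
      by (rule euler_sum_bound[OF v]) (use v0 \<psi> gen r rT \<xi> K that in auto)
    show "\<forall>\<^sub>F N in sequentially. expectation (\<lambda>\<omega>. \<xi> \<omega> * (indicator ?G \<omega> * ?R N \<omega>))
      \<le> expectation (\<lambda>\<omega>. \<xi> \<omega> * v (X r \<omega>)) + (T - r) * (c * (\<epsilon> * (4 * K\<^sup>2 + 3)))"
      using sum_le eventually_gt_at_top[of 0]
    proof eventually_elim
      case (elim N)
      then have N: "N > 0" by simp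
      note [measurable] = alive_measurable[OF r rT N]
      let ?g = "\<lambda>j \<omega>. \<xi> \<omega> * (alive r T R N j \<omega> * \<psi> (X (node r T N j) \<omega>))"
      have int: "integrable M (?g j)" for j
      proof (rule integrable_bounded[where C="c * P"])
        fix \<omega> assume \<omega>: "\<omega> \<in> space M"
        have "\<bar>alive r T R N j \<omega> * \<psi> (X (node r T N j) \<omega>)\<bar> \<le> P"
          using alive_cases[of r T R N j \<omega>] alive_eq_1_iff[of r T R N j \<omega>] P by auto
        then show "\<bar>?g j \<omega>\<bar> \<le> c * P"
          using \<xi>(2)[OF \<omega>] c by (auto simp: abs_mult intro!: mult_mono)
      qed measurable
      have "expectation (\<lambda>\<omega>. \<xi> \<omega> * (indicator ?G \<omega> * ?R N \<omega>)) \<le> expectation (\<lambda>\<omega>. \<Sum>j<N. (T - r) / real N * ?g j \<omega>)"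
      proof (rule integral_mono)
        show "integrable M (\<lambda>\<omega>. \<xi> \<omega> * (indicator ?G \<omega> * ?R N \<omega>))"
          by (rule integrable_bounded[OF _ R_le]) measurable
        show "integrable M (\<lambda>\<omega>. \<Sum>j<N. (T - r) / real N * ?g j \<omega>)"
          using int by (intro Bochner_Integration.integrable_sum integrable_mult_right) auto
        fix \<omega> assume \<omega>: "\<omega> \<in> space M"
        show "\<xi> \<omega> * (indicator ?G \<omega> * ?R N \<omega>) \<le> (\<Sum>j<N. (T - r) / real N * ?g j \<omega>)"
        proof (cases "\<omega> \<in> ?G")
          case True
          then have "alive r T R N j \<omega> = 1" if "j < N" for j using stays_in_alive that by simp
          then show ?thesis using True by (simp add: sum_distrib_left algebra_simps)
        next
          case False
          have g0: "0 \<le> ?g j \<omega>" for j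
            using \<xi>(2)[OF \<omega>] \<psi>(2) alive_cases[of r T R N j \<omega>] by auto
          then have "0 \<le> (\<Sum>j<N. (T - r) / real N * ?g j \<omega>)"
            using rT by (intro sum_nonneg mult_nonneg_nonneg[OF _ g0]) auto
          then show ?thesis using False by simp
        qed
      qed
      also have "\<dots> = (\<Sum>j<N. (T - r) / real N * expectation (?g j))"
        using int by simp
      finally show ?case using elim by linarith
    qed
  qed simp
  show ?thesis
  proof (rule field_le_epsilon)
    fix e :: real assume "e > 0"
    define D where "D = (T - r) * (c * (4 * K\<^sup>2 + 3)) + 1"
    have D: "D > 0" using c rT by (auto simp: D_def intro!: add_nonneg_pos mult_nonneg_nonneg)
    have "(T - r) * (c * (e / D * (4 * K\<^sup>2 + 3))) = e / D * (D - 1)" by (simp add: D_def)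
    also have "\<dots> \<le> e" using D \<open>e > 0\<close> by (simp add: field_simps)
    finally show "expectation (\<lambda>\<omega>. \<xi> \<omega> * (indicator ?G \<omega> * (LINT s:{r<..T}|lborel. \<psi> (X s \<omega>))))
      \<le> expectation (\<lambda>\<omega>. \<xi> \<omega> * v (X r \<omega>)) + e"
      using main[of "e / D"] \<open>e > 0\<close> D by simp
  qed
qed

end

section \<open>Cut-off functions\<close>

text \<open>The cube of the positive part, the lowest integer power of it that is twice continuously
  differentiable at 0. The absolute value spares case distinctions in the derivatives.\<close>

definition cube_pos :: "real \<Rightarrow> real" where "cube_pos y = (y ^ 3 + y * (y * \<bar>y\<bar>)) / 2"

lemma cube_pos_nonpos: "y \<le> 0 \<Longrightarrow> cube_pos y = 0"
  by (simp add: cube_pos_def power3_eq_cube)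

lemma cube_pos_nonneg: "0 \<le> y \<Longrightarrow> cube_pos y = y ^ 3"
  by (simp add: cube_pos_def power3_eq_cube)

lemma deriv_times_abs: "((\<lambda>y. y * \<bar>y\<bar>) has_real_derivative 2 * \<bar>y\<bar>) (at y)"
proof -
  consider "y > 0" | "y < 0" | "y = 0" by linarith
  then show ?thesis
  proof cases
    case 1
    have "((\<lambda>y. y * y) has_real_derivative 2 * \<bar>y\<bar>) (at y)"
      using 1 by (auto intro!: derivative_eq_intros)
    then show ?thesis
      by (rule has_field_derivative_transform_within_open[where S="{0<..}"]) (use 1 in auto)
  next
    case 2
    have "((\<lambda>y. - (y * y)) has_real_derivative 2 * \<bar>y\<bar>) (at y)"
      using 2 by (auto intro!: derivative_eq_intros)
    then show ?thesis
      by (rule has_field_derivative_transform_within_open[where S="{..<0}"]) (use 2 in auto)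
  next
    case 3
    have "(\<lambda>h. \<bar>h::real\<bar>) \<midarrow>0\<rightarrow> 0" using tendsto_rabs_zero_iff[of "\<lambda>h. h::real" "at 0"] by simp
    then have "(\<lambda>h. ((y + h) * \<bar>y + h\<bar> - y * \<bar>y\<bar>) / h) \<midarrow>0\<rightarrow> 0"
      by (rule Lim_transform_eventually) (auto simp: 3 eventually_at_filter)
    then show ?thesis by (simp add: 3 DERIV_def)
  qed
qed

lemma cube_pos_deriv: "(cube_pos has_real_derivative 3 * (y\<^sup>2 + y * \<bar>y\<bar>) / 2) (at y)"
proof -
  have "((\<lambda>y. y ^ 3 + y * (y * \<bar>y\<bar>)) has_real_derivative (real 3 * y ^ (3 - Suc 0) + (1 * (y * \<bar>y\<bar>) + (2 * \<bar>y\<bar>) * y))) (at y)"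
    by (intro DERIV_add DERIV_pow DERIV_mult DERIV_ident deriv_times_abs)
  from DERIV_cdivide[OF this, of 2] show ?thesis
    unfolding cube_pos_def[abs_def] by (rule DERIV_cong) (simp add: power2_eq_square)
qed

lemma cube_pos_deriv2: "((\<lambda>y. 3 * (y\<^sup>2 + y * \<bar>y\<bar>) / 2) has_real_derivative 3 * (y + \<bar>y\<bar>)) (at y)"
proof -
  have "((\<lambda>y. y\<^sup>2 + y * \<bar>y\<bar>) has_real_derivative (real 2 * y ^ (2 - Suc 0) + 2 * \<bar>y\<bar>)) (at y)"
    by (intro DERIV_add DERIV_pow deriv_times_abs)
  from DERIV_cdivide[OF DERIV_cmult[OF this, of 3], of 2] show ?thesis
    by (rule DERIV_cong) simp
qed

text \<open>The inner \<open>cube_pos\<close> leaves the level 1 at \<open>R\<close>, the outer one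
  reaches the level 0 at \<open>R + 1\<close>, both with two vanishing derivatives.\<close>

definition half_cutoff :: "real \<Rightarrow> real \<Rightarrow> real" where
  "half_cutoff R y = cube_pos (1 - cube_pos (y - R))"

lemma half_cutoff_C2:
  obtains p p' where "\<And>y. (half_cutoff R has_real_derivative p y) (at y)"
    "\<And>y. (p has_real_derivative p' y) (at y)" "continuous_on UNIV p'"
    "\<And>y. y \<le> R \<Longrightarrow> p y = 0 \<and> p' y = 0" "\<And>y. y \<ge> R + 1 \<Longrightarrow> p y = 0 \<and> p' y = 0"
proof -
  define c1 where "c1 y = 3 * (y\<^sup>2 + y * \<bar>y\<bar>) / 2" for y :: real
  define c2 where "c2 y = 3 * (y + \<bar>y\<bar>)" for y :: real
  define p where "p y = - (c1 (1 - cube_pos (y - R)) * c1 (y - R))" for y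
  define p' where "p' y = c2 (1 - cube_pos (y - R)) * c1 (y - R) * c1 (y - R) - c1 (1 - cube_pos (y - R)) * c2 (y - R)" for y
  have d0: "(cube_pos has_real_derivative c1 y) (at y)" and d1: "(c1 has_real_derivative c2 y) (at y)" for y
    using cube_pos_deriv cube_pos_deriv2 by (simp_all add: c1_def[abs_def] c2_def)
  have e: "((\<lambda>y. cube_pos (y - R)) has_real_derivative c1 (y - R)) (at y)" for y
    using DERIV_chain2[where g="\<lambda>y. y - R", OF d0[of "y - R"] DERIV_diff[OF DERIV_ident DERIV_const]] by simp
  have e': "((\<lambda>y. c1 (y - R)) has_real_derivative c2 (y - R)) (at y)" for y
    using DERIV_chain2[where g="\<lambda>y. y - R", OF d1[of "y - R"] DERIV_diff[OF DERIV_ident DERIV_const]] by simp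
  have f: "((\<lambda>y. 1 - cube_pos (y - R)) has_real_derivative - c1 (y - R)) (at y)" for y
    using DERIV_diff[OF DERIV_const e[of y], of 1] by simp
  have P: "(half_cutoff R has_real_derivative p y) (at y)" for y
    unfolding half_cutoff_def[abs_def]
    by (rule DERIV_cong[OF DERIV_chain2[where g="\<lambda>y. 1 - cube_pos (y - R)", OF d0 f[of y]]]) (simp add: p_def)
  have g: "((\<lambda>y. c1 (1 - cube_pos (y - R))) has_real_derivative c2 (1 - cube_pos (y - R)) * - c1 (y - R)) (at y)" for y
    using DERIV_chain2[where g="\<lambda>y. 1 - cube_pos (y - R)", OF d1 f[of y]] .
  have P': "(p has_real_derivative p' y) (at y)" for y
    unfolding p_def[abs_def]
    by (rule DERIV_cong[OF DERIV_minus[OF DERIV_mult[OF g[of y] e'[of y]]]]) (simp add: p'_def)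
  have c1: "continuous_on UNIV c1" "continuous_on UNIV cube_pos"
    using DERIV_isCont[OF d0] DERIV_isCont[OF d1] by (auto simp: continuous_on_eq_continuous_at)
  have c2: "continuous_on UNIV c2" unfolding c2_def[abs_def] by (intro continuous_intros)
  have l: "continuous_on UNIV (\<lambda>y::real. y - R)" by (intro continuous_intros)
  have s: "continuous_on UNIV (\<lambda>y. 1 - cube_pos (y - R))"
    by (intro continuous_on_diff continuous_on_const continuous_on_compose2[OF c1(2) l]) simp
  have cont: "continuous_on UNIV p'"
    unfolding p'_def[abs_def]
    by (intro continuous_on_diff continuous_on_mult continuous_on_compose2[OF c1(1) l]
        continuous_on_compose2[OF c2 l] continuous_on_compose2[OF c1(1) s] continuous_on_compose2[OF c2 s]) simp_all
  have z: "c1 y = 0" "c2 y = 0" if "y \<le> 0" for y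
    using that by (simp_all add: c1_def c2_def power2_eq_square)
  have z1: "p y = 0 \<and> p' y = 0" if "y \<le> R" for y
    using z[of "y - R"] that by (simp add: p_def p'_def)
  have z2: "p y = 0 \<and> p' y = 0" if "y \<ge> R + 1" for y
  proof -
    have "1 \<le> (y - R) ^ 3" using that by (intro one_le_power) simp
    then have "1 - cube_pos (y - R) \<le> 0" using that by (simp add: cube_pos_nonneg)
    then show ?thesis using z by (simp add: p_def p'_def)
  qed
  show ?thesis by (rule that[of p p', OF P P' cont z1 z2])
qed

lemma half_cutoff_values:
  "y \<le> R \<Longrightarrow> half_cutoff R y = 1" "y \<ge> R + 1 \<Longrightarrow> half_cutoff R y = 0"
  "0 \<le> half_cutoff R y" "half_cutoff R y \<le> 1"
proof -
  show "y \<le> R \<Longrightarrow> half_cutoff R y = 1"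
    by (simp add: half_cutoff_def cube_pos_nonpos cube_pos_nonneg)
  have nonneg: "0 \<le> cube_pos z" for z
    using cube_pos_nonpos[of z] cube_pos_nonneg[of z] by (cases "z \<le> 0") auto
  show "0 \<le> half_cutoff R y" unfolding half_cutoff_def by (rule nonneg)
  have le: "cube_pos z \<le> 1" if "z \<le> 1" for z
    using that cube_pos_nonpos[of z] cube_pos_nonneg[of z] power_le_one[of z 3] by (cases "z \<le> 0") auto
  show "half_cutoff R y \<le> 1" unfolding half_cutoff_def using nonneg[of "y - R"] by (intro le) simp
  assume "y \<ge> R + 1"
  then have "1 \<le> (y - R) ^ 3" by (intro one_le_power) simp
  then have "1 - cube_pos (y - R) \<le> 0" using \<open>y \<ge> R + 1\<close> by (simp add: cube_pos_nonneg)
  then show "half_cutoff R y = 0" by (simp add: half_cutoff_def cube_pos_nonpos)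
qed

lemma compact_support_bounded_unif:
  fixes f :: "real \<Rightarrow> real"
  assumes f: "continuous_on UNIV f" and z: "\<And>y. \<bar>y\<bar> \<ge> L \<Longrightarrow> f y = 0"
  shows "\<exists>B. \<forall>y. \<bar>f y\<bar> \<le> B" and "uniformly_continuous_on UNIV f"
proof -
  have c: "continuous_on {-L-1..L+1} f" using f by (rule continuous_on_subset) simp
  have "bounded (f ` {-L-1..L+1})"
    using c by (intro compact_imp_bounded compact_continuous_image compact_Icc)
  then obtain B where "B > 0" and B: "\<And>z. z \<in> f ` {-L-1..L+1} \<Longrightarrow> norm z \<le> B"
    unfolding bounded_pos by blast
  have "\<bar>f y\<bar> \<le> B" for y
  proof (cases "\<bar>y\<bar> \<ge> L")
    case True then show ?thesis using z \<open>B > 0\<close> by simp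
  next
    case False
    then have "y \<in> {-L-1..L+1}" by auto
    then show ?thesis using B[OF imageI] by simp
  qed
  then show "\<exists>B. \<forall>y. \<bar>f y\<bar> \<le> B" by blast
  have u: "uniformly_continuous_on {-L-1..L+1} f"
    using c by (intro compact_uniformly_continuous) auto
  show "uniformly_continuous_on UNIV f"
    unfolding uniformly_continuous_on_def
  proof (intro allI impI)
    fix e :: real assume "e > 0"
    then obtain d where d: "d > 0" "\<And>x x'. x \<in> {-L-1..L+1} \<Longrightarrow> x' \<in> {-L-1..L+1} \<Longrightarrow> dist x' x < d \<Longrightarrow> dist (f x') (f x) < e"
      using u unfolding uniformly_continuous_on_def by meson
    show "\<exists>d>0. \<forall>x\<in>UNIV. \<forall>x'\<in>UNIV. dist x' x < d \<longrightarrow> dist (f x') (f x) < e"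
    \<comment> \<open>Two points closer than 1 lie both in \<open>[-L-1,L+1]\<close>, unless
      \<open>f\<close> vanishes at both.\<close>
    proof (intro exI[of _ "min d 1"] conjI ballI impI)
      fix x x' :: real assume xx: "dist x' x < min d 1"
      show "dist (f x') (f x) < e"
      proof (cases "\<bar>x\<bar> \<ge> L \<and> \<bar>x'\<bar> \<ge> L")
        case True
        then show ?thesis using z \<open>e > 0\<close> by simp
      next
        case False
        then have "x \<in> {-L-1..L+1}" "x' \<in> {-L-1..L+1}"
          using xx by (auto simp: dist_real_def)
        then show ?thesis using d(2) xx by simp
      qed
    qed (use d in auto)
  qed
qed

text \<open>Green functions are twice continuously differentiable, but global bounds on their
  derivatives are not at hand. A cut-off factor equal to 1 on \<open>[-R,R]\<close> leaves both
  derivatives unchanged there, and \<open>0 \<le> u\<close> gives \<open>v \<le> u\<close>, the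
  direction used at the starting time.\<close>

lemma test_function_cutoff:
  fixes u u' u'' :: "real \<Rightarrow> real"
  assumes u: "\<And>y. (u has_real_derivative u' y) (at y)" "\<And>y. (u' has_real_derivative u'' y) (at y)"
    "continuous_on UNIV u''" "\<And>y. 0 \<le> u y" and "R \<ge> 0"
  obtains v v' v'' B where "test_function v v' v'' B" "\<And>y. 0 \<le> v y" "\<And>y. v y \<le> u y"
    "\<And>y. \<bar>y\<bar> \<le> R \<Longrightarrow> v' y = u' y \<and> v'' y = u'' y"
proof -
  obtain p p' where p: "\<And>y. (half_cutoff R has_real_derivative p y) (at y)"
    "\<And>y. (p has_real_derivative p' y) (at y)" "continuous_on UNIV p'"
    "\<And>y. y \<le> R \<Longrightarrow> p y = 0 \<and> p' y = 0" "\<And>y. y \<ge> R + 1 \<Longrightarrow> p y = 0 \<and> p' y = 0"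
    using half_cutoff_C2[of R] by blast
  have chain: "((\<lambda>y. f (- y)) has_real_derivative - f' (- y)) (at y)"
    if "\<And>y. (f has_real_derivative f' y) (at y)" for f f' :: "real \<Rightarrow> real" and y
    using DERIV_chain2[where g=uminus, OF that[of "- y"] DERIV_minus[OF DERIV_ident]] by simp
  define \<gamma> where "\<gamma> y = half_cutoff R y * half_cutoff R (- y)" for y
  define \<gamma>' where "\<gamma>' y = p y * half_cutoff R (- y) + - p (- y) * half_cutoff R y" for y
  define \<gamma>'' where "\<gamma>'' y = (p' y * half_cutoff R (- y) + - p (- y) * p y) + (p' (- y) * half_cutoff R y + p y * - p (- y))" for y
  have d\<gamma>: "(\<gamma> has_real_derivative \<gamma>' y) (at y)" for y
    unfolding \<gamma>_def[abs_def] \<gamma>'_def by (rule DERIV_mult[OF p(1) chain[OF p(1)]])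
  have d\<gamma>': "(\<gamma>' has_real_derivative \<gamma>'' y) (at y)" for y
    unfolding \<gamma>'_def[abs_def] \<gamma>''_def
    using DERIV_add[OF DERIV_mult[OF p(2) chain[OF p(1)]] DERIV_mult[OF DERIV_minus[OF chain[OF p(2)]] p(1)], of y]
    by simp
  have cont: "continuous_on UNIV (half_cutoff R)" "continuous_on UNIV p"
    using DERIV_isCont[OF p(1)] DERIV_isCont[OF p(2)] by (auto simp: continuous_on_eq_continuous_at)
  have c\<gamma>'': "continuous_on UNIV \<gamma>''"
    unfolding \<gamma>''_def[abs_def]
    by (intro continuous_intros cont p(3) continuous_on_compose2[OF cont(1)] continuous_on_compose2[OF cont(2)] continuous_on_compose2[OF p(3)]) auto
  have \<gamma>1: "\<gamma> y = 1" "\<gamma>' y = 0" "\<gamma>'' y = 0" if "\<bar>y\<bar> \<le> R" for y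
    using that p(4)[of y] p(4)[of "- y"] half_cutoff_values(1)[of y R] half_cutoff_values(1)[of "-y" R]
    by (simp_all add: \<gamma>_def \<gamma>'_def \<gamma>''_def abs_le_iff)
  have \<gamma>0: "\<gamma> y = 0" "\<gamma>' y = 0" "\<gamma>'' y = 0" if "\<bar>y\<bar> \<ge> R + 1" for y
  proof -
    have "y \<ge> R + 1 \<or> - y \<ge> R + 1" using that by linarith
    then show "\<gamma> y = 0" "\<gamma>' y = 0" "\<gamma>'' y = 0"
      using p(5)[of y] p(5)[of "- y"] half_cutoff_values(2)[of R y] half_cutoff_values(2)[of R "-y"]
      by (auto simp: \<gamma>_def \<gamma>'_def \<gamma>''_def)
  qed
  define v where "v y = \<gamma> y * u y" for y
  define v' where "v' y = \<gamma>' y * u y + u' y * \<gamma> y" for y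
  define v'' where "v'' y = (\<gamma>'' y * u y + u' y * \<gamma>' y) + (u'' y * \<gamma> y + \<gamma>' y * u' y)" for y
  have dv: "(v has_real_derivative v' y) (at y)" for y
    unfolding v_def[abs_def] v'_def by (rule DERIV_mult[OF d\<gamma> u(1)])
  have dv': "(v' has_real_derivative v'' y) (at y)" for y
    unfolding v'_def[abs_def] v''_def by (rule DERIV_add[OF DERIV_mult[OF d\<gamma>' u(1)] DERIV_mult[OF u(2) d\<gamma>]])
  have cv: "continuous_on UNIV v" "continuous_on UNIV v'"
    using DERIV_isCont[OF dv] DERIV_isCont[OF dv'] by (auto simp: continuous_on_eq_continuous_at)
  have cu: "continuous_on UNIV u" "continuous_on UNIV u'" "continuous_on UNIV \<gamma>" "continuous_on UNIV \<gamma>'"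
    using DERIV_isCont[OF u(1)] DERIV_isCont[OF u(2)] DERIV_isCont[OF d\<gamma>] DERIV_isCont[OF d\<gamma>']
    by (auto simp: continuous_on_eq_continuous_at)
  have cv'': "continuous_on UNIV v''"
    unfolding v''_def[abs_def] by (intro continuous_intros cu c\<gamma>'' u(3))
  have z: "v y = 0" "v' y = 0" "v'' y = 0" if "\<bar>y\<bar> \<ge> R + 1" for y
    using \<gamma>0[OF that] by (simp_all add: v_def v'_def v''_def)
  obtain B0 where B0: "\<And>y. \<bar>v y\<bar> \<le> B0" using compact_support_bounded_unif(1)[OF cv(1) z(1)] by blast
  obtain B1 where B1: "\<And>y. \<bar>v' y\<bar> \<le> B1" using compact_support_bounded_unif(1)[OF cv(2) z(2)] by blast
  obtain B2 where B2: "\<And>y. \<bar>v'' y\<bar> \<le> B2" using compact_support_bounded_unif(1)[OF cv'' z(3)] by blast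
  have "test_function v v' v'' (max B0 (max B1 B2))"
  proof
    show "uniformly_continuous_on UNIV v''" by (rule compact_support_bounded_unif(2)[OF cv'' z(3)])
    show "\<bar>v y\<bar> \<le> max B0 (max B1 B2)" for y using B0[of y] by linarith
    show "\<bar>v' y\<bar> \<le> max B0 (max B1 B2)" for y using B1[of y] by linarith
    show "\<bar>v'' y\<bar> \<le> max B0 (max B1 B2)" for y using B2[of y] by linarith
  qed (rule dv dv')+
  moreover have \<gamma>b: "0 \<le> \<gamma> y" "\<gamma> y \<le> 1" for y
    unfolding \<gamma>_def using half_cutoff_values(3,4) by (auto intro!: mult_le_one)
  then have "0 \<le> v y" "v y \<le> u y" for y
    using u(4)[of y] mult_right_mono[OF \<gamma>b(2)[of y] u(4)[of y]] by (simp_all add: v_def)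
  moreover have "v' y = u' y \<and> v'' y = u'' y" if "\<bar>y\<bar> \<le> R" for y
    using \<gamma>1[OF that] by (simp add: v'_def v''_def)
  ultimately show ?thesis using that by blast
qed

section \<open>Scale function and Green operator\<close>

lemma LBINT_FTC:
  fixes f G :: "real \<Rightarrow> real"
  assumes "\<And>y. (G has_real_derivative f y) (at y)" "continuous_on UNIV f"
  shows "(LBINT u=ereal c..ereal x. f u) = G x - G c"
proof (rule interval_integral_FTC_finite)
  show "continuous_on {min c x..max c x} f" using assms(2) by (rule continuous_on_subset) simp
  show "(G has_vector_derivative f y) (at y within {min c x..max c x})" for y
    using assms(1)[of y] has_real_derivative_iff_has_vector_derivative has_vector_derivative_at_within by blast
qed

lemma LBINT_deriv:
  fixes f :: "real \<Rightarrow> real"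
  assumes "continuous_on UNIV f"
  shows "((\<lambda>x. LBINT u=ereal c..ereal x. f u) has_real_derivative f x) (at x)"
proof -
  let ?A = "min c x - 1" and ?B = "max c x + 1"
  have "((\<lambda>x. LBINT u=ereal c..ereal x. f u) has_vector_derivative f x) (at x within {?A..?B})"
    by (rule interval_integral_FTC2) (use assms continuous_on_subset in auto)
  moreover have "at x within {?A..?B} = at x" by (rule at_within_Icc_at) auto
  ultimately show ?thesis by (simp add: has_real_derivative_iff_has_vector_derivative)
qed

lemma LBINT_nonneg:
  fixes f :: "real \<Rightarrow> real"
  assumes "c \<le> x" "\<And>y. 0 \<le> f y"
  shows "0 \<le> (LBINT u=ereal c..ereal x. f u)"
  using assms by (simp add: interval_integral_Icc set_lebesgue_integral_def)

locale transient_coefficients =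
  fixes a b :: "real \<Rightarrow> real"
  assumes a_cont: "continuous_on UNIV a" and b_cont: "continuous_on UNIV b"
    and a_nz: "\<And>y. a y \<noteq> 0"
    and scale_top: "scale_fun_top a b 0 < \<infinity>"
begin

definition dens :: "real \<Rightarrow> real" where "dens = scale_density a b 0"

text \<open>The \<open>s\<close> of the overview. By \<open>scale_fun_top_tail\<close>,
  \<open>\<Phi>(u,\<infinity>)\<close> is \<open>tail u / dens u\<close>.\<close>

definition tail :: "real \<Rightarrow> real" where
  "tail y = real_of_ereal (scale_fun_top a b 0) - scale_fun a b 0 y"

lemma drift_cont: "continuous_on UNIV (\<lambda>u. b u / (a u)\<^sup>2)"
  using a_cont b_cont a_nz by (intro continuous_intros) auto

lemma dens_pos: "0 < dens y"
  by (simp add: dens_def scale_density_def)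

lemma dens_deriv: "(dens has_real_derivative - 2 * (b y / (a y)\<^sup>2) * dens y) (at y)"
proof -
  have "((\<lambda>x. - 2 * (LBINT u=ereal 0..ereal x. b u / (a u)\<^sup>2)) has_real_derivative - 2 * (b y / (a y)\<^sup>2)) (at y)"
    by (rule DERIV_cmult[OF LBINT_deriv[OF drift_cont]])
  from DERIV_fun_exp[OF this] show ?thesis
    unfolding dens_def scale_density_def[abs_def] by (simp add: mult.commute)
qed

lemma dens_cont: "continuous_on UNIV dens"
  using DERIV_isCont[OF dens_deriv] by (simp add: continuous_on_eq_continuous_at)

text \<open>The integrals in the exponent add up, so a change of the base point is division by
  \<open>dens u\<close>; this reduces later formulas to the base point 0.\<close>

lemma scale_density_eq: "scale_density a b u x = dens x / dens u"
proof -
  let ?G = "\<lambda>x. LBINT u=ereal 0..ereal x. b u / (a u)\<^sup>2"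
  have "(LBINT u=ereal u..ereal x. b u / (a u)\<^sup>2) = ?G x - ?G u"
    by (rule LBINT_FTC[OF LBINT_deriv[OF drift_cont] drift_cont])
  then show ?thesis
    by (simp add: dens_def scale_density_def exp_diff[symmetric] algebra_simps)
qed

lemma scale_fun_deriv: "(scale_fun a b 0 has_real_derivative dens y) (at y)"
  using LBINT_deriv[OF dens_cont, of 0 y] unfolding scale_fun_def[abs_def] dens_def by simp

lemma scale_fun_eq: "scale_fun a b u x = (scale_fun a b 0 x - scale_fun a b 0 u) / dens u"
proof -
  have "(LBINT z=ereal u..ereal x. dens z / dens u) = scale_fun a b 0 x / dens u - scale_fun a b 0 u / dens u"
    by (rule LBINT_FTC) (use dens_cont dens_pos scale_fun_deriv in \<open>auto intro!: DERIV_cdivide continuous_intros simp: less_imp_neq[symmetric]\<close>)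
  then show ?thesis by (simp add: scale_fun_def scale_density_eq diff_divide_distrib)
qed

lemma scale_fun_strict_mono: "y < z \<Longrightarrow> scale_fun a b 0 y < scale_fun a b 0 z"
  using DERIV_pos_imp_increasing[of y z "scale_fun a b 0"] scale_fun_deriv dens_pos by blast

text \<open>\<open>Lim\<close> is a definite description, usable only once a limit is exhibited; by
  monotonicity the supremum is one.\<close>

lemma scale_fun_top_eq: "scale_fun_top a b 0 = (SUP y. ereal (scale_fun a b 0 y))"
  unfolding scale_fun_top_def
proof (rule tendsto_Lim)
  let ?S = "\<lambda>y. ereal (scale_fun a b 0 y)"
  show "(?S \<longlongrightarrow> (SUP y. ?S y)) at_top"
  proof (rule order_tendstoI)
    fix l assume "l < (SUP y. ?S y)"
    then obtain y where y: "l < ?S y" by (auto simp: less_SUP_iff)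
    have "l < ?S z" if "z \<ge> y" for z
    proof -
      have "?S y \<le> ?S z" using scale_fun_strict_mono[of y z] that by (cases "y = z") auto
      then show ?thesis using y by (rule less_le_trans[rotated])
    qed
    then show "\<forall>\<^sub>F z in at_top. l < ?S z" unfolding eventually_at_top_linorder by blast
  next
    fix l assume "l > (SUP y. ?S y)"
    then have "?S z < l" for z by (meson SUP_upper UNIV_I le_less_trans)
    then show "\<forall>\<^sub>F z in at_top. ?S z < l" by simp
  qed
qed simp

lemma scale_fun_top_finite: "scale_fun_top a b 0 = ereal (real_of_ereal (scale_fun_top a b 0))"
proof -
  have "ereal (scale_fun a b 0 0) \<le> scale_fun_top a b 0"
    unfolding scale_fun_top_eq by (rule SUP_upper) simp
  then have "\<bar>scale_fun_top a b 0\<bar> \<noteq> \<infinity>" using scale_top by auto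
  then show ?thesis by (simp add: ereal_real)
qed

lemma scale_fun_tendsto: "(scale_fun a b 0 \<longlongrightarrow> real_of_ereal (scale_fun_top a b 0)) at_top"
proof (rule order_tendstoI)
  let ?L = "real_of_ereal (scale_fun_top a b 0)"
  have S: "(SUP y. ereal (scale_fun a b 0 y)) = ereal ?L"
    using scale_fun_top_finite unfolding scale_fun_top_eq .
  fix l assume "l < ?L"
  then have "ereal l < (SUP y. ereal (scale_fun a b 0 y))" unfolding S by simp
  then obtain y where y: "l < scale_fun a b 0 y" by (auto simp: less_SUP_iff)
  have "l < scale_fun a b 0 z" if "z \<ge> y" for z
    using scale_fun_strict_mono[of y z] that y by (cases "y = z") auto
  then show "\<forall>\<^sub>F z in at_top. l < scale_fun a b 0 z" unfolding eventually_at_top_linorder by blast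
next
  let ?L = "real_of_ereal (scale_fun_top a b 0)"
  have S: "(SUP y. ereal (scale_fun a b 0 y)) = ereal ?L"
    using scale_fun_top_finite unfolding scale_fun_top_eq .
  fix l assume "?L < l"
  have "scale_fun a b 0 z < l" for z
  proof -
    have "ereal (scale_fun a b 0 z) \<le> ereal ?L" unfolding S[symmetric] by (rule SUP_upper) simp
    then show ?thesis using \<open>?L < l\<close> by simp
  qed
  then show "\<forall>\<^sub>F z in at_top. scale_fun a b 0 z < l" by simp
qed

lemma tail_pos: "0 < tail y"
proof -
  let ?L = "real_of_ereal (scale_fun_top a b 0)"
  have S: "(SUP y. ereal (scale_fun a b 0 y)) = ereal ?L"
    using scale_fun_top_finite unfolding scale_fun_top_eq .
  have "ereal (scale_fun a b 0 (y + 1)) \<le> ereal ?L" unfolding S[symmetric] by (rule SUP_upper) simp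
  then show ?thesis using scale_fun_strict_mono[of y "y + 1"] by (simp add: tail_def)
qed

lemma tail_antimono: "y \<le> z \<Longrightarrow> tail z \<le> tail y"
  using scale_fun_strict_mono[of y z] by (cases "y = z") (auto simp: tail_def)

lemma tail_deriv: "(tail has_real_derivative - dens y) (at y)"
  unfolding tail_def[abs_def] using DERIV_diff[OF DERIV_const scale_fun_deriv] by simp

lemma tail_cont: "continuous_on UNIV tail"
  using DERIV_isCont[OF tail_deriv] by (simp add: continuous_on_eq_continuous_at)

lemma scale_fun_top_tail: "scale_fun_top a b u = ereal (tail u / dens u)"
  unfolding scale_fun_top_def
proof (rule tendsto_Lim)
  have eq: "scale_fun a b u = (\<lambda>x. (scale_fun a b 0 x - scale_fun a b 0 u) / dens u)"
    by (rule ext) (rule scale_fun_eq)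
  have "((\<lambda>x. (scale_fun a b 0 x - scale_fun a b 0 u) / dens u) \<longlongrightarrow> tail u / dens u) at_top"
    unfolding tail_def using dens_pos[of u] by (intro tendsto_intros scale_fun_tendsto) simp
  then show "((\<lambda>x. ereal (scale_fun a b u x)) \<longlongrightarrow> ereal (tail u / dens u)) at_top"
    unfolding eq by (rule tendsto_ereal)
qed simp

text \<open>The density of the speed measure, normalised so that
  \<open>min (tail y) (tail z) * speed z\<close> is the Green kernel.\<close>

definition speed :: "real \<Rightarrow> real" where "speed y = 2 / (dens y * (a y)\<^sup>2)"

lemma speed_pos: "0 < speed y"
  using dens_pos[of y] a_nz[of y] by (simp add: speed_def)

lemma speed_cont: "continuous_on UNIV speed"
proof -
  have "dens y * (a y)\<^sup>2 \<noteq> 0" for y using dens_pos[of y] a_nz[of y] by simp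
  then show ?thesis unfolding speed_def[abs_def] using dens_cont a_cont by (intro continuous_intros) auto
qed

text \<open>The Green kernel integrated against \<open>\<psi>\<close>, split at the diagonal, for
  \<open>\<psi>\<close> vanishing outside \<open>[-n,n]\<close>. Oriented interval integrals keep
  the formula correct, and differentiable, for \<open>y\<close> outside
  \<open>[-n,n]\<close>.\<close>

definition green :: "real \<Rightarrow> (real \<Rightarrow> real) \<Rightarrow> real \<Rightarrow> real" where
  "green n \<psi> y = tail y * (LBINT z=ereal (-n)..ereal y. \<psi> z * speed z)
    + (LBINT z=ereal y..ereal n. tail z * (\<psi> z * speed z))"

context
  fixes \<psi> :: "real \<Rightarrow> real" and n :: real
  assumes \<psi>: "continuous_on UNIV \<psi>" "\<And>y. 0 \<le> \<psi> y" "\<And>y. \<bar>y\<bar> \<ge> n \<Longrightarrow> \<psi> y = 0" and n: "0 \<le> n"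
begin

lemma weight_cont: "continuous_on UNIV (\<lambda>z. \<psi> z * speed z)" "continuous_on UNIV (\<lambda>z. tail z * (\<psi> z * speed z))"
  by (intro continuous_on_mult \<psi>(1) speed_cont tail_cont)+

lemma weight_nonneg: "0 \<le> \<psi> z * speed z" "0 \<le> tail z * (\<psi> z * speed z)"
  using \<psi>(2)[of z] speed_pos[of z] tail_pos[of z] by (auto intro!: mult_nonneg_nonneg less_imp_le)

text \<open>For \<open>y\<close> outside \<open>[-n,n]\<close> one of the two integrals has reversed
  orientation, but \<open>\<psi>\<close> vanishes on its range.\<close>

lemma green_nonneg: "0 \<le> green n \<psi> y"
proof -
  consider "y < - n" | "- n \<le> y" "y \<le> n" | "n < y" by linarith
  then show ?thesis
  proof cases
    case 1
    have "(LBINT z=ereal (-n)..ereal y. \<psi> z * speed z) = (LBINT z=ereal (-n)..ereal y. 0)"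
      by (rule interval_integral_cong) (use 1 \<psi>(3) in \<open>auto simp: einterval_iff min_def max_def\<close>)
    moreover have "0 \<le> (LBINT z=ereal y..ereal n. tail z * (\<psi> z * speed z))"
      by (rule LBINT_nonneg) (use 1 n weight_nonneg in auto)
    ultimately show ?thesis by (simp add: green_def)
  next
    case 2
    then show ?thesis
      unfolding green_def by (intro add_nonneg_nonneg mult_nonneg_nonneg LBINT_nonneg less_imp_le[OF tail_pos] weight_nonneg)
  next
    case 3
    have "(LBINT z=ereal y..ereal n. tail z * (\<psi> z * speed z)) = (LBINT z=ereal y..ereal n. 0)"
      by (rule interval_integral_cong) (use 3 \<psi>(3) in \<open>auto simp: einterval_iff min_def max_def\<close>)
    moreover have "0 \<le> (LBINT z=ereal (-n)..ereal y. \<psi> z * speed z)"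
      by (rule LBINT_nonneg) (use 3 n weight_nonneg in auto)
    ultimately show ?thesis using tail_pos[of y] by (simp add: green_def less_imp_le)
  qed
qed

text \<open>The kernel is continuous across the diagonal, so the contributions of the moving split
  point cancel and the derivative is \<open>- (dens y * N y)\<close>. In the second derivative the
  term from \<open>dens_deriv\<close> cancels the drift, and \<open>speed\<close> is normalised to
  leave exactly \<open>- \<psi> y\<close>.\<close>

lemma green_C2:
  obtains u' u'' where "\<And>y. (green n \<psi> has_real_derivative u' y) (at y)"
    "\<And>y. (u' has_real_derivative u'' y) (at y)" "continuous_on UNIV u''"
    "\<And>y. u' y * b y + u'' y * (a y)\<^sup>2 / 2 = - \<psi> y"
proof -
  define N where "N y = (LBINT z=ereal (-n)..ereal y. \<psi> z * speed z)" for y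
  define P where "P y = (LBINT z=ereal 0..ereal y. tail z * (\<psi> z * speed z))" for y
  have dN: "(N has_real_derivative \<psi> y * speed y) (at y)" for y
    unfolding N_def[abs_def] by (rule LBINT_deriv[OF weight_cont(1)])
  have dP: "(P has_real_derivative tail y * (\<psi> y * speed y)) (at y)" for y
    unfolding P_def[abs_def] by (rule LBINT_deriv[OF weight_cont(2)])
  have eq: "green n \<psi> = (\<lambda>y. tail y * N y + (P n - P y))"
    using LBINT_FTC[OF dP weight_cont(2)] by (auto simp: green_def N_def)
  define u' where "u' y = - (dens y * N y)" for y
  define u'' where "u'' y = - (- 2 * (b y / (a y)\<^sup>2) * dens y * N y + \<psi> y * speed y * dens y)" for y
  have d1: "(green n \<psi> has_real_derivative u' y) (at y)" for y
    unfolding eq u'_def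
    by (rule DERIV_cong[OF DERIV_add[OF DERIV_mult[OF tail_deriv dN] DERIV_diff[OF DERIV_const dP]]]) (simp add: algebra_simps)
  have d2: "(u' has_real_derivative u'' y) (at y)" for y
    unfolding u'_def[abs_def] u''_def by (rule DERIV_minus[OF DERIV_mult[OF dens_deriv dN]])
  have cN: "continuous_on UNIV N"
    using DERIV_isCont[OF dN] by (simp add: continuous_on_eq_continuous_at)
  have c: "continuous_on UNIV u''"
    unfolding u''_def[abs_def]
    by (intro continuous_on_minus continuous_on_add continuous_on_mult continuous_on_const drift_cont dens_cont cN \<psi>(1) speed_cont)
  have "u' y * b y + u'' y * (a y)\<^sup>2 / 2 = - \<psi> y" for y
    using dens_pos[of y] a_nz[of y] by (simp add: u'_def u''_def speed_def field_simps)
  then show ?thesis using that[of u' u''] d1 d2 c by blast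
qed

lemma green_cont: "continuous_on UNIV (green n \<psi>)"
proof -
  obtain u' where "\<And>y. (green n \<psi> has_real_derivative u' y) (at y)" using green_C2 by metis
  from DERIV_isCont[OF this] show ?thesis by (simp add: continuous_on_eq_continuous_at)
qed

text \<open>For \<open>\<bar>y\<bar> \<le> n\<close> both integrals have the usual orientation and
  join to one over \<open>[-n,n]\<close>; monotonicity of \<open>tail\<close> decides the minimum on
  either side of \<open>y\<close>.\<close>

lemma green_nn_integral:
  assumes y: "\<bar>y\<bar> \<le> n"
  shows "ennreal (green n \<psi> y) = (\<integral>\<^sup>+ z. ennreal (min (tail y) (tail z) * speed z) * ennreal (\<psi> z) \<partial>lborel)"
proof -
  define H where "H z = min (tail y) (tail z) * (\<psi> z * speed z)" for z
  have H_cont: "continuous_on UNIV H"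
    unfolding H_def[abs_def] by (intro continuous_on_mult weight_cont(1) continuous_on_min continuous_on_const tail_cont)
  have H0: "0 \<le> H z" for z
    unfolding H_def using tail_pos[of y] tail_pos[of z]
    by (intro mult_nonneg_nonneg[OF _ weight_nonneg(1)]) auto
  let ?I = "\<lambda>y. LBINT z=ereal 0..ereal y. H z"
  have I: "(LBINT z=ereal c..ereal x. H z) = ?I x - ?I c" for c x
    by (rule LBINT_FTC[OF LBINT_deriv[OF H_cont] H_cont])
  have minl: "min (tail y) (tail z) = tail y" if "z < y" for z
    using tail_antimono[of z y] that by simp
  have minr: "min (tail y) (tail z) = tail z" if "y < z" for z
    using tail_antimono[of y z] that by simp
  have 1: "(LBINT z=ereal (-n)..ereal y. H z) = tail y * (LBINT z=ereal (-n)..ereal y. \<psi> z * speed z)"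
  proof -
    have "(LBINT z=ereal (-n)..ereal y. H z) = (LBINT z=ereal (-n)..ereal y. tail y * (\<psi> z * speed z))"
    proof (rule interval_integral_cong)
      fix z assume z: "z \<in> einterval (min (ereal (-n)) (ereal y)) (max (ereal (-n)) (ereal y))"
      have "max (ereal (-n)) (ereal y) = ereal y" using y by (intro max_absorb2) auto
      with z have "z < y" by (auto simp: einterval_def)
      then show "H z = tail y * (\<psi> z * speed z)" unfolding H_def by (simp only: minl)
    qed
    then show ?thesis by simp
  qed
  have 2: "(LBINT z=ereal y..ereal n. H z) = (LBINT z=ereal y..ereal n. tail z * (\<psi> z * speed z))"
  proof (rule interval_integral_cong)
    fix z assume z: "z \<in> einterval (min (ereal y) (ereal n)) (max (ereal y) (ereal n))"
    have "min (ereal y) (ereal n) = ereal y" using y by (intro min_absorb1) auto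
    with z have "y < z" by (auto simp: einterval_def)
    then show "H z = tail z * (\<psi> z * speed z)" unfolding H_def by (simp only: minr)
  qed
  have "green n \<psi> y = (LBINT z=ereal (-n)..ereal n. H z)"
    unfolding green_def 1[symmetric] 2[symmetric] using I[of "-n" y] I[of y n] I[of "-n" n] by linarith
  also have "\<dots> = (LINT z:{-n..n}|lborel. H z)" using n by (simp add: interval_integral_Icc)
  also have "ennreal \<dots> = (\<integral>\<^sup>+ z. ennreal (indicator {-n..n} z *\<^sub>R H z) \<partial>lborel)"
    unfolding set_lebesgue_integral_def
  proof (rule nn_integral_eq_integral[symmetric])
    have "continuous_on {-n..n} H" using H_cont by (rule continuous_on_subset) simp
    then show "integrable lborel (\<lambda>z. indicator {-n..n} z *\<^sub>R H z)"
      using borel_integrable_atLeastAtMost'[of "-n" n H] by (simp add: set_integrable_def)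
  qed (use H0 in auto)
  also have "\<dots> = (\<integral>\<^sup>+ z. ennreal (min (tail y) (tail z) * speed z) * ennreal (\<psi> z) \<partial>lborel)"
  proof (rule nn_integral_cong)
    fix z
    have "indicator {-n..n} z *\<^sub>R H z = (min (tail y) (tail z) * speed z) * \<psi> z"
    proof (cases "\<bar>z\<bar> \<le> n")
      case True
      then have "z \<in> {-n..n}" by auto
      then show ?thesis by (simp add: H_def)
    next
      case False
      then show ?thesis using \<psi>(3)[of z] by (simp add: H_def)
    qed
    then show "ennreal (indicator {-n..n} z *\<^sub>R H z) = ennreal (min (tail y) (tail z) * speed z) * ennreal (\<psi> z)"
      using \<psi>(2)[of z] by (simp add: ennreal_mult'')
  qed
  finally show ?thesis .
qed

end

end

section \<open>Moments of additive functionals\<close>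

lemma LBINT_nn_integral:
  fixes f :: "real \<Rightarrow> real"
  assumes f: "continuous_on UNIV f" "\<And>q. q \<le> T \<Longrightarrow> 0 \<le> f q" and "s \<le> T"
  shows "ennreal (LBINT q=ereal s..ereal T. f q) = (\<integral>\<^sup>+ q \<in> {s<..T}. ennreal (f q) \<partial>lborel)"
proof -
  have "(LBINT q=ereal s..ereal T. f q) = (LINT q:{s<..T}|lborel. f q)"
    using \<open>s \<le> T\<close> by (simp add: interval_integral_Ioc)
  also have "ennreal \<dots> = (\<integral>\<^sup>+ q. ennreal (indicator {s<..T} q *\<^sub>R f q) \<partial>lborel)"
    unfolding set_lebesgue_integral_def
  proof (rule nn_integral_eq_integral[symmetric])
    have "continuous_on {s..T} f" using f(1) by (rule continuous_on_subset) simp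
    then have "set_integrable lborel {s..T} f" by (rule borel_integrable_atLeastAtMost')
    then have "set_integrable lborel {s<..T} f" by (rule set_integrable_subset) auto
    then show "integrable lborel (\<lambda>q. indicator {s<..T} q *\<^sub>R f q)" by (simp add: set_integrable_def)
    show "AE q in lborel. 0 \<le> indicator {s<..T} q *\<^sub>R f q" using f(2) by (intro AE_I2) (simp add: indicator_def)
  qed
  also have "\<dots> = (\<integral>\<^sup>+ q \<in> {s<..T}. ennreal (f q) \<partial>lborel)"
    by (intro nn_integral_cong) (simp add: indicator_def)
  finally show ?thesis .
qed

locale transient_diffusion = diffusion_path M F W a b x X + transient_coefficients a b
  for M :: "'a measure" and F :: "real \<Rightarrow> 'a measure" and W :: "real \<Rightarrow> 'a \<Rightarrow> real"
    and a b :: "real \<Rightarrow> real" and x :: real and X :: "real \<Rightarrow> 'a \<Rightarrow> real" +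
  assumes X_start: "AE \<omega> in M. X 0 \<omega> = x"
begin

lemma nn_integral_path_eq:
  assumes "continuous_on UNIV \<psi>" "\<And>y. 0 \<le> \<psi> y" "\<omega> \<in> space M"
  shows "(\<integral>\<^sup>+ s \<in> {r<..T}. ennreal (\<psi> (X s \<omega>)) \<partial>lborel) = ennreal (LINT s:{r<..T}|lborel. \<psi> (X s \<omega>))"
proof -
  have "set_integrable lborel {r<..T} (\<lambda>s. \<psi> (X s \<omega>))"
    by (rule set_integrable_subset[OF path_drift_integrable[OF assms(1,3), of r T]]) auto
  then have "(\<integral>\<^sup>+ s. ennreal (indicator {r<..T} s *\<^sub>R \<psi> (X s \<omega>)) \<partial>lborel) = ennreal (LINT s:{r<..T}|lborel. \<psi> (X s \<omega>))"
    unfolding set_lebesgue_integral_def set_integrable_def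
    by (rule nn_integral_eq_integral) (use assms(2) in auto)
  moreover have "ennreal (indicator {r<..T} s *\<^sub>R \<psi> (X s \<omega>)) = ennreal (\<psi> (X s \<omega>)) * indicator {r<..T} s" for s
    by (simp add: indicator_def)
  ultimately show ?thesis by simp
qed

lemma stays_in_mono: "R \<le> R' \<Longrightarrow> stays_in r T R \<subseteq> stays_in r T R'"
  unfolding stays_in_def by (auto intro: order_trans)

lemma stays_in_exhausts:
  assumes "\<omega> \<in> space M" "0 \<le> r" "r < T"
  obtains R :: nat where "\<omega> \<in> stays_in r T (real R)"
proof -
  obtain R :: nat where R: "\<And>s. s \<in> {r..T} \<Longrightarrow> \<bar>X s \<omega>\<bar> \<le> real R"
    using path_bounded[OF assms(1), of r T] by blast
  have "node r T N i \<in> {r..T}" if "i \<le> N" for N i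
  proof (cases "N > 0")
    case True
    then show ?thesis using node_ge[OF assms(2,3) True] node_le_T[OF assms(2,3) True that] by simp
  next
    \<comment> \<open>Here \<open>N = 0\<close>, and the only node is \<open>r\<close>.\<close>
    case False
    then show ?thesis using assms by (simp add: node_def)
  qed
  then have "\<omega> \<in> stays_in r T (real R)" using R assms(1) by (simp add: stays_in_def)
  then show ?thesis by (rule that)
qed

text \<open>For each \<open>R\<close> the cut-off Green function agrees with \<open>green\<close> on
  \<open>[-R,R]\<close> to second order and stays below it everywhere, so the right-hand side is
  free of \<open>R\<close>. The events \<open>stays_in\<close> increase to the whole space, because
  paths are bounded on compact intervals.\<close>

lemma occupation_bound:
  assumes \<psi>: "continuous_on UNIV \<psi>" "\<And>y. 0 \<le> \<psi> y" "\<And>y. \<bar>y\<bar> \<ge> n \<Longrightarrow> \<psi> y = 0" and n: "0 \<le> n"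
    and r: "0 \<le> r" and rT: "r < T"
    and \<xi>: "\<xi> \<in> borel_measurable (F r)" "\<And>\<omega>. \<omega> \<in> space M \<Longrightarrow> 0 \<le> \<xi> \<omega> \<and> \<xi> \<omega> \<le> c"
  shows "(\<integral>\<^sup>+ \<omega>. ennreal (\<xi> \<omega>) * (\<integral>\<^sup>+ s \<in> {r<..T}. ennreal (\<psi> (X s \<omega>)) \<partial>lborel) \<partial>M)
    \<le> (\<integral>\<^sup>+ \<omega>. ennreal (\<xi> \<omega>) * ennreal (green n \<psi> (X r \<omega>)) \<partial>M)"
proof -
  have [measurable]: "\<psi> \<in> borel_measurable borel" using \<psi>(1) by (rule borel_measurable_continuous_onI)
  have \<xi>M [measurable]: "\<xi> \<in> borel_measurable M" using F_measurable[OF \<xi>(1)] .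
  note [measurable (raw)] = X_comp_measurable
  obtain \<omega>0 where "\<omega>0 \<in> space M" using not_empty by blast
  then have c: "0 \<le> c" using \<xi>(2)[of \<omega>0] by linarith
  obtain P where P: "\<And>y. \<bar>\<psi> y\<bar> \<le> P" using compact_support_bounded_unif(1)[OF \<psi>(1,3)] by blast
  let ?J = "\<lambda>\<omega>. LINT s:{r<..T}|lborel. \<psi> (X s \<omega>)"
  have Jm [measurable]: "?J \<in> borel_measurable M"
    unfolding set_lebesgue_integral_def by measurable
  have J0: "0 \<le> ?J \<omega>" for \<omega>
    unfolding set_lebesgue_integral_def using \<psi>(2) by (intro Bochner_Integration.integral_nonneg) simp
  have J_le: "?J \<omega> \<le> (T - r) * P" if \<omega>: "\<omega> \<in> space M" for \<omega>
  proof -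
    have "?J \<omega> \<le> (LINT s:{r<..T}|lborel. P)"
    proof (rule set_integral_mono)
      show "set_integrable lborel {r<..T} (\<lambda>s. \<psi> (X s \<omega>))"
        by (rule set_integrable_subset[OF path_drift_integrable[OF \<psi>(1) \<omega>, of r T]]) auto
      show "set_integrable lborel {r<..T} (\<lambda>s. P)"
        unfolding set_integrable_def by (rule integrable_scaleR_left) (use rT in auto)
      show "\<psi> (X s \<omega>) \<le> P" for s using P[of "X s \<omega>"] by linarith
    qed
    also have "\<dots> = (T - r) * P"
      using rT by (simp add: set_lebesgue_integral_def)
    finally show ?thesis .
  qed
  have R: "(\<integral>\<^sup>+ \<omega>. ennreal (\<xi> \<omega>) * (indicator (stays_in r T (real R)) \<omega> * ennreal (?J \<omega>)) \<partial>M)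
    \<le> (\<integral>\<^sup>+ \<omega>. ennreal (\<xi> \<omega>) * ennreal (green n \<psi> (X r \<omega>)) \<partial>M)" for R :: nat
  proof -
    obtain u' u'' where u: "\<And>y. (green n \<psi> has_real_derivative u' y) (at y)"
      "\<And>y. (u' has_real_derivative u'' y) (at y)" "continuous_on UNIV u''"
      "\<And>y. u' y * b y + u'' y * (a y)\<^sup>2 / 2 = - \<psi> y"
      using green_C2[OF \<psi> n] by blast
    obtain v v' v'' B where v: "test_function v v' v'' B" "\<And>y. 0 \<le> v y" "\<And>y. v y \<le> green n \<psi> y"
      "\<And>y. \<bar>y\<bar> \<le> real R \<Longrightarrow> v' y = u' y \<and> v'' y = u'' y"
      using test_function_cutoff[OF u(1-3) green_nonneg[OF \<psi> n], where R="real R"] by (metis of_nat_0_le_iff)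
    interpret test_function v v' v'' B by (rule v(1))
    note [measurable] = v_measurable(1)
    have le: "expectation (\<lambda>\<omega>. \<xi> \<omega> * (indicator (stays_in r T (real R)) \<omega> * ?J \<omega>)) \<le> expectation (\<lambda>\<omega>. \<xi> \<omega> * v (X r \<omega>))"
      by (rule occupation_bound_localized[OF v(1,2) \<psi>(1,2) _ r rT \<xi>]) (use v(4) u(4) in auto)
    have i1: "integrable M (\<lambda>\<omega>. \<xi> \<omega> * (indicator (stays_in r T (real R)) \<omega> * ?J \<omega>))"
    proof (rule integrable_bounded[where C="c * ((T - r) * P)"])
      fix \<omega> assume \<omega>: "\<omega> \<in> space M"
      have "\<bar>indicator (stays_in r T (real R)) \<omega> * ?J \<omega>\<bar> \<le> (T - r) * P"
        using J0[of \<omega>] J_le[OF \<omega>] by (auto simp: indicator_def)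
      then show "\<bar>\<xi> \<omega> * (indicator (stays_in r T (real R)) \<omega> * ?J \<omega>)\<bar> \<le> c * ((T - r) * P)"
        unfolding abs_mult[of "\<xi> \<omega>"] using \<xi>(2)[OF \<omega>] c by (intro mult_mono) auto
    qed measurable
    have i2: "integrable M (\<lambda>\<omega>. \<xi> \<omega> * v (X r \<omega>))"
    proof (rule integrable_bounded[where C="c * B"])
      fix \<omega> assume \<omega>: "\<omega> \<in> space M"
      show "\<bar>\<xi> \<omega> * v (X r \<omega>)\<bar> \<le> c * B"
        unfolding abs_mult using \<xi>(2)[OF \<omega>] c bounds(1) by (intro mult_mono) auto
    qed measurable
    have "(\<integral>\<^sup>+ \<omega>. ennreal (\<xi> \<omega>) * (indicator (stays_in r T (real R)) \<omega> * ennreal (?J \<omega>)) \<partial>M)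
      = (\<integral>\<^sup>+ \<omega>. ennreal (\<xi> \<omega> * (indicator (stays_in r T (real R)) \<omega> * ?J \<omega>)) \<partial>M)"
      by (rule nn_integral_cong) (use \<xi>(2) J0 in \<open>auto simp: ennreal_mult indicator_def\<close>)
    also have "\<dots> = ennreal (expectation (\<lambda>\<omega>. \<xi> \<omega> * (indicator (stays_in r T (real R)) \<omega> * ?J \<omega>)))"
      by (rule nn_integral_eq_integral[OF i1]) (use \<xi>(2) J0 in auto)
    also have "\<dots> \<le> ennreal (expectation (\<lambda>\<omega>. \<xi> \<omega> * v (X r \<omega>)))" using le by (rule ennreal_leI)
    also have "\<dots> = (\<integral>\<^sup>+ \<omega>. ennreal (\<xi> \<omega> * v (X r \<omega>)) \<partial>M)"
      by (rule nn_integral_eq_integral[OF i2, symmetric]) (use \<xi>(2) v(2) in auto)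
    also have "\<dots> \<le> (\<integral>\<^sup>+ \<omega>. ennreal (\<xi> \<omega>) * ennreal (green n \<psi> (X r \<omega>)) \<partial>M)"
    proof (rule nn_integral_mono)
      fix \<omega> assume \<omega>: "\<omega> \<in> space M"
      have "ennreal (\<xi> \<omega> * v (X r \<omega>)) = ennreal (\<xi> \<omega>) * ennreal (v (X r \<omega>))"
        using \<xi>(2)[OF \<omega>] v(2) by (simp add: ennreal_mult)
      also have "\<dots> \<le> ennreal (\<xi> \<omega>) * ennreal (green n \<psi> (X r \<omega>))"
        using v(3) by (intro mult_left_mono ennreal_leI) auto
      finally show "ennreal (\<xi> \<omega> * v (X r \<omega>)) \<le> ennreal (\<xi> \<omega>) * ennreal (green n \<psi> (X r \<omega>))" .
    qed
    finally show ?thesis .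
  qed
  let ?f = "\<lambda>(R::nat) \<omega>. ennreal (\<xi> \<omega>) * (indicator (stays_in r T (real R)) \<omega> * ennreal (?J \<omega>))"
  have "(\<integral>\<^sup>+ \<omega>. ennreal (\<xi> \<omega>) * (\<integral>\<^sup>+ s \<in> {r<..T}. ennreal (\<psi> (X s \<omega>)) \<partial>lborel) \<partial>M)
    \<le> (\<integral>\<^sup>+ \<omega>. (SUP R. ?f R \<omega>) \<partial>M)"
  proof (rule nn_integral_mono)
    fix \<omega> assume \<omega>: "\<omega> \<in> space M"
    obtain R :: nat where "\<omega> \<in> stays_in r T (real R)" using stays_in_exhausts[OF \<omega> r rT] by blast
    then have "ennreal (\<xi> \<omega>) * (\<integral>\<^sup>+ s \<in> {r<..T}. ennreal (\<psi> (X s \<omega>)) \<partial>lborel) = ?f R \<omega>"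
      using nn_integral_path_eq[OF \<psi>(1,2) \<omega>] by simp
    also have "\<dots> \<le> (SUP R. ?f R \<omega>)" by (rule SUP_upper) simp
    finally show "ennreal (\<xi> \<omega>) * (\<integral>\<^sup>+ s \<in> {r<..T}. ennreal (\<psi> (X s \<omega>)) \<partial>lborel) \<le> (SUP R. ?f R \<omega>)" .
  qed
  also have "\<dots> = (SUP R. \<integral>\<^sup>+ \<omega>. ?f R \<omega> \<partial>M)"
  proof (rule nn_integral_monotone_convergence_SUP)
    show "incseq ?f"
    proof (intro incseq_SucI le_funI mult_left_mono mult_right_mono)
      fix R \<omega>
      show "(indicator (stays_in r T (real R)) \<omega> :: ennreal) \<le> indicator (stays_in r T (real (Suc R))) \<omega>"
        using stays_in_mono[of "real R" "real (Suc R)" r T] by (auto simp: indicator_def)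
    qed auto
  qed measurable
  also have "\<dots> \<le> (\<integral>\<^sup>+ \<omega>. ennreal (\<xi> \<omega>) * ennreal (green n \<psi> (X r \<omega>)) \<partial>M)"
    by (rule SUP_least) (rule R)
  finally show ?thesis .
qed

definition occupation :: "(real \<Rightarrow> real) \<Rightarrow> real \<Rightarrow> 'a \<Rightarrow> real" where
  "occupation g t \<omega> = (LBINT s=ereal 0..ereal t. g (X s \<omega>))"

text \<open>The interval integral is suited to differentiation in \<open>t\<close>; this form shows
  joint measurability in \<open>t\<close> and \<open>\<omega>\<close>, as Fubini requires.\<close>

lemma occupation_eq:
  "0 \<le> t \<Longrightarrow> occupation g t \<omega> = (\<integral>s. (if 0 \<le> s \<and> s \<le> t then g (X s \<omega>) else 0) \<partial>lborel)"
  unfolding occupation_def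
  by (simp add: interval_integral_Icc set_lebesgue_integral_def indicator_def if_distrib[of "\<lambda>c. c * _"] cong: if_cong)
    (auto intro!: Bochner_Integration.integral_cong)

text \<open>Bounds for the moments of \<open>\<integral> g(X s) ds\<close>; the factor
  \<open>Suc j\<close> comes from differentiating the power \<open>Suc j\<close>.\<close>

fun green_iter :: "real \<Rightarrow> (real \<Rightarrow> real) \<Rightarrow> nat \<Rightarrow> real \<Rightarrow> real" where
  "green_iter n g 0 = (\<lambda>y. 1)"
| "green_iter n g (Suc j) = green n (\<lambda>z. real (Suc j) * g z * green_iter n g j z)"

context
  fixes g :: "real \<Rightarrow> real" and n :: real
  assumes g: "continuous_on UNIV g" "\<And>y. 0 \<le> g y" "\<And>y. \<bar>y\<bar> \<ge> n \<Longrightarrow> g y = 0" and n: "0 \<le> n"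
begin

lemma green_iter_props: "continuous_on UNIV (green_iter n g j) \<and> (\<forall>y. 0 \<le> green_iter n g j y)"
proof (induction j)
  case 0
  then show ?case by simp
next
  case (Suc j)
  have 1: "continuous_on UNIV (\<lambda>z. real (Suc j) * g z * green_iter n g j z)"
    using Suc g(1) by (intro continuous_intros) auto
  have 2: "0 \<le> real (Suc j) * g z * green_iter n g j z" for z
    using Suc g(2) by (intro mult_nonneg_nonneg) auto
  have 3: "real (Suc j) * g z * green_iter n g j z = 0" if "\<bar>z\<bar> \<ge> n" for z
    using g(3)[OF that] by simp
  show ?case
    unfolding green_iter.simps using green_cont[OF 1 2 3 n] green_nonneg[OF 1 2 3 n] by blast
qed

lemma green_iter_weight:
  shows "continuous_on UNIV (\<lambda>z. real (Suc j) * g z * green_iter n g j z)"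
    and "0 \<le> real (Suc j) * g z * green_iter n g j z"
    and "\<bar>z\<bar> \<ge> n \<Longrightarrow> real (Suc j) * g z * green_iter n g j z = 0"
proof -
  show "continuous_on UNIV (\<lambda>z. real (Suc j) * g z * green_iter n g j z)"
    using green_iter_props[of j] g(1) by (intro continuous_intros) auto
  show "0 \<le> real (Suc j) * g z * green_iter n g j z"
    using green_iter_props[of j] g(2) by (intro mult_nonneg_nonneg) auto
  show "\<bar>z\<bar> \<ge> n \<Longrightarrow> real (Suc j) * g z * green_iter n g j z = 0"
    using g(3) by simp
qed

lemma occupation_deriv:
  "\<omega> \<in> space M \<Longrightarrow> ((\<lambda>t. occupation g t \<omega>) has_real_derivative g (X t \<omega>)) (at t)"
  unfolding occupation_def
  by (rule LBINT_deriv[where f="\<lambda>s. g (X s \<omega>)"], rule continuous_on_compose2[OF g(1) X_cont]) auto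

lemma occupation_mono:
  assumes "\<omega> \<in> space M" "s \<le> t"
  shows "occupation g s \<omega> \<le> occupation g t \<omega>"
proof (rule DERIV_nonneg_imp_nondecreasing[OF assms(2)])
  fix t
  show "\<exists>y. ((\<lambda>t. occupation g t \<omega>) has_real_derivative y) (at t) \<and> 0 \<le> y"
    using occupation_deriv[OF assms(1), of t] g(2)[of "X t \<omega>"] by blast
qed

lemma occupation_power:
  assumes \<omega>: "\<omega> \<in> space M" and "s \<le> T"
  shows "ennreal ((occupation g T \<omega> - occupation g s \<omega>) ^ Suc j)
    = (\<integral>\<^sup>+ q \<in> {s<..T}. ennreal (real (Suc j) * g (X q \<omega>) * (occupation g T \<omega> - occupation g q \<omega>) ^ j) \<partial>lborel)"
proof -
  let ?A = "\<lambda>t. occupation g t \<omega>"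
  let ?f = "\<lambda>q. real (Suc j) * g (X q \<omega>) * (?A T - ?A q) ^ j"
  have cA: "continuous_on UNIV ?A"
    using DERIV_isCont[OF occupation_deriv[OF \<omega>]] by (simp add: continuous_on_eq_continuous_at)
  have cg: "continuous_on UNIV (\<lambda>q. g (X q \<omega>))"
    by (rule continuous_on_compose2[OF g(1) X_cont[OF \<omega>]]) auto
  have cf: "continuous_on UNIV ?f"
    by (intro continuous_on_mult continuous_on_const cg continuous_on_power continuous_on_diff cA)
  have d: "((\<lambda>q. - ((?A T - ?A q) ^ Suc j)) has_real_derivative ?f q) (at q)" for q
  proof -
    have "((\<lambda>q. ?A T - ?A q) has_real_derivative 0 - g (X q \<omega>)) (at q)"
      by (rule DERIV_diff[OF DERIV_const occupation_deriv[OF \<omega>]])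
    from DERIV_minus[OF DERIV_power[OF this, of "Suc j"]]
    show ?thesis by (rule DERIV_cong) (simp add: algebra_simps del: of_nat_Suc)
  qed
  have "(LBINT q=ereal s..ereal T. ?f q) = - ((?A T - ?A T) ^ Suc j) - (- ((?A T - ?A s) ^ Suc j))"
    by (rule LBINT_FTC[where G="\<lambda>q. - ((?A T - ?A q) ^ Suc j)" and f="?f", OF d cf])
  moreover have "(?A T - ?A T) ^ Suc j = 0" by (simp only: diff_self power_0_Suc)
  ultimately have eq: "(?A T - ?A s) ^ Suc j = (LBINT q=ereal s..ereal T. ?f q)" by linarith
  have nn: "0 \<le> ?f q" if "q \<le> T" for q
  proof -
    have "0 \<le> ?A T - ?A q" using occupation_mono[OF \<omega> that] by linarith
    then have "0 \<le> (?A T - ?A q) ^ j" by (rule zero_le_power)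
    moreover have "0 \<le> real (Suc j) * g (X q \<omega>)" by (rule mult_nonneg_nonneg[OF of_nat_0_le_iff g(2)])
    ultimately show ?thesis by (rule mult_nonneg_nonneg[rotated])
  qed
  show ?thesis unfolding eq by (rule LBINT_nn_integral[OF cf nn \<open>s \<le> T\<close>])
qed

text \<open>The induction runs over all times and all bounded weights. After Fubini, at a fixed time
  \<open>q\<close>, the product of \<open>\<xi>\<close> with
  \<open>real (Suc j) * g (X q \<omega>)\<close> is again a bounded weight known at time
  \<open>q\<close>, so the induction hypothesis replaces the remaining power by
  \<open>green_iter n g j (X q \<omega>)\<close>. Integrating back over \<open>q\<close> leaves a
  first moment, to which \<open>occupation_bound\<close> applies.\<close>

lemma occupation_moment:
  assumes "0 \<le> s" "s \<le> T" "\<xi> \<in> borel_measurable (F s)" "\<And>\<omega>. \<omega> \<in> space M \<Longrightarrow> 0 \<le> \<xi> \<omega> \<and> \<xi> \<omega> \<le> c"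
  shows "(\<integral>\<^sup>+ \<omega>. ennreal (\<xi> \<omega>) * ennreal ((occupation g T \<omega> - occupation g s \<omega>) ^ j) \<partial>M)
    \<le> (\<integral>\<^sup>+ \<omega>. ennreal (\<xi> \<omega>) * ennreal (green_iter n g j (X s \<omega>)) \<partial>M)"
  using assms
proof (induction j arbitrary: s \<xi> c)
  case 0
  then show ?case by simp
next
  case (Suc j)
  show ?case
  proof (cases "s = T")
    case True
    then show ?thesis by simp
  next
    case False
    then have sT: "s < T" using Suc.prems by simp
    have \<xi>M [measurable]: "\<xi> \<in> borel_measurable M" using F_measurable[OF Suc.prems(3)] .
    have gm [measurable]: "g \<in> borel_measurable borel" using g(1) by (rule borel_measurable_continuous_onI)
    have um [measurable]: "green_iter n g j \<in> borel_measurable borel"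
      using green_iter_props by (intro borel_measurable_continuous_onI) blast
    note [measurable (raw)] = X_comp_measurable
    obtain P where P: "\<And>y. \<bar>g y\<bar> \<le> P" using compact_support_bounded_unif(1)[OF g(1,3)] by blast
    obtain \<omega>0 where "\<omega>0 \<in> space M" using not_empty by blast
    then have c: "0 \<le> c" using Suc.prems(4)[of \<omega>0] by linarith
    let ?A = "\<lambda>t \<omega>. \<integral>p. (if 0 \<le> p \<and> p \<le> t then g (X p \<omega>) else 0) \<partial>lborel"
    let ?w = "\<lambda>q \<omega>. real (Suc j) * g (X q \<omega>)"
    let ?\<psi> = "\<lambda>z. real (Suc j) * g z * green_iter n g j z"
    interpret pair_sigma_finite lborel M
      by (intro pair_sigma_finite.intro lborel.sigma_finite_measure_axioms sigma_finite_measure_axioms)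
    have meas1: "(\<lambda>(q, \<omega>). ennreal (\<xi> \<omega>) * (ennreal (?w q \<omega> * (?A T \<omega> - ?A q \<omega>) ^ j) * indicator {s<..T} q))
        \<in> borel_measurable (lborel \<Otimes>\<^sub>M M)"
      by measurable
    have meas2: "(\<lambda>(q, \<omega>). ennreal (\<xi> \<omega>) * (ennreal (?\<psi> (X q \<omega>)) * indicator {s<..T} q))
        \<in> borel_measurable (lborel \<Otimes>\<^sub>M M)"
      by measurable
    have pathm: "(\<lambda>q. X q \<omega>) \<in> borel_measurable borel" if "\<omega> \<in> space M" for \<omega>
      using X_path_measurable[OF that] .
    have "(\<integral>\<^sup>+ \<omega>. ennreal (\<xi> \<omega>) * ennreal ((occupation g T \<omega> - occupation g s \<omega>) ^ Suc j) \<partial>M)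
      = (\<integral>\<^sup>+ \<omega>. (\<integral>\<^sup>+ q. ennreal (\<xi> \<omega>) * (ennreal (?w q \<omega> * (?A T \<omega> - ?A q \<omega>) ^ j) * indicator {s<..T} q) \<partial>lborel) \<partial>M)"
    proof (rule nn_integral_cong)
      fix \<omega> assume \<omega>: "\<omega> \<in> space M"
      have "ennreal ((occupation g T \<omega> - occupation g s \<omega>) ^ Suc j)
        = (\<integral>\<^sup>+ q. ennreal (?w q \<omega> * (?A T \<omega> - ?A q \<omega>) ^ j) * indicator {s<..T} q \<partial>lborel)"
        unfolding occupation_power[OF \<omega> less_imp_le[OF sT]]
        by (intro nn_integral_cong) (use Suc.prems(1) sT in \<open>auto simp: indicator_def occupation_eq\<close>)
      moreover have "(\<lambda>q. ennreal (?w q \<omega> * (?A T \<omega> - ?A q \<omega>) ^ j) * indicator {s<..T} q) \<in> borel_measurable lborel"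
        using pathm[OF \<omega>] by measurable
      ultimately show "ennreal (\<xi> \<omega>) * ennreal ((occupation g T \<omega> - occupation g s \<omega>) ^ Suc j)
        = (\<integral>\<^sup>+ q. ennreal (\<xi> \<omega>) * (ennreal (?w q \<omega> * (?A T \<omega> - ?A q \<omega>) ^ j) * indicator {s<..T} q) \<partial>lborel)"
        by (simp only: nn_integral_cmult)
    qed
    also have "\<dots> = (\<integral>\<^sup>+ q. (\<integral>\<^sup>+ \<omega>. ennreal (\<xi> \<omega>) * (ennreal (?w q \<omega> * (?A T \<omega> - ?A q \<omega>) ^ j) * indicator {s<..T} q) \<partial>M) \<partial>lborel)"
      using Fubini'[OF meas1] by simp
    also have "\<dots> \<le> (\<integral>\<^sup>+ q. (\<integral>\<^sup>+ \<omega>. ennreal (\<xi> \<omega>) * (ennreal (?\<psi> (X q \<omega>)) * indicator {s<..T} q) \<partial>M) \<partial>lborel)"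
    proof (rule nn_integral_mono)
      fix q :: real
      show "(\<integral>\<^sup>+ \<omega>. ennreal (\<xi> \<omega>) * (ennreal (?w q \<omega> * (?A T \<omega> - ?A q \<omega>) ^ j) * indicator {s<..T} q) \<partial>M)
        \<le> (\<integral>\<^sup>+ \<omega>. ennreal (\<xi> \<omega>) * (ennreal (?\<psi> (X q \<omega>)) * indicator {s<..T} q) \<partial>M)"
      proof (cases "q \<in> {s<..T}")
        case True
        then have q: "0 \<le> q" "q \<le> T" "s \<le> q" using Suc.prems(1) by auto
        have w0: "0 \<le> ?w q \<omega>" for \<omega> using g(2) by (intro mult_nonneg_nonneg) auto
        have w\<xi>: "0 \<le> \<xi> \<omega> * ?w q \<omega> \<and> \<xi> \<omega> * ?w q \<omega> \<le> c * (real (Suc j) * P)" if \<omega>: "\<omega> \<in> space M" for \<omega>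
        proof
          show "0 \<le> \<xi> \<omega> * ?w q \<omega>" by (rule mult_nonneg_nonneg[OF conjunct1[OF Suc.prems(4)[OF \<omega>]] w0])
          have "g (X q \<omega>) \<le> P" using P[of "X q \<omega>"] by linarith
          then have "?w q \<omega> \<le> real (Suc j) * P" by (rule mult_left_mono) simp
          then show "\<xi> \<omega> * ?w q \<omega> \<le> c * (real (Suc j) * P)"
            by (rule mult_mono[OF conjunct2[OF Suc.prems(4)[OF \<omega>]] _ c w0])
        qed
        have wm: "(\<lambda>\<omega>. \<xi> \<omega> * ?w q \<omega>) \<in> borel_measurable (F q)"
          using F_mono[OF Suc.prems(3) q(3)] measurable_compose[OF X_adapted'[OF q(1)] gm]
          by (intro borel_measurable_times borel_measurable_const)
        have "(\<integral>\<^sup>+ \<omega>. ennreal (\<xi> \<omega>) * (ennreal (?w q \<omega> * (?A T \<omega> - ?A q \<omega>) ^ j) * indicator {s<..T} q) \<partial>M)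
          = (\<integral>\<^sup>+ \<omega>. ennreal (\<xi> \<omega> * ?w q \<omega>) * ennreal ((occupation g T \<omega> - occupation g q \<omega>) ^ j) \<partial>M)"
        proof (rule nn_integral_cong)
          fix \<omega> assume \<omega>: "\<omega> \<in> space M"
          have "0 \<le> (occupation g T \<omega> - occupation g q \<omega>) ^ j"
            using occupation_mono[OF \<omega> q(2)] by (intro zero_le_power) simp
          then have "ennreal (?w q \<omega> * (occupation g T \<omega> - occupation g q \<omega>) ^ j) = ennreal (?w q \<omega>) * ennreal ((occupation g T \<omega> - occupation g q \<omega>) ^ j)"
            by (rule ennreal_mult[OF w0])
          moreover have "ennreal (\<xi> \<omega> * ?w q \<omega>) = ennreal (\<xi> \<omega>) * ennreal (?w q \<omega>)"
            by (rule ennreal_mult[OF conjunct1[OF Suc.prems(4)[OF \<omega>]] w0])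
          ultimately show "ennreal (\<xi> \<omega>) * (ennreal (?w q \<omega> * (?A T \<omega> - ?A q \<omega>) ^ j) * indicator {s<..T} q)
            = ennreal (\<xi> \<omega> * ?w q \<omega>) * ennreal ((occupation g T \<omega> - occupation g q \<omega>) ^ j)"
            using True q occupation_eq[OF q(1), of g \<omega>] occupation_eq[of T g \<omega>] by (simp add: mult.assoc)
        qed
        also have "\<dots> \<le> (\<integral>\<^sup>+ \<omega>. ennreal (\<xi> \<omega> * ?w q \<omega>) * ennreal (green_iter n g j (X q \<omega>)) \<partial>M)"
          by (rule Suc.IH[OF q(1,2) wm w\<xi>])
        also have "\<dots> = (\<integral>\<^sup>+ \<omega>. ennreal (\<xi> \<omega>) * (ennreal (?\<psi> (X q \<omega>)) * indicator {s<..T} q) \<partial>M)"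
        proof (rule nn_integral_cong)
          fix \<omega> assume \<omega>: "\<omega> \<in> space M"
          have "0 \<le> green_iter n g j (X q \<omega>)" using green_iter_props by blast
          then have "ennreal (?\<psi> (X q \<omega>)) = ennreal (?w q \<omega>) * ennreal (green_iter n g j (X q \<omega>))"
            by (rule ennreal_mult[OF w0])
          moreover have "ennreal (\<xi> \<omega> * ?w q \<omega>) = ennreal (\<xi> \<omega>) * ennreal (?w q \<omega>)"
            by (rule ennreal_mult[OF conjunct1[OF Suc.prems(4)[OF \<omega>]] w0])
          ultimately show "ennreal (\<xi> \<omega> * ?w q \<omega>) * ennreal (green_iter n g j (X q \<omega>))
            = ennreal (\<xi> \<omega>) * (ennreal (?\<psi> (X q \<omega>)) * indicator {s<..T} q)"
            using True by (simp add: mult.assoc)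
        qed
        finally show ?thesis .
      next
        case False
        then show ?thesis by simp
      qed
    qed
    also have "\<dots> = (\<integral>\<^sup>+ \<omega>. (\<integral>\<^sup>+ q. ennreal (\<xi> \<omega>) * (ennreal (?\<psi> (X q \<omega>)) * indicator {s<..T} q) \<partial>lborel) \<partial>M)"
      using Fubini'[OF meas2] by simp
    also have "\<dots> = (\<integral>\<^sup>+ \<omega>. ennreal (\<xi> \<omega>) * (\<integral>\<^sup>+ q \<in> {s<..T}. ennreal (?\<psi> (X q \<omega>)) \<partial>lborel) \<partial>M)"
    proof (rule nn_integral_cong)
      fix \<omega> assume \<omega>: "\<omega> \<in> space M"
      have "(\<lambda>q. ennreal (?\<psi> (X q \<omega>)) * indicator {s<..T} q) \<in> borel_measurable lborel"
        using pathm[OF \<omega>] by measurable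
      then show "(\<integral>\<^sup>+ q. ennreal (\<xi> \<omega>) * (ennreal (?\<psi> (X q \<omega>)) * indicator {s<..T} q) \<partial>lborel)
        = ennreal (\<xi> \<omega>) * (\<integral>\<^sup>+ q \<in> {s<..T}. ennreal (?\<psi> (X q \<omega>)) \<partial>lborel)"
        by (rule nn_integral_cmult)
    qed
    also have "\<dots> \<le> (\<integral>\<^sup>+ \<omega>. ennreal (\<xi> \<omega>) * ennreal (green n ?\<psi> (X s \<omega>)) \<partial>M)"
      by (rule occupation_bound[OF green_iter_weight n Suc.prems(1) sT Suc.prems(3,4)])
    finally show ?thesis by simp
  qed
qed

end

end

text \<open>In the double supremum a pair of indices is dominated by the diagonal entry at their
  maximum.\<close>

lemma ennreal_SUP_power_le:
  fixes f :: "nat \<Rightarrow> ennreal"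
  assumes "incseq f"
  shows "(SUP i. f i) ^ k \<le> (SUP i. f i ^ k)"
proof (induction k)
  case (Suc k)
  have "(SUP i. f i) ^ Suc k \<le> (SUP i. f i) * (SUP j. f j ^ k)"
    using Suc by (simp add: mult_left_mono)
  also have "\<dots> = (SUP j. SUP i. f i * f j ^ k)"
    unfolding SUP_mult_right_ennreal SUP_mult_left_ennreal ..
  also have "\<dots> \<le> (SUP i. f i ^ Suc k)"
  proof (intro SUP_least)
    fix i j
    have "f i * f j ^ k \<le> f (max i j) * f (max i j) ^ k"
      using assms by (intro mult_mono power_mono) (auto simp: incseq_def)
    also have "\<dots> = f (max i j) ^ Suc k" by simp
    also have "\<dots> \<le> (SUP i. f i ^ Suc k)" by (rule SUP_upper) simp
    finally show "f i * f j ^ k \<le> (SUP i. f i ^ Suc k)" .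
  qed
  finally show ?case .
qed simp

section \<open>Hitting probabilities and the induction on moments\<close>

context transient_coefficients
begin

text \<open>The probability of hitting \<open>z\<close> from \<open>y\<close>.\<close>

definition hit :: "real \<Rightarrow> real \<Rightarrow> real" where "hit y z = min 1 (tail y / tail z)"

lemma hit_bounds: "0 < hit y z" "hit y z \<le> 1"
  using tail_pos by (auto simp: hit_def)

lemma hit_mult_tail: "tail z * hit y z = min (tail y) (tail z)"
  using tail_pos[of z] by (simp add: hit_def min_def field_simps)

text \<open>The ratios of tails telescope and no factor exceeds 1; in terms of paths, passing
  through \<open>z\<close> is one way to reach \<open>w\<close>.\<close>

lemma hit_triangle: "hit y z * hit z w \<le> hit y w"
proof -
  have "hit y z * hit z w \<le> 1 * 1" using hit_bounds[of y z] hit_bounds[of z w] by (intro mult_mono) auto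
  moreover have "hit y z * hit z w \<le> tail y / tail z * (tail z / tail w)"
    using tail_pos[of y] tail_pos[of z] tail_pos[of w] hit_bounds[of z w] by (intro mult_mono) (auto simp: hit_def)
  ultimately show ?thesis using tail_pos[of z] by (simp add: hit_def)
qed

text \<open>The \<open>L\<^sup>k\<close> norm of the local time at \<open>z\<close>, started at \<open>y\<close>, is \<open>(k!)\<^sup>1\<^sup>/\<^sup>k\<close> times this kernel.\<close>

definition kernel :: "nat \<Rightarrow> real \<Rightarrow> real \<Rightarrow> real" where
  "kernel k y z = tail z * speed z * hit y z powr (1 / real k)"

lemma kernel_nonneg: "0 \<le> kernel k y z"
  unfolding kernel_def using tail_pos[of z] speed_pos[of z] by simp

lemma kernel_cont: "continuous_on UNIV (kernel k y)"
proof -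
  have h: "continuous_on UNIV (hit y)"
    unfolding hit_def[abs_def] using tail_pos
    by (intro continuous_on_min continuous_on_const continuous_on_divide tail_cont) (auto simp: less_imp_neq[symmetric])
  have "continuous_on UNIV (\<lambda>z. hit y z powr (1 / real k))"
    using hit_bounds(1)[of y] by (intro continuous_on_powr h continuous_on_const) (auto simp: less_imp_neq[symmetric])
  then show ?thesis
    unfolding kernel_def[abs_def] by (intro continuous_on_mult tail_cont speed_cont)
qed

lemma kernel_measurable [measurable]: "kernel k y \<in> borel_measurable borel"
  using kernel_cont by (rule borel_measurable_continuous_onI)

lemma kernel_triangle: "hit y z powr (1 / real k) * kernel k z w \<le> kernel k y w"
proof -
  have "hit y z powr (1 / real k) * hit z w powr (1 / real k) = (hit y z * hit z w) powr (1 / real k)"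
    using hit_bounds(1) by (simp add: powr_mult less_imp_le)
  also have "\<dots> \<le> hit y w powr (1 / real k)"
    using hit_bounds(1)[of y z] hit_bounds(1)[of z w] hit_triangle by (intro powr_mono2) auto
  finally have "tail w * speed w * (hit y z powr (1 / real k) * hit z w powr (1 / real k)) \<le> tail w * speed w * hit y w powr (1 / real k)"
    using tail_pos[of w] speed_pos[of w] by (intro mult_left_mono) auto
  then show ?thesis by (simp add: kernel_def algebra_simps)
qed

text \<open>Rests on \<open>hit y z = h ^ k\<close> with \<open>h\<close> between 0 and 1. The
  factor \<open>h ^ j\<close> is split off for use with \<open>kernel_norm_triangle\<close>.\<close>

lemma green_kernel_le:
  assumes "Suc j \<le> k"
  shows "min (tail y) (tail z) * speed z \<le> kernel k y z * (hit y z powr (1 / real k)) ^ j"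
proof -
  define h where "h = hit y z powr (1 / real k)"
  have h: "0 \<le> h" "h \<le> 1" using hit_bounds[of y z] by (auto simp: h_def intro!: powr_le1)
  have "hit y z = h ^ k"
    using hit_bounds(1)[of y z] assms by (simp add: h_def powr_power)
  also have "\<dots> \<le> h ^ Suc j" using h assms by (intro power_decreasing) auto
  finally have "hit y z \<le> h * h ^ j" by simp
  then have "tail z * speed z * hit y z \<le> tail z * speed z * (h * h ^ j)"
    using tail_pos[of z] speed_pos[of z] by (intro mult_left_mono) auto
  then show ?thesis
    unfolding hit_mult_tail[symmetric] kernel_def h_def[symmetric] by (simp add: algebra_simps)
qed

end

context transient_diffusion
begin

text \<open>Times the k-th root of \<open>fact k\<close>, and for \<open>\<bar>f\<bar>\<close> in
  place of \<open>g\<close>, this is the right-hand side of the theorem; see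
  \<open>moment_bound_eq\<close>.\<close>

definition kernel_norm :: "nat \<Rightarrow> (real \<Rightarrow> real) \<Rightarrow> real \<Rightarrow> ennreal" where
  "kernel_norm k g y = (\<integral>\<^sup>+ z. ennreal (kernel k y z) * ennreal (g z) \<partial>lborel)"

context
  fixes g :: "real \<Rightarrow> real" and n :: real
  assumes g: "continuous_on UNIV g" "\<And>y. 0 \<le> g y" "\<And>y. \<bar>y\<bar> \<ge> n \<Longrightarrow> g y = 0" and n: "0 \<le> n"
begin

lemma kernel_norm_triangle: "ennreal (hit y z powr (1 / real k)) * kernel_norm k g z \<le> kernel_norm k g y"
proof -
  have [measurable]: "g \<in> borel_measurable borel" using g(1) by (rule borel_measurable_continuous_onI)
  have "ennreal (hit y z powr (1 / real k)) * kernel_norm k g z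
    = (\<integral>\<^sup>+ w. ennreal (hit y z powr (1 / real k)) * (ennreal (kernel k z w) * ennreal (g w)) \<partial>lborel)"
    unfolding kernel_norm_def by (rule nn_integral_cmult[symmetric]) measurable
  also have "\<dots> \<le> kernel_norm k g y"
    unfolding kernel_norm_def
  proof (rule nn_integral_mono)
    fix w
    have "ennreal (hit y z powr (1 / real k)) * (ennreal (kernel k z w) * ennreal (g w))
      = ennreal (hit y z powr (1 / real k) * kernel k z w) * ennreal (g w)"
      by (simp add: ennreal_mult kernel_nonneg mult.assoc)
    also have "\<dots> \<le> ennreal (kernel k y w) * ennreal (g w)"
      by (intro mult_right_mono ennreal_leI kernel_triangle) simp
    finally show "ennreal (hit y z powr (1 / real k)) * (ennreal (kernel k z w) * ennreal (g w))
      \<le> ennreal (kernel k y w) * ennreal (g w)" .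
  qed
  finally show ?thesis .
qed

text \<open>Under the Green integral the hypothesis yields the \<open>j\<close>-th power of the norm
  at \<open>z\<close>. The \<open>j\<close> factors from \<open>green_kernel_le\<close> turn it into
  the norm at \<open>y\<close>, which is constant in the integration, and the remaining integral is
  one more factor of that norm. The exponent \<open>k\<close> stays fixed while \<open>j\<close>
  grows up to it.\<close>

lemma green_iter_bound:
  assumes "j \<le> k" "\<bar>y\<bar> \<le> n"
  shows "ennreal (green_iter n g j y) \<le> ennreal (fact j) * kernel_norm k g y ^ j"
  using assms
proof (induction j arbitrary: y)
  case 0
  then show ?case by simp
next
  case (Suc j)
  have [measurable]: "g \<in> borel_measurable borel" using g(1) by (rule borel_measurable_continuous_onI)
  let ?\<psi> = "\<lambda>z. real (Suc j) * g z * green_iter n g j z"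
  let ?c = "ennreal (fact (Suc j)) * kernel_norm k g y ^ j"
  have "ennreal (green_iter n g (Suc j) y) = (\<integral>\<^sup>+ z. ennreal (min (tail y) (tail z) * speed z) * ennreal (?\<psi> z) \<partial>lborel)"
    unfolding green_iter.simps by (rule green_nn_integral[OF green_iter_weight[OF g n] n Suc.prems(2)])
  also have "\<dots> \<le> (\<integral>\<^sup>+ z. ?c * (ennreal (kernel k y z) * ennreal (g z)) \<partial>lborel)"
  proof (rule nn_integral_mono)
    fix z
    show "ennreal (min (tail y) (tail z) * speed z) * ennreal (?\<psi> z) \<le> ?c * (ennreal (kernel k y z) * ennreal (g z))"
    \<comment> \<open>The induction hypothesis is available only on \<open>[-n,n]\<close>; outside,
      \<open>g\<close> vanishes.\<close>
    proof (cases "\<bar>z\<bar> \<le> n")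
      case False
      then show ?thesis using g(3)[of z] by simp
    next
      case True
      let ?h = "hit y z powr (1 / real k)"
      have u0: "0 \<le> green_iter n g j z" using green_iter_props[OF g n] by blast
      have IH: "ennreal (green_iter n g j z) \<le> ennreal (fact j) * kernel_norm k g z ^ j"
        using Suc.IH[OF _ True] Suc.prems(1) by simp
      have "ennreal (min (tail y) (tail z) * speed z) \<le> ennreal (kernel k y z * ?h ^ j)"
        by (rule ennreal_leI[OF green_kernel_le[OF Suc.prems(1)]])
      also have "\<dots> = ennreal (kernel k y z) * ennreal ?h ^ j"
        by (simp add: ennreal_mult kernel_nonneg ennreal_power)
      finally have K: "ennreal (min (tail y) (tail z) * speed z) \<le> ennreal (kernel k y z) * ennreal ?h ^ j" .
      have "ennreal (?\<psi> z) = ennreal (real (Suc j) * g z) * ennreal (green_iter n g j z)"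
        by (rule ennreal_mult[OF _ u0]) (intro mult_nonneg_nonneg of_nat_0_le_iff g(2))
      also have "\<dots> \<le> ennreal (real (Suc j) * g z) * (ennreal (fact j) * kernel_norm k g z ^ j)"
        by (rule mult_left_mono[OF IH]) simp
      also have "ennreal (real (Suc j) * g z) = ennreal (real (Suc j)) * ennreal (g z)"
        by (rule ennreal_mult[OF of_nat_0_le_iff g(2)])
      finally have P: "ennreal (?\<psi> z) \<le> ennreal (real (Suc j)) * ennreal (g z) * (ennreal (fact j) * kernel_norm k g z ^ j)" .
      have "ennreal (min (tail y) (tail z) * speed z) * ennreal (?\<psi> z)
        \<le> (ennreal (kernel k y z) * ennreal ?h ^ j) * (ennreal (real (Suc j)) * ennreal (g z) * (ennreal (fact j) * kernel_norm k g z ^ j))"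
        by (rule mult_mono[OF K P]) auto
      also have "\<dots> = (ennreal (real (Suc j)) * ennreal (fact j)) * (ennreal ?h * kernel_norm k g z) ^ j * (ennreal (kernel k y z) * ennreal (g z))"
        unfolding power_mult_distrib by (simp only: mult_ac)
      also have "ennreal (real (Suc j)) * ennreal (fact j) = ennreal (fact (Suc j))"
        unfolding fact_Suc by (rule ennreal_mult[symmetric]) auto
      also have "ennreal (fact (Suc j)) * (ennreal ?h * kernel_norm k g z) ^ j * (ennreal (kernel k y z) * ennreal (g z))
        \<le> ?c * (ennreal (kernel k y z) * ennreal (g z))"
        by (intro mult_right_mono mult_left_mono power_mono kernel_norm_triangle) auto
      finally show ?thesis .
    qed
  qed
  also have "\<dots> = ?c * kernel_norm k g y"
    unfolding kernel_norm_def by (rule nn_integral_cmult) measurable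
  also have "\<dots> = ennreal (fact (Suc j)) * kernel_norm k g y ^ Suc j" by (simp only: power_Suc mult_ac)
  finally show ?case .
qed

lemma occupation_power_bound:
  assumes xn: "\<bar>x\<bar> \<le> n" and "0 \<le> T"
  shows "(\<integral>\<^sup>+ \<omega>. (\<integral>\<^sup>+ s \<in> {0<..T}. ennreal (g (X s \<omega>)) \<partial>lborel) ^ k \<partial>M) \<le> ennreal (fact k) * kernel_norm k g x ^ k"
proof -
  have "(\<integral>\<^sup>+ \<omega>. (\<integral>\<^sup>+ s \<in> {0<..T}. ennreal (g (X s \<omega>)) \<partial>lborel) ^ k \<partial>M)
    = (\<integral>\<^sup>+ \<omega>. ennreal 1 * ennreal ((occupation g T \<omega> - occupation g 0 \<omega>) ^ k) \<partial>M)"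
  proof (rule nn_integral_cong)
    fix \<omega> assume \<omega>: "\<omega> \<in> space M"
    have "ennreal (occupation g T \<omega> - occupation g 0 \<omega>) = (\<integral>\<^sup>+ s \<in> {0<..T}. ennreal (g (X s \<omega>)) \<partial>lborel)"
      using occupation_power[OF g n \<omega> \<open>0 \<le> T\<close>, of 0] by simp
    then show "(\<integral>\<^sup>+ s \<in> {0<..T}. ennreal (g (X s \<omega>)) \<partial>lborel) ^ k
      = ennreal 1 * ennreal ((occupation g T \<omega> - occupation g 0 \<omega>) ^ k)"
      using occupation_mono[OF g n \<omega> \<open>0 \<le> T\<close>] by (simp add: ennreal_power[symmetric])
  qed
  also have "\<dots> \<le> (\<integral>\<^sup>+ \<omega>. ennreal 1 * ennreal (green_iter n g k (X 0 \<omega>)) \<partial>M)"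
    by (rule occupation_moment[OF g n, where c=1]) (use \<open>0 \<le> T\<close> in auto)
  also have "\<dots> = (\<integral>\<^sup>+ \<omega>. ennreal (green_iter n g k x) \<partial>M)"
    using X_start by (intro nn_integral_cong_AE) auto
  also have "\<dots> = ennreal (green_iter n g k x)" by (simp add: emeasure_space_1)
  also have "\<dots> \<le> ennreal (fact k) * kernel_norm k g x ^ k"
    by (rule green_iter_bound[OF order_refl xn])
  finally show ?thesis .
qed

lemma total_occupation_bound:
  assumes xn: "\<bar>x\<bar> \<le> n"
  shows "(\<integral>\<^sup>+ \<omega>. (\<integral>\<^sup>+ s \<in> {0<..}. ennreal (g (X s \<omega>)) \<partial>lborel) ^ k \<partial>M) \<le> ennreal (fact k) * kernel_norm k g x ^ k"
proof -
  have [measurable]: "g \<in> borel_measurable borel" using g(1) by (rule borel_measurable_continuous_onI)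
  note [measurable (raw)] = X_comp_measurable
  let ?I = "\<lambda>(N::nat) \<omega>. \<integral>\<^sup>+ s \<in> {0<..real N}. ennreal (g (X s \<omega>)) \<partial>lborel"
  have inc: "incseq (\<lambda>N. ?I N \<omega>)" for \<omega>
    by (intro incseq_SucI nn_integral_mono) (auto simp: indicator_def)
  have sup: "(\<integral>\<^sup>+ s \<in> {0<..}. ennreal (g (X s \<omega>)) \<partial>lborel) = (SUP N. ?I N \<omega>)" if \<omega>: "\<omega> \<in> space M" for \<omega>
  proof -
    have [measurable]: "(\<lambda>s. X s \<omega>) \<in> borel_measurable borel" using X_path_measurable[OF \<omega>] .
    have "(\<integral>\<^sup>+ s \<in> {0<..}. ennreal (g (X s \<omega>)) \<partial>lborel) \<le> (\<integral>\<^sup>+ s. (SUP N::nat. ennreal (g (X s \<omega>)) * indicator {0<..real N} s) \<partial>lborel)"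
    proof (rule nn_integral_mono)
      fix s :: real
      obtain N :: nat where "s \<le> real N" using real_arch_simple by blast
      then have "ennreal (g (X s \<omega>)) * indicator {0<..} s = ennreal (g (X s \<omega>)) * indicator {0<..real N} s"
        by (simp add: indicator_def)
      also have "\<dots> \<le> (SUP N::nat. ennreal (g (X s \<omega>)) * indicator {0<..real N} s)" by (rule SUP_upper) simp
      finally show "ennreal (g (X s \<omega>)) * indicator {0<..} s \<le> (SUP N::nat. ennreal (g (X s \<omega>)) * indicator {0<..real N} s)" .
    qed
    also have "\<dots> = (SUP N. ?I N \<omega>)"
      by (rule nn_integral_monotone_convergence_SUP) (auto intro!: incseq_SucI le_funI simp: indicator_def)
    finally have 1: "(\<integral>\<^sup>+ s \<in> {0<..}. ennreal (g (X s \<omega>)) \<partial>lborel) \<le> (SUP N. ?I N \<omega>)" .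
    have 2: "(SUP N. ?I N \<omega>) \<le> (\<integral>\<^sup>+ s \<in> {0<..}. ennreal (g (X s \<omega>)) \<partial>lborel)"
      by (intro SUP_least nn_integral_mono) (auto simp: indicator_def)
    show ?thesis using 1 2 by (rule antisym)
  qed
  have "(\<integral>\<^sup>+ \<omega>. (\<integral>\<^sup>+ s \<in> {0<..}. ennreal (g (X s \<omega>)) \<partial>lborel) ^ k \<partial>M) \<le> (\<integral>\<^sup>+ \<omega>. (SUP N. ?I N \<omega> ^ k) \<partial>M)"
    by (rule nn_integral_mono) (simp add: sup ennreal_SUP_power_le[OF inc])
  also have "\<dots> = (SUP N. \<integral>\<^sup>+ \<omega>. ?I N \<omega> ^ k \<partial>M)"
  proof (rule nn_integral_monotone_convergence_SUP)
    show "incseq (\<lambda>N \<omega>. ?I N \<omega> ^ k)"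
      using inc by (auto simp: incseq_def le_fun_def intro!: power_mono)
  qed measurable
  also have "\<dots> \<le> ennreal (fact k) * kernel_norm k g x ^ k"
    by (rule SUP_least) (rule occupation_power_bound[OF xn], simp)
  finally show ?thesis .
qed

end

end

section \<open>From continuous to measurable functions\<close>

definition open_cutoff :: "real set \<Rightarrow> nat \<Rightarrow> real \<Rightarrow> real" where
  "open_cutoff U N z = min 1 (real N * infdist z (- U))"

lemma open_cutoff_cont: "continuous_on UNIV (open_cutoff U N)"
  unfolding open_cutoff_def[abs_def] by (intro continuous_intros)

lemma open_cutoff_bounds: "0 \<le> open_cutoff U N z" "open_cutoff U N z \<le> indicator U z"
  by (auto simp: open_cutoff_def infdist_nonneg indicator_def)

lemma open_cutoff_mono: "N \<le> N' \<Longrightarrow> open_cutoff U N z \<le> open_cutoff U N' z"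
  unfolding open_cutoff_def by (intro min.mono mult_right_mono) (auto simp: infdist_nonneg)

text \<open>A point of an open set has positive distance to the complement. The whole line is
  excluded because \<open>infdist\<close> to the empty set is 0 by convention.\<close>

lemma open_cutoff_eventually:
  assumes "open U" "U \<noteq> UNIV" "z \<in> U"
  obtains N where "open_cutoff U N z = 1"
proof -
  have "0 < infdist z (- U)"
    using infdist_pos_not_in_closed[of "- U" z] assms by auto
  then obtain N :: nat where "1 / infdist z (- U) \<le> real N" "0 < infdist z (- U)"
    using real_arch_simple by blast
  then have "open_cutoff U N z = 1" by (simp add: open_cutoff_def field_simps)
  then show ?thesis by (rule that)
qed

lemma bounded_not_UNIV: "(U :: real set) \<subseteq> {-L..L} \<Longrightarrow> U \<noteq> UNIV"
proof
  assume "U \<subseteq> {-L..L}" "U = UNIV"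
  then have "- L - 1 \<in> {-L..L}" by blast
  then show False by simp
qed

text \<open>Vitali-Caratheodory: approximation from above by a sum of indicators of bounded open sets, after
  rounding the values of \<open>f\<close> up to powers of \<open>q\<close>.\<close>

lemma open_sum_approximation:
  fixes f w :: "real \<Rightarrow> real"
  assumes f [measurable]: "f \<in> borel_measurable borel" and f0: "\<And>z. 0 \<le> f z"
    and w: "continuous_on UNIV w" "\<And>z. 0 \<le> w z" and q: "1 < q" and \<epsilon>: "0 < \<epsilon>"
  obtains c :: "nat \<Rightarrow> real" and U :: "nat \<Rightarrow> real set" and L :: "nat \<Rightarrow> real"
  where "\<And>i. 0 \<le> c i" "\<And>i. open (U i)" "\<And>i. U i \<subseteq> {-L i..L i}"
    "\<And>z. ennreal (f z) \<le> (\<Sum>i. ennreal (c i) * indicator (U i) z)"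
    "(\<integral>\<^sup>+ z. ennreal (w z) * (\<Sum>i. ennreal (c i) * indicator (U i) z) \<partial>lborel)
      \<le> ennreal q * (\<integral>\<^sup>+ z. ennreal (w z) * ennreal (f z) \<partial>lborel) + ennreal \<epsilon>"
proof -
  have [measurable]: "w \<in> borel_measurable borel" using w(1) by (rule borel_measurable_continuous_onI)
  \<comment> \<open>One index for the level of \<open>f\<close> on a logarithmic scale and for the
    integer cell of \<open>z\<close>: the level fixes \<open>f\<close> up to the factor
    \<open>q\<close>, the cell makes the pieces \<open>A i\<close> bounded. Below,
    \<open>c i\<close> is the upper end of the level and \<open>l i\<close> the left end of the
    cell.\<close>
  define code where "code z = to_nat (\<lfloor>log q (f z)\<rfloor>, \<lfloor>z\<rfloor>)" for z :: real
  define A where "A i = {z. 0 < f z \<and> code z = i}" for i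
  define c where "c i = q powr (real_of_int (fst (from_nat i :: int \<times> int)) + 1)" for i
  define l where "l i = real_of_int (snd (from_nat i :: int \<times> int))" for i
  define L where "L i = \<bar>l i\<bar> + 2" for i
  have c: "0 < c i" for i using q by (simp add: c_def)
  have Am [measurable]: "A i \<in> sets borel" for i
  proof -
    have "A i = {z. 0 < f z} \<inter> (\<Union>p \<in> {p :: int \<times> int. to_nat p = i}. {z. \<lfloor>log q (f z)\<rfloor> = fst p \<and> \<lfloor>z\<rfloor> = snd p})"
      by (auto simp: A_def code_def)
    also have "\<dots> \<in> sets borel"
      by (intro sets.Int sets.countable_UN') (auto intro: countableI_type)
    finally show ?thesis .
  qed
  have Al: "A i \<subseteq> {l i - 1<..<l i + 2}" for i
  proof
    fix z assume "z \<in> A i"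
    then have "l i = real_of_int \<lfloor>z\<rfloor>" by (auto simp: A_def code_def l_def)
    then show "z \<in> {l i - 1<..<l i + 2}" by simp linarith
  qed
  have "\<exists>K\<ge>0. \<forall>z. \<bar>z\<bar> \<le> L i \<longrightarrow> \<bar>w z\<bar> \<le> K" for i
    using continuous_bounded_on_interval[OF w(1), where R="L i"] by metis
  then obtain K where K: "\<And>i. 0 \<le> K i" "\<And>i z. \<bar>z\<bar> \<le> L i \<Longrightarrow> \<bar>w z\<bar> \<le> K i" by metis
  \<comment> \<open>The excess measure allowed to the i-th open set: with height \<open>c i\<close>
    and weight at most \<open>K i\<close>, it contributes at most
    \<open>\<epsilon> * (1/2) ^ Suc i\<close>. The summand 1 avoids division by 0.\<close>
  define e where "e i = \<epsilon> * (1/2) ^ Suc i / (c i * (K i + 1))" for i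
  have e: "0 < e i" "c i * (K i * e i) \<le> \<epsilon> * (1/2) ^ Suc i" for i
  proof -
    have K1: "0 < K i + 1" using K(1)[of i] by linarith
    show "0 < e i" unfolding e_def using \<epsilon> c[of i] K1 by simp
    have "c i * (K i * e i) \<le> c i * ((K i + 1) * e i)"
      using c[of i] \<open>0 < e i\<close> by (intro mult_left_mono mult_right_mono) auto
    also have "\<dots> = \<epsilon> * (1/2) ^ Suc i"
      unfolding e_def using c[of i] K1 by simp
    finally show "c i * (K i * e i) \<le> \<epsilon> * (1/2) ^ Suc i" .
  qed
  have "\<exists>V. open V \<and> A i \<subseteq> V \<and> emeasure lborel (V - A i) < ennreal (e i)" for i
    using outer_regular_lborel[OF Am e(1), of i i] by metis
  then obtain V where V: "\<And>i. open (V i)" "\<And>i. A i \<subseteq> V i" "\<And>i. emeasure lborel (V i - A i) < ennreal (e i)"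
    by metis
  \<comment> \<open>The set from outer regularity is cut to a bounded open interval around the cell,
    on which \<open>w\<close> is at most \<open>K i\<close>.\<close>
  define U where "U i = V i \<inter> {l i - 1<..<l i + 2}" for i
  have U: "open (U i)" "A i \<subseteq> U i" "U i \<subseteq> {-L i..L i}" for i
    using V(1,2)[of i] Al[of i] by (auto simp: U_def L_def)
  have [measurable]: "U i \<in> sets borel" for i using U(1)[of i] by (rule borel_open)
  have UA: "emeasure lborel (U i - A i) \<le> ennreal (e i)" for i
  proof -
    have "emeasure lborel (U i - A i) \<le> emeasure lborel (V i - A i)"
      using V(1)[of i] by (intro emeasure_mono) (auto simp: U_def)
    then show ?thesis using V(3)[of i] by simp
  qed
  \<comment> \<open>The \<open>A i\<close> are disjoint, so at most one term of the series is
    nonzero.\<close>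
  have rounding: "ennreal (f z) \<le> (\<Sum>i. ennreal (c i) * indicator (A i) z)
      \<and> (\<Sum>i. ennreal (c i) * indicator (A i) z) \<le> ennreal q * ennreal (f z)" for z
  proof (cases "0 < f z")
    case False
    then have "f z = 0" using f0[of z] by simp
    then show ?thesis by (simp add: A_def)
  next
    case True
    have "ennreal (c i) * indicator (A i) z = (if i = code z then ennreal (c (code z)) else 0)" for i
      using True by (auto simp: A_def indicator_def)
    then have "(\<Sum>i. ennreal (c i) * indicator (A i) z) = (\<Sum>i. if i = code z then ennreal (c (code z)) else 0)" by simp
    also have "\<dots> = ennreal (c (code z))"
      using sums_single[of "code z" "\<lambda>_. ennreal (c (code z))"] by (simp add: sums_iff)
    finally have S: "(\<Sum>i. ennreal (c i) * indicator (A i) z) = ennreal (c (code z))" .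
    let ?m = "real_of_int \<lfloor>log q (f z)\<rfloor>"
    have cz: "c (code z) = q powr (?m + 1)" by (simp add: c_def code_def)
    have fz: "f z = q powr (log q (f z))" using True q by simp
    have "f z \<le> q powr (?m + 1)"
      by (subst fz, rule powr_mono) (use q in \<open>linarith+\<close>)
    moreover have "q powr (?m + 1) \<le> q * f z"
    proof -
      have "q powr ?m \<le> q powr (log q (f z))" by (rule powr_mono) (use q in \<open>linarith+\<close>)
      then have "q * q powr ?m \<le> q * f z" using fz q by (intro mult_left_mono) auto
      then show ?thesis using q by (simp add: powr_add mult.commute)
    qed
    ultimately show ?thesis
      unfolding S cz using q f0[of z] by (simp add: ennreal_leI ennreal_mult[symmetric])
  qed
  have IU: "(\<integral>\<^sup>+ z. ennreal (w z) * (ennreal (c i) * indicator (U i) z) \<partial>lborel)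
    \<le> (\<integral>\<^sup>+ z. ennreal (w z) * (ennreal (c i) * indicator (A i) z) \<partial>lborel) + ennreal (\<epsilon> * (1/2) ^ Suc i)" for i
  proof -
    have "(\<integral>\<^sup>+ z. ennreal (w z) * (ennreal (c i) * indicator (U i) z) \<partial>lborel)
      \<le> (\<integral>\<^sup>+ z. ennreal (w z) * (ennreal (c i) * indicator (A i) z) + ennreal (c i * K i) * indicator (U i - A i) z \<partial>lborel)"
    proof (rule nn_integral_mono)
      fix z
      show "ennreal (w z) * (ennreal (c i) * indicator (U i) z)
        \<le> ennreal (w z) * (ennreal (c i) * indicator (A i) z) + ennreal (c i * K i) * indicator (U i - A i) z"
      proof (cases "z \<in> U i - A i")
        case True
        then have "w z \<le> K i" using U(3)[of i] K(2)[of z i] by (auto simp: abs_le_iff)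
        then have "w z * c i \<le> c i * K i" using c[of i] by (simp add: mult.commute)
        then show ?thesis using True w(2)[of z] c[of i]
          by (simp add: ennreal_mult[symmetric] ennreal_leI less_imp_le)
      next
        case False
        then show ?thesis using U(2)[of i] by (auto simp: indicator_def)
      qed
    qed
    also have "\<dots> = (\<integral>\<^sup>+ z. ennreal (w z) * (ennreal (c i) * indicator (A i) z) \<partial>lborel) + ennreal (c i * K i) * emeasure lborel (U i - A i)"
      by (subst nn_integral_add) (auto simp: nn_integral_cmult)
    also have "ennreal (c i * K i) * emeasure lborel (U i - A i) \<le> ennreal (c i * K i) * ennreal (e i)"
      by (rule mult_left_mono[OF UA]) simp
    also have "\<dots> = ennreal (c i * (K i * e i))"
      using c[of i] K(1)[of i] e(1)[of i] by (simp add: ennreal_mult[symmetric] mult.assoc less_imp_le)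
    also have "\<dots> \<le> ennreal (\<epsilon> * (1/2) ^ Suc i)" by (rule ennreal_leI[OF e(2)])
    finally show ?thesis by (simp add: add_left_mono)
  qed
  have suml: "ennreal (w z) * (\<Sum>i. ennreal (c i) * indicator (B i) z) = (\<Sum>i. ennreal (w z) * (ennreal (c i) * indicator (B i) z))" for B z
    by (rule ennreal_suminf_cmult[symmetric])
  have "(\<integral>\<^sup>+ z. ennreal (w z) * (\<Sum>i. ennreal (c i) * indicator (U i) z) \<partial>lborel)
    = (\<Sum>i. \<integral>\<^sup>+ z. ennreal (w z) * (ennreal (c i) * indicator (U i) z) \<partial>lborel)"
    unfolding suml by (rule nn_integral_suminf) measurable
  also have "\<dots> \<le> (\<Sum>i. (\<integral>\<^sup>+ z. ennreal (w z) * (ennreal (c i) * indicator (A i) z) \<partial>lborel) + ennreal (\<epsilon> * (1/2) ^ Suc i))"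
    by (rule suminf_le[OF IU]) auto
  also have "\<dots> = (\<Sum>i. \<integral>\<^sup>+ z. ennreal (w z) * (ennreal (c i) * indicator (A i) z) \<partial>lborel) + (\<Sum>i. ennreal (\<epsilon> * (1/2) ^ Suc i))"
    by (rule suminf_add[symmetric]) auto
  also have "(\<Sum>i. ennreal (\<epsilon> * (1/2) ^ Suc i)) = ennreal (\<epsilon> * 1)"
    using \<epsilon> by (intro suminf_ennreal_eq sums_mult power_half_series) auto
  also have "(\<Sum>i. \<integral>\<^sup>+ z. ennreal (w z) * (ennreal (c i) * indicator (A i) z) \<partial>lborel)
    = (\<integral>\<^sup>+ z. ennreal (w z) * (\<Sum>i. ennreal (c i) * indicator (A i) z) \<partial>lborel)"
    unfolding suml by (rule nn_integral_suminf[symmetric]) measurable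
  also have "\<dots> \<le> (\<integral>\<^sup>+ z. ennreal q * (ennreal (w z) * ennreal (f z)) \<partial>lborel)"
  proof (rule nn_integral_mono)
    fix z
    have "ennreal (w z) * (\<Sum>i. ennreal (c i) * indicator (A i) z) \<le> ennreal (w z) * (ennreal q * ennreal (f z))"
      using rounding[of z] by (intro mult_left_mono) auto
    then show "ennreal (w z) * (\<Sum>i. ennreal (c i) * indicator (A i) z) \<le> ennreal q * (ennreal (w z) * ennreal (f z))"
      by (simp only: mult.left_commute)
  qed
  also have "\<dots> = ennreal q * (\<integral>\<^sup>+ z. ennreal (w z) * ennreal (f z) \<partial>lborel)"
    by (rule nn_integral_cmult) measurable
  finally have bound: "(\<integral>\<^sup>+ z. ennreal (w z) * (\<Sum>i. ennreal (c i) * indicator (U i) z) \<partial>lborel)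
      \<le> ennreal q * (\<integral>\<^sup>+ z. ennreal (w z) * ennreal (f z) \<partial>lborel) + ennreal \<epsilon>"
    by (simp add: add_right_mono)
  have above: "ennreal (f z) \<le> (\<Sum>i. ennreal (c i) * indicator (U i) z)" for z
  proof -
    have "(\<Sum>i. ennreal (c i) * indicator (A i) z) \<le> (\<Sum>i. ennreal (c i) * indicator (U i) z)"
      using U(2) by (intro suminf_le) (auto simp: indicator_def)
    then show ?thesis using rounding[of z] by (blast intro: order_trans)
  qed
  show ?thesis by (rule that[of c U L, OF less_imp_le[OF c] U(1,3) above bound])
qed

context transient_diffusion
begin

text \<open>\<open>G\<close> is lower semicontinuous, hence an increasing limit of continuous
  functions with compact support, to which \<open>total_occupation_bound\<close> applies. In
  \<open>g\<close> the index \<open>N\<close> serves both as the number of terms and as the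
  steepness of the cut-offs.\<close>

lemma open_sum_occupation_bound:
  fixes c L :: "nat \<Rightarrow> real" and U :: "nat \<Rightarrow> real set"
  assumes c: "\<And>i. 0 \<le> c i" and U: "\<And>i. open (U i)" "\<And>i. U i \<subseteq> {-L i..L i}"
  defines "G \<equiv> \<lambda>z. \<Sum>i. ennreal (c i) * indicator (U i) z"
  shows "(\<integral>\<^sup>+ \<omega>. (\<integral>\<^sup>+ s \<in> {0<..}. G (X s \<omega>) \<partial>lborel) ^ k \<partial>M)
    \<le> ennreal (fact k) * (\<integral>\<^sup>+ z. ennreal (kernel k x z) * G z \<partial>lborel) ^ k"
proof -
  define g where "g N z = (\<Sum>i<N. c i * open_cutoff (U i) N z)" for N z
  have g_cont: "continuous_on UNIV (g N)" for N
    unfolding g_def[abs_def] by (intro continuous_on_sum continuous_on_mult continuous_on_const open_cutoff_cont)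
  have g0: "0 \<le> g N z" for N z
    unfolding g_def by (intro sum_nonneg mult_nonneg_nonneg c open_cutoff_bounds)
  have [measurable]: "g N \<in> borel_measurable borel" for N
    using g_cont by (rule borel_measurable_continuous_onI)
  \<comment> \<open>It has to bound the support of \<open>g N\<close> and the starting point
    \<open>x\<close> as well.\<close>
  define n where "n N = \<bar>x\<bar> + (\<Sum>i<N. \<bar>L i\<bar>) + 1" for N
  have n: "0 \<le> n N" "\<bar>x\<bar> \<le> n N" for N
    by (auto simp: n_def intro!: add_nonneg_nonneg sum_nonneg)
  have g_supp: "g N z = 0" if "\<bar>z\<bar> \<ge> n N" for N z
    unfolding g_def
  proof (rule sum.neutral, rule ballI)
    fix i assume i: "i \<in> {..<N}"
    have "\<bar>L i\<bar> \<le> (\<Sum>i<N. \<bar>L i\<bar>)" using i by (intro member_le_sum) auto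
    have "z \<notin> U i"
    proof
      assume "z \<in> U i"
      then have "\<bar>z\<bar> \<le> \<bar>L i\<bar>" using U(2)[of i] by force
      then show False using that \<open>\<bar>L i\<bar> \<le> _\<close> unfolding n_def by linarith
    qed
    then show "c i * open_cutoff (U i) N z = 0" using open_cutoff_bounds[of "U i" N z] by (simp add: antisym)
  qed
  have g_mono: "g N z \<le> g N' z" if "N \<le> N'" for N N' z
  proof -
    have "g N z \<le> (\<Sum>i<N. c i * open_cutoff (U i) N' z)"
      unfolding g_def using that c by (intro sum_mono mult_left_mono open_cutoff_mono) auto
    also have "\<dots> \<le> g N' z"
      unfolding g_def using that by (intro sum_mono2) (auto intro!: mult_nonneg_nonneg c open_cutoff_bounds)
    finally show ?thesis .
  qed
  have g_inc: "incseq (\<lambda>N. ennreal (g N z))" for z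
    by (auto simp: incseq_def intro!: ennreal_leI g_mono)
  have G_eq: "G z = (SUP N. ennreal (g N z))" for z
  proof (rule antisym)
    show "G z \<le> (SUP N. ennreal (g N z))"
      unfolding G_def suminf_eq_SUP
    proof (rule SUP_least)
      fix N
      have "\<exists>m. indicator (U i) z \<le> open_cutoff (U i) m z" for i
      proof (cases "z \<in> U i")
        case True
        then obtain m where "open_cutoff (U i) m z = 1"
          using open_cutoff_eventually[OF U(1) bounded_not_UNIV[OF U(2)]] by blast
        then show ?thesis using True by (auto intro!: exI[of _ m])
      next
        case False
        then show ?thesis using open_cutoff_bounds(1) by auto
      qed
      then obtain m where m: "\<And>i. indicator (U i) z \<le> open_cutoff (U i) (m i) z" by metis
      \<comment> \<open>At least \<open>N\<close>, and at least every \<open>m i\<close> with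
        \<open>i < N\<close>.\<close>
      define N' where "N' = N + (\<Sum>i<N. m i)"
      have "(\<Sum>i<N. ennreal (c i) * indicator (U i) z) = ennreal (\<Sum>i<N. c i * indicator (U i) z)"
        using c by (subst sum_ennreal[symmetric]) (auto simp: ennreal_mult ennreal_indicator)
      also have "\<dots> \<le> ennreal (g N' z)"
      proof (rule ennreal_leI)
        have "(\<Sum>i<N. c i * indicator (U i) z) \<le> (\<Sum>i<N. c i * open_cutoff (U i) N' z)"
        proof (intro sum_mono mult_left_mono c)
          fix i assume "i \<in> {..<N}"
          then have "m i \<le> N'" unfolding N'_def using member_le_sum[of i "{..<N}" m] by simp
          then show "indicator (U i) z \<le> open_cutoff (U i) N' z"
            using m[of i] open_cutoff_mono[of "m i" N' "U i" z] by linarith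
        qed
        also have "\<dots> \<le> g N' z"
          unfolding g_def by (intro sum_mono2) (auto simp: N'_def intro!: mult_nonneg_nonneg c open_cutoff_bounds)
        finally show "(\<Sum>i<N. c i * indicator (U i) z) \<le> g N' z" .
      qed
      also have "\<dots> \<le> (SUP N. ennreal (g N z))" by (rule SUP_upper) simp
      finally show "(\<Sum>i<N. ennreal (c i) * indicator (U i) z) \<le> (SUP N. ennreal (g N z))" .
    qed
    show "(SUP N. ennreal (g N z)) \<le> G z"
    proof (rule SUP_least)
      fix N
      have "ennreal (g N z) \<le> ennreal (\<Sum>i<N. c i * indicator (U i) z)"
        unfolding g_def by (intro ennreal_leI sum_mono mult_left_mono c open_cutoff_bounds)
      also have "\<dots> = (\<Sum>i<N. ennreal (c i) * indicator (U i) z)"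
        using c by (subst sum_ennreal[symmetric]) (auto simp: ennreal_mult ennreal_indicator)
      also have "\<dots> \<le> G z" unfolding G_def suminf_eq_SUP by (rule SUP_upper) simp
      finally show "ennreal (g N z) \<le> G z" .
    qed
  qed
  note [measurable (raw)] = X_comp_measurable
  let ?I = "\<lambda>N \<omega>. \<integral>\<^sup>+ s \<in> {0<..}. ennreal (g N (X s \<omega>)) \<partial>lborel"
  have inc: "incseq (\<lambda>N. ?I N \<omega>)" for \<omega>
    using g_inc by (auto simp: incseq_def intro!: nn_integral_mono mult_right_mono)
  have I_sup: "(\<integral>\<^sup>+ s \<in> {0<..}. G (X s \<omega>) \<partial>lborel) = (SUP N. ?I N \<omega>)" if \<omega>: "\<omega> \<in> space M" for \<omega>
  proof -
    have [measurable]: "(\<lambda>s. X s \<omega>) \<in> borel_measurable borel" using X_path_measurable[OF \<omega>] .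
    have "(\<integral>\<^sup>+ s \<in> {0<..}. G (X s \<omega>) \<partial>lborel) = (\<integral>\<^sup>+ s. (SUP N. ennreal (g N (X s \<omega>)) * indicator {0<..} s) \<partial>lborel)"
      by (simp add: G_eq SUP_mult_right_ennreal)
    also have "\<dots> = (SUP N. ?I N \<omega>)"
      by (rule nn_integral_monotone_convergence_SUP)
        (use g_inc in \<open>auto simp: incseq_def le_fun_def intro!: mult_right_mono\<close>)
    finally show ?thesis .
  qed
  have "(\<integral>\<^sup>+ \<omega>. (\<integral>\<^sup>+ s \<in> {0<..}. G (X s \<omega>) \<partial>lborel) ^ k \<partial>M) \<le> (\<integral>\<^sup>+ \<omega>. (SUP N. ?I N \<omega> ^ k) \<partial>M)"
    by (rule nn_integral_mono) (simp add: I_sup ennreal_SUP_power_le[OF inc])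
  also have "\<dots> = (SUP N. \<integral>\<^sup>+ \<omega>. ?I N \<omega> ^ k \<partial>M)"
  proof (rule nn_integral_monotone_convergence_SUP)
    show "incseq (\<lambda>N \<omega>. ?I N \<omega> ^ k)"
      using inc by (auto simp: incseq_def le_fun_def intro!: power_mono)
  qed measurable
  also have "\<dots> \<le> ennreal (fact k) * (\<integral>\<^sup>+ z. ennreal (kernel k x z) * G z \<partial>lborel) ^ k"
  proof (rule SUP_least)
    fix N
    have "(\<integral>\<^sup>+ \<omega>. ?I N \<omega> ^ k \<partial>M) \<le> ennreal (fact k) * kernel_norm k (g N) x ^ k"
      by (rule total_occupation_bound[OF g_cont g0 g_supp n])
    also have "\<dots> \<le> ennreal (fact k) * (\<integral>\<^sup>+ z. ennreal (kernel k x z) * G z \<partial>lborel) ^ k"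
      unfolding kernel_norm_def G_eq
      by (intro mult_left_mono power_mono nn_integral_mono SUP_upper) auto
    finally show "(\<integral>\<^sup>+ \<omega>. ?I N \<omega> ^ k \<partial>M) \<le> ennreal (fact k) * (\<integral>\<^sup>+ z. ennreal (kernel k x z) * G z \<partial>lborel) ^ k" .
  qed
  finally show ?thesis .
qed

text \<open>The function from \<open>open_sum_approximation\<close> dominates \<open>f\<close> at
  every point, so the comparison holds along every path; an almost everywhere bound would not
  control the time spent in a Lebesgue null set. Letting \<open>\<delta>\<close> tend to 0 removes
  both the factor \<open>1 + \<delta>\<close> and the added \<open>\<delta>\<close>.\<close>

lemma measurable_occupation_bound:
  fixes f :: "real \<Rightarrow> real"
  assumes f: "f \<in> borel_measurable borel" "\<And>z. 0 \<le> f z"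
  shows "(\<integral>\<^sup>+ \<omega>. (\<integral>\<^sup>+ s \<in> {0<..}. ennreal (f (X s \<omega>)) \<partial>lborel) ^ k \<partial>M)
    \<le> ennreal (fact k) * kernel_norm k f x ^ k"
proof (cases "kernel_norm k f x = \<top>")
  case True
  show ?thesis
  \<comment> \<open>For \<open>k = 0\<close> both sides are 1, even though the norm is
    infinite.\<close>
  proof (cases "k = 0")
    case True
    then show ?thesis by (simp add: emeasure_space_1)
  next
    case False
    then show ?thesis using \<open>kernel_norm k f x = \<top>\<close> by (simp add: power_eq_top_ennreal ennreal_mult_eq_top_iff top_unique)
  qed
next
  case False
  then obtain I where I: "kernel_norm k f x = ennreal I" "0 \<le> I" by (cases "kernel_norm k f x") auto
  let ?E = "\<integral>\<^sup>+ \<omega>. (\<integral>\<^sup>+ s \<in> {0<..}. ennreal (f (X s \<omega>)) \<partial>lborel) ^ k \<partial>M"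
  have bound: "?E \<le> ennreal (fact k * (I + \<delta> * (I + 1)) ^ k)" if \<delta>: "\<delta> > 0" for \<delta>
  proof -
    obtain c :: "nat \<Rightarrow> real" and U :: "nat \<Rightarrow> real set" and L :: "nat \<Rightarrow> real"
      where cU: "\<And>i. 0 \<le> c i" "\<And>i. open (U i)" "\<And>i. U i \<subseteq> {-L i..L i}"
        and above: "\<And>z. ennreal (f z) \<le> (\<Sum>i. ennreal (c i) * indicator (U i) z)"
        and le: "(\<integral>\<^sup>+ z. ennreal (kernel k x z) * (\<Sum>i. ennreal (c i) * indicator (U i) z) \<partial>lborel)
          \<le> ennreal (1 + \<delta>) * (\<integral>\<^sup>+ z. ennreal (kernel k x z) * ennreal (f z) \<partial>lborel) + ennreal \<delta>"
      using open_sum_approximation[OF f kernel_cont kernel_nonneg, of "1 + \<delta>" \<delta> k x] \<delta> by (smt (verit))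
    let ?G = "\<lambda>z. \<Sum>i. ennreal (c i) * indicator (U i) z"
    have "?E \<le> (\<integral>\<^sup>+ \<omega>. (\<integral>\<^sup>+ s \<in> {0<..}. ?G (X s \<omega>) \<partial>lborel) ^ k \<partial>M)"
      by (intro nn_integral_mono power_mono mult_right_mono above) auto
    also have "\<dots> \<le> ennreal (fact k) * (\<integral>\<^sup>+ z. ennreal (kernel k x z) * ?G z \<partial>lborel) ^ k"
      by (rule open_sum_occupation_bound[OF cU])
    also have "\<dots> \<le> ennreal (fact k) * (ennreal (1 + \<delta>) * ennreal I + ennreal \<delta>) ^ k"
      using le unfolding I(1)[symmetric] kernel_norm_def[symmetric] by (intro mult_left_mono power_mono) auto
    also have "ennreal (1 + \<delta>) * ennreal I + ennreal \<delta> = ennreal (I + \<delta> * (I + 1))"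
      using \<delta> I(2) by (simp add: ennreal_mult[symmetric] ennreal_plus[symmetric] algebra_simps del: ennreal_plus)
    also have "ennreal (fact k) * ennreal (I + \<delta> * (I + 1)) ^ k = ennreal (fact k * (I + \<delta> * (I + 1)) ^ k)"
    proof -
      have pos: "0 \<le> I + \<delta> * (I + 1)" using \<delta> I(2) by (intro add_nonneg_nonneg mult_nonneg_nonneg) auto
      show ?thesis
        unfolding ennreal_power[OF pos] by (rule ennreal_mult[symmetric]) (use pos in auto)
    qed
    finally show ?thesis .
  qed
  have "((\<lambda>\<delta>. ennreal (fact k * (I + \<delta> * (I + 1)) ^ k)) \<longlongrightarrow> ennreal (fact k * (I + 0 * (I + 1)) ^ k)) (at_right 0)"
    by (intro tendsto_ennrealI tendsto_intros)
  moreover have "\<forall>\<^sub>F \<delta> in at_right 0. ?E \<le> ennreal (fact k * (I + \<delta> * (I + 1)) ^ k)"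
    using bound by (auto simp: eventually_at_right_field intro!: exI[of _ 1])
  ultimately have "?E \<le> ennreal (fact k * (I + 0 * (I + 1)) ^ k)"
    by (rule tendsto_lowerbound) simp
  then show ?thesis using I by (simp add: ennreal_mult ennreal_power)
qed

end

section \<open>Paths modified on a null set\<close>

context wiener_space
begin

text \<open>Completeness of \<open>M\<close> enters here: a set that differs from a measurable one
  by a null set is measurable.\<close>

lemma measurable_AE_eq:
  fixes Y Y' :: "'a \<Rightarrow> 'b :: topological_space"
  assumes "Y \<in> borel_measurable M" "AE \<omega> in M. Y \<omega> = Y' \<omega>"
  shows "Y' \<in> borel_measurable M"
proof (rule measurableI)
  fix B :: "'b set" assume B: "B \<in> sets borel"
  have "AE \<omega> in M. \<omega> \<in> Y -` B \<inter> space M \<longleftrightarrow> \<omega> \<in> Y' -` B \<inter> space M"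
    using assms(2) by (auto elim!: eventually_mono)
  then show "Y' -` B \<inter> space M \<in> sets M"
    by (rule in_sets_AE) (use measurable_sets[OF assms(1) B] in auto)
qed simp

lemma null_in_probability_AE_eq:
  assumes Y: "null_in_probability M Y" and eq: "AE \<omega> in M. \<forall>n. Y n \<omega> = Y' n \<omega>"
  shows "null_in_probability M Y'"
proof -
  have m: "Y' n \<in> borel_measurable M" for n
    by (rule measurable_AE_eq[of "Y n"]) (use Y eq in \<open>auto simp: null_in_probability_def elim!: eventually_mono\<close>)
  have "prob {\<omega> \<in> space M. Y' n \<omega> > ennreal \<epsilon>} = prob {\<omega> \<in> space M. Y n \<omega> > ennreal \<epsilon>}" for n \<epsilon>
  proof (rule finite_measure_eq_AE)
    show "AE \<omega> in M. \<omega> \<in> {\<omega> \<in> space M. Y' n \<omega> > ennreal \<epsilon>} \<longleftrightarrow> \<omega> \<in> {\<omega> \<in> space M. Y n \<omega> > ennreal \<epsilon>}"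
      using eq by (auto elim!: eventually_mono)
    show "{\<omega> \<in> space M. Y n \<omega> > ennreal \<epsilon>} \<in> sets M" by (rule null_in_probability_sets[OF Y])
    note [measurable] = m
    show "{\<omega> \<in> space M. Y' n \<omega> > ennreal \<epsilon>} \<in> sets M" by measurable
  qed
  then show ?thesis using Y m by (simp add: null_in_probability_def)
qed

lemma has_ito_integral_AE_eq:
  assumes I: "has_ito_integral M F W H t I"
    and H: "AE \<omega> in M. \<forall>s\<ge>0. H s \<omega> = H' s \<omega>" and I': "AE \<omega> in M. I \<omega> = I' \<omega>"
  shows "has_ito_integral M F W H' t I'"
proof -
  obtain S where S: "\<And>n. simple_integrand F (S n)"
    and Y: "null_in_probability M (\<lambda>n \<omega>. \<integral>\<^sup>+ s \<in> {0..t}. ennreal ((simple_value (S n) s \<omega> - H s \<omega>)\<^sup>2) \<partial>lborel)"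
    and Z: "null_in_probability M (\<lambda>n \<omega>. ennreal \<bar>simple_ito W (S n) t \<omega> - I \<omega>\<bar>)"
    using I unfolding has_ito_integral_def by blast
  have "null_in_probability M (\<lambda>n \<omega>. \<integral>\<^sup>+ s \<in> {0..t}. ennreal ((simple_value (S n) s \<omega> - H' s \<omega>)\<^sup>2) \<partial>lborel)"
    by (rule null_in_probability_AE_eq[OF Y])
      (use H in \<open>auto elim!: eventually_mono intro!: nn_integral_cong simp: indicator_def\<close>)
  moreover have "null_in_probability M (\<lambda>n \<omega>. ennreal \<bar>simple_ito W (S n) t \<omega> - I' \<omega>\<bar>)"
    by (rule null_in_probability_AE_eq[OF Z]) (use I' in \<open>auto elim!: eventually_mono\<close>)
  ultimately show ?thesis using S unfolding has_ito_integral_def by blast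
qed

text \<open>On the null set of discontinuous paths the path is replaced by the constant
  \<open>x\<close>. Null sets belong to \<open>F 0\<close>, so adaptedness survives;
  \<open>max 0 t\<close> freezes the path at negative times. The Ito integrals carry over by
  \<open>has_ito_integral_AE_eq\<close>.\<close>

lemma continuous_modification:
  assumes X: "sde_solution M F W a b x X"
    and ab: "continuous_on UNIV a" "continuous_on UNIV b"
  obtains X' where "diffusion_path M F W a b x X'"
    "AE \<omega> in M. \<forall>t\<ge>0. X' t \<omega> = X t \<omega>" "AE \<omega> in M. X' 0 \<omega> = x"
proof -
  define N where "N = {\<omega> \<in> space M. \<not> continuous_on {0..} (\<lambda>t. X t \<omega>)}"
  have X_ad: "X t \<in> borel_measurable (F t)" if "0 \<le> t" for t
    using X that by (auto simp: sde_solution_def)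
  have X_cont: "AE \<omega> in M. continuous_on {0..} (\<lambda>t. X t \<omega>)" using X by (auto simp: sde_solution_def)
  have N_null: "N \<in> null_sets M" using X_cont unfolding N_def AE_iff_null_sets .
  define X' where "X' t \<omega> = (if \<omega> \<in> N then x else X (max 0 t) \<omega>)" for t \<omega>
  have X'_eq: "AE \<omega> in M. \<forall>t\<ge>0. X' t \<omega> = X t \<omega>"
    using AE_not_in[OF N_null] by (auto simp: X'_def elim!: eventually_mono)
  have "diffusion_path M F W a b x X'"
  proof unfold_locales
    show "continuous_on UNIV a" "continuous_on UNIV b" by (fact ab)+
    show "X' t \<in> borel_measurable (F (max 0 t))" for t
    proof -
      have "N \<in> sets (F 0)" using N_null null_sets_F by blast
      then have "N \<in> sets (F (max 0 t))" using sets_F_mono[of 0 "max 0 t"] by auto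
      moreover have "N \<subseteq> space (F (max 0 t))" by (auto simp: N_def space_F)
      ultimately have "{\<omega> \<in> space (F (max 0 t)). \<omega> \<in> N} \<in> sets (F (max 0 t))"
        by (simp add: Collect_conj_eq Int_absorb1)
      then show ?thesis
        unfolding X'_def[abs_def] by (intro measurable_If borel_measurable_const X_ad) auto
    qed
    show "continuous_on UNIV (\<lambda>t. X' t \<omega>)" if "\<omega> \<in> space M" for \<omega>
    proof (cases "\<omega> \<in> N")
      case True
      then show ?thesis by (simp add: X'_def)
    next
      case False
      then have "continuous_on {0..} (\<lambda>t. X t \<omega>)" using that by (simp add: N_def)
      then have "continuous_on UNIV (\<lambda>t. X (max 0 t) \<omega>)"
        by (rule continuous_on_compose2) (auto intro!: continuous_intros)
      then show ?thesis using False by (simp add: X'_def)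
    qed
    show "has_ito_integral M F W (\<lambda>s \<omega>. a (X' s \<omega>)) t (\<lambda>\<omega>. X' t \<omega> - x - (LBINT s=0..t. b (X' s \<omega>)))"
      if t: "0 \<le> t" for t
    proof (rule has_ito_integral_AE_eq)
      show "has_ito_integral M F W (\<lambda>s \<omega>. a (X s \<omega>)) t (\<lambda>\<omega>. X t \<omega> - x - (LBINT s=0..t. b (X s \<omega>)))"
        using X t by (auto simp: sde_solution_def)
      show "AE \<omega> in M. \<forall>s\<ge>0. a (X s \<omega>) = a (X' s \<omega>)" using X'_eq by (auto elim!: eventually_mono)
      show "AE \<omega> in M. X t \<omega> - x - (LBINT s=0..t. b (X s \<omega>)) = X' t \<omega> - x - (LBINT s=0..t. b (X' s \<omega>))"
        using X'_eq
      proof eventually_elim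
        case (elim \<omega>)
        have "(LBINT s=0..t. b (X s \<omega>)) = (LBINT s=0..t. b (X' s \<omega>))"
          unfolding zero_ereal_def
          by (rule interval_integral_cong) (use elim t in \<open>auto simp: einterval_iff min_def max_def\<close>)
        then show ?case using elim t by simp
      qed
    qed
  qed
  moreover have "AE \<omega> in M. X 0 \<omega> = x" using X by (auto simp: sde_solution_def)
  then have "AE \<omega> in M. X' 0 \<omega> = x" using X'_eq by eventually_elim auto
  ultimately show ?thesis using that X'_eq by blast
qed

end

section \<open>The moment bound\<close>

lemma ennreal_rpow_ennreal: "0 \<le> y \<Longrightarrow> ennreal_rpow (ennreal y) p = ennreal (y powr p)"
  by (simp add: ennreal_rpow_def)

lemma ennreal_rpow_mono:
  assumes "y \<le> z" "0 \<le> p"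
  shows "ennreal_rpow y p \<le> ennreal_rpow z p"
proof (cases "z = \<top>")
  case True
  then show ?thesis by (simp add: ennreal_rpow_def)
next
  case False
  then obtain r where r: "z = ennreal r" "0 \<le> r" by (cases z) auto
  then obtain q where q: "y = ennreal q" "0 \<le> q"
    using assms(1) by (cases y) (auto simp: top_unique)
  then show ?thesis
    using assms r by (simp add: ennreal_rpow_ennreal ennreal_leI powr_mono2)
qed

context transient_coefficients
begin

lemma scale_top_ennreal: "e2ennreal (scale_fun_top a b u) = ennreal (tail u / dens u)"
  by (simp add: scale_fun_top_tail ennreal.rep_eq[symmetric] e2ennreal_ereal)

lemma kernel_right:
  assumes "y \<le> z"
  shows "kernel k y z = 2 * (1 / (a z)\<^sup>2 * (tail z / dens z))"
proof -
  have "hit y z = 1" using tail_antimono[OF assms] tail_pos[of z] by (simp add: hit_def)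
  then show ?thesis by (simp add: kernel_def speed_def mult_ac)
qed

text \<open>Here \<open>hit y z\<close> is the quotient of the tails; writing each tail as
  \<open>\<Phi>\<close> times \<open>dens\<close> and sorting the powers of \<open>dens\<close>
  produces the ratio \<open>dens y / dens z\<close>, which is \<open>\<phi>(z,y)\<close>.\<close>

lemma kernel_left:
  assumes "z \<le> y" "k > 0"
  shows "kernel k y z = 2 * ((tail y / dens y) powr (1 / k) *
    (1 / (a z)\<^sup>2 * (tail z / dens z) powr (1 - 1 / k) * (dens y / dens z) powr (1 / k)))"
proof -
  define p where "p = 1 / real k"
  have pos: "0 < tail y" "0 < tail z" "0 < dens y" "0 < dens z" using tail_pos dens_pos by auto
  have "hit y z = tail y / tail z" using tail_antimono[OF assms(1)] pos by (simp add: hit_def)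
  then have h: "hit y z powr p = tail y powr p / tail z powr p" using pos by (simp add: powr_divide)
  have "(tail y / dens y) powr p * ((tail z / dens z) powr (1 - p) * (dens y / dens z) powr p)
    = (tail y powr p / dens y powr p) * (((tail z / tail z powr p) / (dens z / dens z powr p)) * (dens y powr p / dens z powr p))"
    using pos by (simp add: powr_divide powr_diff)
  also have "\<dots> = tail z / dens z * (tail y powr p / tail z powr p)"
    using pos by (simp add: field_simps)
  finally have e: "tail z / dens z * (tail y powr p / tail z powr p)
    = (tail y / dens y) powr p * ((tail z / dens z) powr (1 - p) * (dens y / dens z) powr p)" by simp
  have "kernel k y z = 2 * (1 / (a z)\<^sup>2 * (tail z / dens z * (tail y powr p / tail z powr p)))"
    unfolding kernel_def p_def[symmetric] h speed_def by (simp add: mult_ac)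
  then show ?thesis unfolding e unfolding p_def by (simp add: mult_ac)
qed

text \<open>The two integrals in \<open>moment_bound\<close> are the parts of one kernel integral:
  to the right of \<open>y\<close>, where \<open>hit\<close> is 1, and to the left, where it is the
  quotient of the tails.\<close>

lemma moment_bound_eq:
  assumes f [measurable]: "f \<in> borel_measurable borel" and k: "k > 0"
  shows "moment_bound a b f k y
    = ennreal (fact k powr (1 / k)) * (\<integral>\<^sup>+ z. ennreal (kernel k y z) * ennreal \<bar>f z\<bar> \<partial>lborel)"
proof -
  define p where "p = 1 / real k"
  have [measurable]: "a \<in> borel_measurable borel" "dens \<in> borel_measurable borel" "tail \<in> borel_measurable borel"
    using a_cont dens_cont tail_cont by (auto intro: borel_measurable_continuous_onI)
  define \<Phi> where "\<Phi> u = tail u / dens u" for u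
  have [measurable]: "\<Phi> \<in> borel_measurable borel" unfolding \<Phi>_def[abs_def] by measurable
  have \<Phi>0: "0 \<le> \<Phi> u" for u using tail_pos[of u] dens_pos[of u] by (simp add: \<Phi>_def)
  define g1 where "g1 z = 1 / (a z)\<^sup>2 * \<Phi> z * \<bar>f z\<bar>" for z
  define g2 where "g2 z = 1 / (a z)\<^sup>2 * \<Phi> z powr (1 - p) * (dens y / dens z) powr p * \<bar>f z\<bar>" for z
  have [measurable]: "g1 \<in> borel_measurable borel" "g2 \<in> borel_measurable borel"
    unfolding g1_def[abs_def] g2_def[abs_def] by measurable
  have g0: "0 \<le> g1 z" "0 \<le> g2 z" for z
    unfolding g1_def g2_def using \<Phi>0[of z] by (auto intro!: mult_nonneg_nonneg)
  have I1: "(\<integral>\<^sup>+ u \<in> {y..}. ennreal (\<bar>f u\<bar> / (a u)\<^sup>2) * ennreal (\<Phi> u) \<partial>lborel) = (\<integral>\<^sup>+ u \<in> {y..}. ennreal (g1 u) \<partial>lborel)"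
    by (rule nn_integral_cong) (simp add: g1_def ennreal_mult[symmetric] \<Phi>0 mult_ac)
  have I2: "(\<integral>\<^sup>+ u \<in> {..y}. ennreal (\<bar>f u\<bar> / (a u)\<^sup>2) * ennreal_rpow (ennreal (\<Phi> u)) (1 - p) * ennreal (scale_density a b u y powr p) \<partial>lborel)
    = (\<integral>\<^sup>+ u \<in> {..y}. ennreal (g2 u) \<partial>lborel)"
    by (rule nn_integral_cong) (simp add: g2_def ennreal_mult[symmetric] ennreal_rpow_ennreal \<Phi>0 scale_density_eq mult_ac)
  have "moment_bound a b f k y = ennreal (2 * fact k powr p) *
      ((\<integral>\<^sup>+ u \<in> {y..}. ennreal (g1 u) \<partial>lborel) + ennreal (\<Phi> y powr p) * (\<integral>\<^sup>+ u \<in> {..y}. ennreal (g2 u) \<partial>lborel))"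
    unfolding moment_bound_def Let_def scale_top_ennreal p_def[symmetric] \<Phi>_def[symmetric] I1 I2
    by (simp add: ennreal_rpow_ennreal \<Phi>0)
  also have "\<dots> = ennreal (fact k powr p) * (ennreal 2 *
      ((\<integral>\<^sup>+ u \<in> {y..}. ennreal (g1 u) \<partial>lborel) + ennreal (\<Phi> y powr p) * (\<integral>\<^sup>+ u \<in> {..y}. ennreal (g2 u) \<partial>lborel)))"
  proof -
    have "ennreal (2 * fact k powr p) = ennreal (fact k powr p) * ennreal 2"
      by (subst ennreal_mult[symmetric]) (simp_all add: mult.commute)
    then show ?thesis by (simp only: mult.assoc)
  qed
  also have "ennreal 2 * ((\<integral>\<^sup>+ u \<in> {y..}. ennreal (g1 u) \<partial>lborel) + ennreal (\<Phi> y powr p) * (\<integral>\<^sup>+ u \<in> {..y}. ennreal (g2 u) \<partial>lborel))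
    = (\<integral>\<^sup>+ z. ennreal 2 * (ennreal (g1 z) * indicator {y..} z + ennreal (\<Phi> y powr p) * (ennreal (g2 z) * indicator {..y} z)) \<partial>lborel)"
    by (simp add: nn_integral_add nn_integral_cmult)
  also have "\<dots> = (\<integral>\<^sup>+ z. ennreal (kernel k y z) * ennreal \<bar>f z\<bar> \<partial>lborel)"
  proof (rule nn_integral_cong_AE)
    \<comment> \<open>Both half-lines contain \<open>y\<close>, so the integrands are compared off
      this point.\<close>
    have "AE z in lborel. z \<noteq> y" by (rule AE_lborel_singleton)
    then show "AE z in lborel. ennreal 2 * (ennreal (g1 z) * indicator {y..} z + ennreal (\<Phi> y powr p) * (ennreal (g2 z) * indicator {..y} z))
      = ennreal (kernel k y z) * ennreal \<bar>f z\<bar>"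
    proof eventually_elim
      case (elim z)
      have K: "ennreal (kernel k y z) * ennreal \<bar>f z\<bar> = ennreal (kernel k y z * \<bar>f z\<bar>)"
        by (rule ennreal_mult[symmetric]) (auto simp: kernel_nonneg)
      from elim consider "y < z" | "z < y" by linarith
      then show ?case
      proof cases
        case 1
        then have eq: "kernel k y z * \<bar>f z\<bar> = 2 * g1 z"
          using kernel_right[of y z k] by (simp add: g1_def \<Phi>_def)
        have "ennreal (2 * g1 z) = ennreal 2 * ennreal (g1 z)" by (rule ennreal_mult) (use g0 in auto)
        then show ?thesis unfolding K eq using 1 by simp
      next
        case 2
        then have eq: "kernel k y z * \<bar>f z\<bar> = 2 * (\<Phi> y powr p * g2 z)"
          using kernel_left[of z y k] k by (simp add: g2_def \<Phi>_def p_def)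
        have "ennreal (2 * (\<Phi> y powr p * g2 z)) = ennreal 2 * ennreal (\<Phi> y powr p * g2 z)"
          by (rule ennreal_mult) (use g0 in auto)
        also have "ennreal (\<Phi> y powr p * g2 z) = ennreal (\<Phi> y powr p) * ennreal (g2 z)"
          by (rule ennreal_mult) (use g0 in auto)
        finally show ?thesis unfolding K eq using 2 by simp
      qed
    qed
  qed
  finally show ?thesis unfolding p_def .
qed

end

theorem theorem4:
  fixes M :: "'a measure" and F :: "real \<Rightarrow> 'a measure"
    and W :: "real \<Rightarrow> 'a \<Rightarrow> real" and X :: "real \<Rightarrow> real \<Rightarrow> 'a \<Rightarrow> real"
    and a b f :: "real \<Rightarrow> real"
  assumes "complete_filtered_prob_space M F"
    and "wiener_process M F W"
    and "continuous_on UNIV a" and "continuous_on UNIV b" and "\<And>x. a x \<noteq> 0"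
    and "\<And>x. sde_solution M F W a b x (X x)"
    and "scale_fun_top a b 0 < \<infinity>" and "scale_fun_bot a b 0 = -\<infinity>"
    and "f \<in> borel_measurable borel"
    and "locally_integrable f" and "locally_integrable (\<lambda>u. f u / (a u)\<^sup>2)"
  shows "\<forall>x. \<forall>k::nat. k > 1 \<longrightarrow>
    (moment_bound a b f k x < \<infinity> \<longrightarrow>
       (AE \<omega> in M. set_integrable lborel {0..} (\<lambda>s. f (X x s \<omega>)))) \<and>
    ennreal_rpow (\<integral>\<^sup>+ \<omega>. ennreal (\<bar>integral_functional (X x) f \<omega>\<bar> ^ k) \<partial>M) (1 / real k)
      \<le> moment_bound a b f k x"
proof (intro allI impI)
  fix x :: real and k :: nat
  assume "k > 1"
  then have k: "k > 0" by simp
  interpret wiener_space M F W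
    using assms(1,2) by (simp add: wiener_space_def wiener_space_axioms_def)
  obtain X' where X': "diffusion_path M F W a b x X'" "AE \<omega> in M. \<forall>t\<ge>0. X' t \<omega> = X x t \<omega>" "AE \<omega> in M. X' 0 \<omega> = x"
    using continuous_modification[OF assms(6,3,4)] by blast
  interpret D: transient_diffusion M F W a b x X'
    using X' assms(3-5,7)
    by (simp add: transient_diffusion_def transient_diffusion_axioms_def transient_coefficients_def)
  note [measurable] = assms(9)
  note [measurable (raw)] = D.X_comp_measurable
  \<comment> \<open>The occupation integral of \<open>\<bar>f\<bar>\<close> with values in
    \<open>[0,\<infinity>]\<close>; it dominates the functional and decides whether the path
    integral exists.\<close>
  let ?A = "\<lambda>\<omega>. \<integral>\<^sup>+ s \<in> {0<..}. ennreal \<bar>f (X' s \<omega>)\<bar> \<partial>lborel"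
  define I where "I = D.kernel_norm k (\<lambda>z. \<bar>f z\<bar>) x"
  have E: "(\<integral>\<^sup>+ \<omega>. ?A \<omega> ^ k \<partial>M) \<le> ennreal (fact k) * I ^ k"
    unfolding I_def by (rule D.measurable_occupation_bound) auto
  have mb: "moment_bound a b f k x = ennreal (fact k powr (1 / k)) * I"
    unfolding I_def D.kernel_norm_def by (rule D.moment_bound_eq[OF assms(9) k])
  have fk: "0 < (fact k :: real) powr (1 / k)" by simp
  have A_closed: "(\<integral>\<^sup>+ s \<in> {0..}. ennreal \<bar>f (X' s \<omega>)\<bar> \<partial>lborel) = ?A \<omega>" for \<omega>
  proof (rule nn_integral_cong_AE)
    have "AE s in lborel. s \<noteq> (0::real)" by (rule AE_lborel_singleton)
    then show "AE s in lborel. ennreal \<bar>f (X' s \<omega>)\<bar> * indicator {0..} s = ennreal \<bar>f (X' s \<omega>)\<bar> * indicator {0<..} s"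
      by eventually_elim (auto simp: indicator_def)
  qed
  have path: "(\<lambda>s. indicator {0..} s *\<^sub>R f (X x s \<omega>)) = (\<lambda>s. indicator {0..} s *\<^sub>R f (X' s \<omega>))"
    if "\<forall>t\<ge>0. X' t \<omega> = X x t \<omega>" for \<omega>
    using that by (auto simp: fun_eq_iff indicator_def)
  have path_meas: "(\<lambda>s. indicator {0..} s *\<^sub>R f (X' s \<omega>)) \<in> borel_measurable lborel" if "\<omega> \<in> space M" for \<omega>
    using D.X_path_measurable[OF that] by measurable
  have path_norm: "(\<integral>\<^sup>+ s. ennreal (norm (indicator {0..} s *\<^sub>R f (X' s \<omega>))) \<partial>lborel) = ?A \<omega>" for \<omega>
    unfolding A_closed[symmetric] by (intro nn_integral_cong) (simp add: indicator_def)
  show "(moment_bound a b f k x < \<infinity> \<longrightarrow>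
       (AE \<omega> in M. set_integrable lborel {0..} (\<lambda>s. f (X x s \<omega>)))) \<and>
    ennreal_rpow (\<integral>\<^sup>+ \<omega>. ennreal (\<bar>integral_functional (X x) f \<omega>\<bar> ^ k) \<partial>M) (1 / real k)
      \<le> moment_bound a b f k x"
  proof (intro conjI impI)
    \<comment> \<open>A finite bound makes the k-th moment of \<open>?A\<close> finite, hence
      \<open>?A\<close> finite almost surely, which is integrability along the path.\<close>
    assume "moment_bound a b f k x < \<infinity>"
    then have "I < \<top>"
      unfolding mb using fk by (auto simp: ennreal_mult_less_top)
    then have "ennreal (fact k) * I ^ k < \<top>"
      by (simp add: ennreal_mult_less_top power_less_top_ennreal)
    then have "(\<integral>\<^sup>+ \<omega>. ?A \<omega> ^ k \<partial>M) \<noteq> \<infinity>" using E by auto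
    then have "AE \<omega> in M. ?A \<omega> ^ k \<noteq> \<infinity>"
      by (intro nn_integral_PInf_AE) measurable
    then show "AE \<omega> in M. set_integrable lborel {0..} (\<lambda>s. f (X x s \<omega>))"
      using X'(2) AE_space
    proof eventually_elim
      case (elim \<omega>)
      then have fin: "?A \<omega> < \<infinity>" using k by (auto simp: power_eq_top_ennreal less_top)
      then show ?case
        unfolding set_integrable_def path[OF elim(2)]
        by (intro integrableI_bounded path_meas[OF elim(3)]) (simp only: path_norm fin)
    qed
  next
    have "(\<integral>\<^sup>+ \<omega>. ennreal (\<bar>integral_functional (X x) f \<omega>\<bar> ^ k) \<partial>M) \<le> (\<integral>\<^sup>+ \<omega>. ?A \<omega> ^ k \<partial>M)"
    proof (rule nn_integral_mono_AE)
      show "AE \<omega> in M. ennreal (\<bar>integral_functional (X x) f \<omega>\<bar> ^ k) \<le> ?A \<omega> ^ k"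
        using X'(2)
      proof eventually_elim
        case (elim \<omega>)
        have "ennreal \<bar>integral_functional (X x) f \<omega>\<bar> \<le> ?A \<omega>"
          unfolding integral_functional_def set_lebesgue_integral_def path[OF elim]
        \<comment> \<open>Without integrability the functional is 0 by convention, and the
          inequality is trivial.\<close>
        proof (cases "integrable lborel (\<lambda>s. indicator {0..} s *\<^sub>R f (X' s \<omega>))")
          case True
          then show "ennreal \<bar>LINT s|lborel. indicator {0..} s *\<^sub>R f (X' s \<omega>)\<bar> \<le> ?A \<omega>"
            using integral_norm_bound_ennreal[OF True] unfolding path_norm by simp
        qed (simp add: not_integrable_integral_eq)
        then show ?case by (simp add: ennreal_power[symmetric] power_mono)
      qed
    qed
    also note E
    finally have le: "ennreal_rpow (\<integral>\<^sup>+ \<omega>. ennreal (\<bar>integral_functional (X x) f \<omega>\<bar> ^ k) \<partial>M) (1 / real k)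
      \<le> ennreal_rpow (ennreal (fact k) * I ^ k) (1 / real k)"
      by (rule ennreal_rpow_mono) simp
    show "ennreal_rpow (\<integral>\<^sup>+ \<omega>. ennreal (\<bar>integral_functional (X x) f \<omega>\<bar> ^ k) \<partial>M) (1 / real k)
      \<le> moment_bound a b f k x"
    \<comment> \<open>\<open>ennreal_rpow\<close> acts through real powers, so the infinite case is
      treated apart.\<close>
    proof (cases "I = \<top>")
      case True
      then show ?thesis unfolding mb using fk by (simp add: ennreal_mult_top)
    next
      case False
      then obtain r where r: "I = ennreal r" "0 \<le> r" by (cases I) auto
      have "(r ^ k) powr (1 / k) = r"
        using r(2) k by (cases "r = 0") (simp_all add: powr_realpow[symmetric] powr_powr)
      then have "(fact k * r ^ k) powr (1 / k) = fact k powr (1 / k) * r"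
        using r(2) by (simp add: powr_mult)
      moreover have "ennreal (fact k) * I ^ k = ennreal (fact k * r ^ k)"
        unfolding r(1) ennreal_power[OF r(2)] using r(2) by (intro ennreal_mult[symmetric]) auto
      ultimately have "ennreal_rpow (ennreal (fact k) * I ^ k) (1 / real k) = ennreal (fact k powr (1 / k) * r)"
        using r(2) by (simp add: ennreal_rpow_ennreal)
      also have "\<dots> = moment_bound a b f k x"
        unfolding mb r(1) using r(2) by (intro ennreal_mult) auto
      finally show ?thesis using le by simp
    qed
  qed
qed

end
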